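(* Let $A$ and $B$ be rings, let ${}_B\Sigma_A$ be a $(B,A)$-bimodule with $\Sigma_A$ finitely generated and projective, and let $S=\mathrm{End}(\Sigma_A)$. Consider the comatrix $A$-coring $\Sigma^*\otimes_B\Sigma$, the Sweedler $S$-coring $S\otimes_B S$ and the functors $-\otimes_S\Sigma:\mathcal{M}^{S\otimes_BS}\to\mathcal{M}^{\Sigma^*\otimes_B\Sigma}$ and $-\otimes_A\Sigma^*:\mathcal{M}^{\Sigma^*\otimes_B\Sigma}\to\mathcal{M}^{S\otimes_BS}$ described in the context. For every right $S\otimes_BS$-comodule $(Y,\rho_Y)$ and every right $\Sigma^*\otimes_B\Sigma$-comodule $(X,\rho_X)$, the $K$-linear map $$\Psi_{Y,X}:\mathrm{Hom}_{\Sigma^*\otimes_B\Sigma}(Y\otimes_S\Sigma,X)\longrightarrow \mathrm{Hom}_{S\otimes_BS}(Y,X\otimes_A\Sigma^* ),\qquad f\longmapsto (f\otimes_A\Sigma^* )\circ(Y\otimes_S\xi^{-1})\circ\iota'_Y$$ is a natural isomorphism, with inverse $$g\longmapsto (X\otimes_A\varepsilon')\circ(g\otimes_S\Sigma)$$ (identifying $X\otimes_AA=X$), where $\varepsilon':\Sigma^*\otimes_S\Sigma\to A$, $u^*\otimes_Su\mapsto u^*(u)$, is the counit of the comatrix $A$-coring $\Sigma^*\otimes_S\Sigma$. In other words, $-\otimes_S\Sigma$ is left adjoint to $-\otimes_A\Sigma^*$.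
   Context: All rings are unital algebras over a commutative ring $K$, modules are unital, and bimodules are central over $K$. An identity map is denoted by its object. An $A$-coring is an $A$-bimodule $\mathfrak{C}$ with $A$-bilinear maps $\Delta:\mathfrak{C}\to\mathfrak{C}\otimes_A\mathfrak{C}$, $\varepsilon:\mathfrak{C}\to A$ satisfying coassociativity and the counit axioms. A right $\mathfrak{C}$-comodule is a right $A$-module $M$ with a right $A$-linear coaction $\rho_M:M\to M\otimes_A\mathfrak{C}$ that is coassociative and counital. $\mathcal{M}^{\mathfrak{C}}$ is the category of right $\mathfrak{C}$-comodules, and $\mathrm{Hom}_{\mathfrak{C}}(-,-)$ denotes colinear maps (i.e. $A$-linear maps commuting with coactions). $\Sigma^*=\mathrm{Hom}(\Sigma_A,A_A)$ is an $(A,B)$-bimodule and $\{(e_i,e_i^* )\}_i\subset\Sigma\times\Sigma^*$ is a finite dual basis of $\Sigma_A$. The comatrix $A$-coring $\Sigma^*\otimes_B\Sigma$ has $\Delta(u^*\otimes_B u)=\sum_i u^*\otimes_B e_i\otimes_A e_i^*\otimes_B u$ and $\varepsilon(u^*\otimes_B u)=u^*(u)$ (independent of the dual basis). $\Sigma^*\otimes_S\Sigma$ is the analogous $A$-coring with $B$ replaced by $S$. $S=\mathrm{End}(\Sigma_A)$ (composition) acts on the left of $\Sigma$ and on the right of $\Sigma^*$ by $u^*s=u^*\circ s$; there is a canonical ring map $B\to S$. The $S$-bimodule isomorphism $\xi:\Sigma\otimes_A\Sigma^*\to S$ sends $u\otimes_Av^*$ to $[x\mapsto u\,v^*(x)]$;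 its inverse is $s\mapsto\sum_i se_i\otimes_Ae_i^*=\sum_ie_i\otimes_Ae_i^*s$. For a right $S$-module $Y$, $\iota'_Y:Y\to Y\otimes_SS$ is the natural isomorphism $y\mapsto y\otimes_S1$. The Sweedler $S$-coring $S\otimes_BS$ has comultiplication $s\otimes_Bs'\mapsto (s\otimes_B1)\otimes_S(1\otimes_Bs')$ and counit given by multiplication. The functor $-\otimes_S\Sigma:\mathcal{M}^{S\otimes_BS}\to\mathcal{M}^{\Sigma^*\otimes_B\Sigma}$: for $(Y,\rho_Y)$ with $\rho_Y(y)=\sum y_{(0)}\otimes_S1\otimes_By_{(1)}$, the coaction on $Y\otimes_S\Sigma$ is $\rho(y\otimes_Su)=\sum_{i}\sum y_{(0)}\otimes_Se_i\otimes_Ae_i^*\otimes_By_{(1)}u$; on morphisms $f\mapsto f\otimes_S\Sigma$. The functor $-\otimes_A\Sigma^*:\mathcal{M}^{\Sigma^*\otimes_B\Sigma}\to\mathcal{M}^{S\otimes_BS}$: for $(X,\rho_X)$, the coaction on $X\otimes_A\Sigma^*$ is the composite $$X\otimes_A\Sigma^*\xrightarrow{\rho_X\otimes_A\Sigma^*}X\otimes_A\Sigma^*\otimes_B\Sigma\otimes_A\Sigma^*\xrightarrow{X\otimes_A\Sigma^*\otimes_B\xi}X\otimes_A\Sigma^*\otimes_BS\cong X\otimes_A\Sigma^*\otimes_SS\otimes_BS,$$ the last isomorphism being $x\otimes u^*\otimes_B s\mapsto x\otimes u^*\otimes_S1\otimes_Bs$; on morphisms $g\mapsto g\otimes_A\Sigma^*$.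 *)

theory Defs
  imports "HOL-Algebra.Module" "HOL-Algebra.Free_Abelian_Groups"
begin

section \<open>Algebras, modules and bimodules\<close>

text \<open>The locale \<^locale>\<open>algebra\<close> of the library is restricted to commutative algebras, and
  \<^locale>\<open>module\<close> to modules over commutative rings.\<close>

locale unital_algebra = module K A + Alg?: ring A for K (structure) and A (structure) +
  assumes smult_mult_left:
      "\<lbrakk>k \<in> carrier K; x \<in> carrier A; y \<in> carrier A\<rbrakk>
        \<Longrightarrow> (k \<odot>\<^bsub>A\<^esub> x) \<otimes>\<^bsub>A\<^esub> y = k \<odot>\<^bsub>A\<^esub> (x \<otimes>\<^bsub>A\<^esub> y)"
    and smult_mult_right:
      "\<lbrakk>k \<in> carrier K; x \<in> carrier A; y \<in> carrier A\<rbrakk>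
        \<Longrightarrow> x \<otimes>\<^bsub>A\<^esub> (k \<odot>\<^bsub>A\<^esub> y) = k \<odot>\<^bsub>A\<^esub> (x \<otimes>\<^bsub>A\<^esub> y)"

text \<open>As for \<^type>\<open>module\<close>, the fields \<^const>\<open>monoid.mult\<close> and \<^const>\<open>monoid.one\<close> of these
  records carry no information.\<close>

record ('r, 'm) rmod = "'m ring" +
  ract :: "'m \<Rightarrow> 'r \<Rightarrow> 'm" (infixl \<open>\<triangleleft>\<index>\<close> 72)

record ('l, 'r, 'm) bimod = "('r, 'm) rmod" +
  lact :: "'l \<Rightarrow> 'm \<Rightarrow> 'm" (infixr \<open>\<triangleright>\<index>\<close> 73)

locale right_module = Alg?: ring A + M?: abelian_group M for A (structure) and M (structure) +
  assumes ract_closed: "\<lbrakk>m \<in> carrier M; a \<in> carrier A\<rbrakk> \<Longrightarrow> m \<triangleleft>\<^bsub>M\<^esub> a \<in> carrier M"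
    and ract_add_left: "\<lbrakk>m \<in> carrier M; m' \<in> carrier M; a \<in> carrier A\<rbrakk>
        \<Longrightarrow> (m \<oplus>\<^bsub>M\<^esub> m') \<triangleleft>\<^bsub>M\<^esub> a = m \<triangleleft>\<^bsub>M\<^esub> a \<oplus>\<^bsub>M\<^esub> m' \<triangleleft>\<^bsub>M\<^esub> a"
    and ract_add_right: "\<lbrakk>m \<in> carrier M; a \<in> carrier A; a' \<in> carrier A\<rbrakk>
        \<Longrightarrow> m \<triangleleft>\<^bsub>M\<^esub> (a \<oplus>\<^bsub>A\<^esub> a') = m \<triangleleft>\<^bsub>M\<^esub> a \<oplus>\<^bsub>M\<^esub> m \<triangleleft>\<^bsub>M\<^esub> a'"
    and ract_mult: "\<lbrakk>m \<in> carrier M; a \<in> carrier A; a' \<in> carrier A\<rbrakk>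
        \<Longrightarrow> m \<triangleleft>\<^bsub>M\<^esub> (a \<otimes>\<^bsub>A\<^esub> a') = m \<triangleleft>\<^bsub>M\<^esub> a \<triangleleft>\<^bsub>M\<^esub> a'"
    and ract_one: "m \<in> carrier M \<Longrightarrow> m \<triangleleft>\<^bsub>M\<^esub> \<one>\<^bsub>A\<^esub> = m"

text \<open>A bimodule over the \<open>K\<close>-algebras \<open>R\<close> (left) and \<open>T\<close> (right), central over \<open>K\<close>.\<close>

locale central_bimodule = L: unital_algebra K R + T: unital_algebra K T + right_module T M
  for K (structure) and R (structure) and T (structure) and M (structure) +
  assumes lact_closed: "\<lbrakk>r \<in> carrier R; m \<in> carrier M\<rbrakk> \<Longrightarrow> r \<triangleright>\<^bsub>M\<^esub> m \<in> carrier M"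
    and lact_add_right: "\<lbrakk>r \<in> carrier R; m \<in> carrier M; m' \<in> carrier M\<rbrakk>
        \<Longrightarrow> r \<triangleright>\<^bsub>M\<^esub> (m \<oplus>\<^bsub>M\<^esub> m') = (r \<triangleright>\<^bsub>M\<^esub> m) \<oplus>\<^bsub>M\<^esub> (r \<triangleright>\<^bsub>M\<^esub> m')"
    and lact_add_left: "\<lbrakk>r \<in> carrier R; r' \<in> carrier R; m \<in> carrier M\<rbrakk>
        \<Longrightarrow> (r \<oplus>\<^bsub>R\<^esub> r') \<triangleright>\<^bsub>M\<^esub> m = (r \<triangleright>\<^bsub>M\<^esub> m) \<oplus>\<^bsub>M\<^esub> (r' \<triangleright>\<^bsub>M\<^esub> m)"
    and lact_mult: "\<lbrakk>r \<in> carrier R; r' \<in> carrier R; m \<in> carrier M\<rbrakk>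
        \<Longrightarrow> (r \<otimes>\<^bsub>R\<^esub> r') \<triangleright>\<^bsub>M\<^esub> m = r \<triangleright>\<^bsub>M\<^esub> (r' \<triangleright>\<^bsub>M\<^esub> m)"
    and lact_one: "m \<in> carrier M \<Longrightarrow> \<one>\<^bsub>R\<^esub> \<triangleright>\<^bsub>M\<^esub> m = m"
    and lact_ract: "\<lbrakk>r \<in> carrier R; m \<in> carrier M; t \<in> carrier T\<rbrakk>
        \<Longrightarrow> (r \<triangleright>\<^bsub>M\<^esub> m) \<triangleleft>\<^bsub>M\<^esub> t = r \<triangleright>\<^bsub>M\<^esub> (m \<triangleleft>\<^bsub>M\<^esub> t)"
    and central: "\<lbrakk>k \<in> carrier K; m \<in> carrier M\<rbrakk>
        \<Longrightarrow> (k \<odot>\<^bsub>R\<^esub> \<one>\<^bsub>R\<^esub>) \<triangleright>\<^bsub>M\<^esub> m = m \<triangleleft>\<^bsub>M\<^esub> (k \<odot>\<^bsub>T\<^esub> \<one>\<^bsub>T\<^esub>)"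

definition right_linear ::
  "('r, 'x) ring_scheme \<Rightarrow> ('r, 'm, 'y) rmod_scheme \<Rightarrow> ('r, 'n, 'z) rmod_scheme \<Rightarrow> ('m \<Rightarrow> 'n) \<Rightarrow> bool"
  where "right_linear A M N f \<longleftrightarrow>
    f \<in> carrier M \<rightarrow> carrier N \<and>
    (\<forall>x\<in>carrier M. \<forall>y\<in>carrier M. f (x \<oplus>\<^bsub>M\<^esub> y) = f x \<oplus>\<^bsub>N\<^esub> f y) \<and>
    (\<forall>x\<in>carrier M. \<forall>a\<in>carrier A. f (x \<triangleleft>\<^bsub>M\<^esub> a) = f x \<triangleleft>\<^bsub>N\<^esub> a)"

definition bilinear_map ::
  "('l, 'w) ring_scheme \<Rightarrow> ('r, 'x) ring_scheme \<Rightarrow> ('l, 'r, 'm, 'y) bimod_scheme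
    \<Rightarrow> ('l, 'r, 'n, 'z) bimod_scheme \<Rightarrow> ('m \<Rightarrow> 'n) \<Rightarrow> bool"
  where "bilinear_map R T M N f \<longleftrightarrow>
    right_linear T M N f \<and>
    (\<forall>r\<in>carrier R. \<forall>x\<in>carrier M. f (r \<triangleright>\<^bsub>M\<^esub> x) = r \<triangleright>\<^bsub>N\<^esub> f x)"

text \<open>Linear maps that are collected in Hom-sets are made extensional, so that equality of
  elements of a Hom-set is equality of maps.\<close>

definition Lin ::
  "('r, 'x) ring_scheme \<Rightarrow> ('r, 'm, 'y) rmod_scheme \<Rightarrow> ('r, 'n, 'z) rmod_scheme \<Rightarrow> ('m \<Rightarrow> 'n) set"
  where "Lin A M N = {f \<in> extensional (carrier M). right_linear A M N f}"

definition regular :: "('a, 'x) ring_scheme \<Rightarrow> ('a, 'a, 'a) bimod" where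
  "regular A = \<lparr>carrier = carrier A, mult = mult A, one = \<one>\<^bsub>A\<^esub>, ring.zero = \<zero>\<^bsub>A\<^esub>, add = add A,
     ract = mult A, lact = mult A\<rparr>"

section \<open>Tensor products\<close>

text \<open>The tensor product \<open>M \<otimes>\<^sub>R N\<close> of a right \<open>R\<close>-module and a left \<open>R\<close>-module is the quotient of
  the free abelian group on \<open>M \<times> N\<close> by the subgroup generated by the usual relators.\<close>

definition tensor_free ::
  "('r, 'm, 'y) rmod_scheme \<Rightarrow> ('r, 's, 'n, 'z) bimod_scheme \<Rightarrow> ('m \<times> 'n \<Rightarrow>\<^sub>0 int) monoid"
  where "tensor_free M N = free_Abelian_group (carrier M \<times> carrier N)"

definition tensor_relators ::
  "('r, 'x) ring_scheme \<Rightarrow> ('r, 'm, 'y) rmod_scheme \<Rightarrow> ('r, 's, 'n, 'z) bimod_scheme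
    \<Rightarrow> ('m \<times> 'n \<Rightarrow>\<^sub>0 int) set"
  where "tensor_relators R M N =
    {frag_of (m \<oplus>\<^bsub>M\<^esub> m', n) - frag_of (m, n) - frag_of (m', n) | m m' n.
       m \<in> carrier M \<and> m' \<in> carrier M \<and> n \<in> carrier N} \<union>
    {frag_of (m, n \<oplus>\<^bsub>N\<^esub> n') - frag_of (m, n) - frag_of (m, n') | m n n'.
       m \<in> carrier M \<and> n \<in> carrier N \<and> n' \<in> carrier N} \<union>
    {frag_of (m \<triangleleft>\<^bsub>M\<^esub> r, n) - frag_of (m, r \<triangleright>\<^bsub>N\<^esub> n) | m r n.
       m \<in> carrier M \<and> r \<in> carrier R \<and> n \<in> carrier N}"

definition tensor_null ::
  "('r, 'x) ring_scheme \<Rightarrow> ('r, 'm, 'y) rmod_scheme \<Rightarrow> ('r, 's, 'n, 'z) bimod_scheme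
    \<Rightarrow> ('m \<times> 'n \<Rightarrow>\<^sub>0 int) set"
  where "tensor_null R M N = generate (tensor_free M N) (tensor_relators R M N)"

definition tens ::
  "('r, 'x) ring_scheme \<Rightarrow> ('r, 'm, 'y) rmod_scheme \<Rightarrow> ('r, 's, 'n, 'z) bimod_scheme
    \<Rightarrow> 'm \<Rightarrow> 'n \<Rightarrow> ('m \<times> 'n \<Rightarrow>\<^sub>0 int) set"
  where "tens R M N m n = tensor_null R M N #>\<^bsub>tensor_free M N\<^esub> frag_of (m, n)"

definition tensor_group ::
  "('r, 'x) ring_scheme \<Rightarrow> ('r, 'm, 'y) rmod_scheme \<Rightarrow> ('r, 's, 'n, 'z) bimod_scheme
    \<Rightarrow> ('m \<times> 'n \<Rightarrow>\<^sub>0 int) set ring"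
  where "tensor_group R M N = (let Q = tensor_free M N Mod tensor_null R M N in
    \<lparr>carrier = carrier Q, mult = undefined, one = undefined, ring.zero = \<one>\<^bsub>Q\<^esub>, add = mult Q\<rparr>)"

text \<open>\<open>tensor_lift G \<phi>\<close> is the homomorphism into the abelian group \<open>G\<close> induced by a balanced
  biadditive map \<open>\<phi>\<close>; it sends the class of \<open>\<Sum>\<^sub>p c\<^sub>p (m\<^sub>p, n\<^sub>p)\<close> to \<open>\<Sum>\<^sub>p c\<^sub>p \<phi> m\<^sub>p n\<^sub>p\<close>. It is only
  meaningful for balanced biadditive \<open>\<phi>\<close>, when the chosen representative does not matter.\<close>

definition tensor_lift ::
  "('g, 'x) ring_scheme \<Rightarrow> ('m \<Rightarrow> 'n \<Rightarrow> 'g) \<Rightarrow> ('m \<times> 'n \<Rightarrow>\<^sub>0 int) set \<Rightarrow> 'g"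
  where "tensor_lift G \<phi> t = (let c = (SOME c. c \<in> t) in
    \<Oplus>\<^bsub>G\<^esub> p \<in> Poly_Mapping.keys c. [Poly_Mapping.lookup c p] \<cdot>\<^bsub>G\<^esub> \<phi> (fst p) (snd p))"

text \<open>\<open>M \<otimes>\<^sub>R N\<close> as a right module if \<open>N\<close> is a bimodule, and as a bimodule if \<open>M\<close> is one as well.\<close>

definition rtensor ::
  "('r, 'x) ring_scheme \<Rightarrow> ('r, 'm, 'y) rmod_scheme \<Rightarrow> ('r, 's, 'n, 'z) bimod_scheme
    \<Rightarrow> ('s, ('m \<times> 'n \<Rightarrow>\<^sub>0 int) set) rmod"
  where "rtensor R M N = ring.extend (tensor_group R M N)
    (rmod.fields (\<lambda>t s. tensor_lift (tensor_group R M N) (\<lambda>m n. tens R M N m (n \<triangleleft>\<^bsub>N\<^esub> s)) t))"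

definition btensor ::
  "('r, 'x) ring_scheme \<Rightarrow> ('l, 'r, 'm, 'y) bimod_scheme \<Rightarrow> ('r, 's, 'n, 'z) bimod_scheme
    \<Rightarrow> ('l, 's, ('m \<times> 'n \<Rightarrow>\<^sub>0 int) set) bimod"
  where "btensor R M N = rmod.extend (rtensor R M N)
    (bimod.fields (\<lambda>l t. tensor_lift (tensor_group R M N) (\<lambda>m n. tens R M N (l \<triangleright>\<^bsub>M\<^esub> m) n) t))"

text \<open>The map \<open>f \<otimes>\<^sub>R g : M \<otimes>\<^sub>R N \<rightarrow> M' \<otimes>\<^sub>R N'\<close>.\<close>

definition tensor_map ::
  "('r, 'x) ring_scheme \<Rightarrow> ('r, 'm, 'y) rmod_scheme \<Rightarrow> ('r, 's, 'n, 'z) bimod_scheme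
    \<Rightarrow> ('r, 'm2, 'y2) rmod_scheme \<Rightarrow> ('r, 's2, 'n2, 'z2) bimod_scheme
    \<Rightarrow> ('m \<Rightarrow> 'm2) \<Rightarrow> ('n \<Rightarrow> 'n2)
    \<Rightarrow> ('m \<times> 'n \<Rightarrow>\<^sub>0 int) set \<Rightarrow> ('m2 \<times> 'n2 \<Rightarrow>\<^sub>0 int) set"
  where "tensor_map R M N M' N' f g =
    (\<lambda>t\<in>carrier (rtensor R M N).
       tensor_lift (rtensor R M' N') (\<lambda>m n. tens R M' N' (f m) (g n)) t)"

text \<open>The canonical isomorphisms \<open>(M \<otimes>\<^sub>R N) \<otimes>\<^sub>T P \<cong> M \<otimes>\<^sub>R (N \<otimes>\<^sub>T P)\<close>, \<open>M \<otimes>\<^sub>A A \<cong> M\<close> and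
  \<open>A \<otimes>\<^sub>A M \<cong> M\<close>.\<close>

definition tensor_assoc ::
  "('r, 'x) ring_scheme \<Rightarrow> ('t, 'w) ring_scheme \<Rightarrow> ('r, 'm, 'y) rmod_scheme
    \<Rightarrow> ('r, 't, 'n, 'z) bimod_scheme \<Rightarrow> ('t, 's, 'p, 'v) bimod_scheme
    \<Rightarrow> (('m \<times> 'n \<Rightarrow>\<^sub>0 int) set \<times> 'p \<Rightarrow>\<^sub>0 int) set \<Rightarrow> ('m \<times> ('n \<times> 'p \<Rightarrow>\<^sub>0 int) set \<Rightarrow>\<^sub>0 int) set"
  where "tensor_assoc R T M N P =
    tensor_lift (rtensor R M (btensor T N P))
      (\<lambda>q p. tensor_lift (rtensor R M (btensor T N P))
        (\<lambda>m n. tens R M (btensor T N P) m (tens T N P n p)) q)"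

definition tensor_assoc_inv ::
  "('r, 'x) ring_scheme \<Rightarrow> ('t, 'w) ring_scheme \<Rightarrow> ('r, 'm, 'y) rmod_scheme
    \<Rightarrow> ('r, 't, 'n, 'z) bimod_scheme \<Rightarrow> ('t, 's, 'p, 'v) bimod_scheme
    \<Rightarrow> ('m \<times> ('n \<times> 'p \<Rightarrow>\<^sub>0 int) set \<Rightarrow>\<^sub>0 int) set \<Rightarrow> (('m \<times> 'n \<Rightarrow>\<^sub>0 int) set \<times> 'p \<Rightarrow>\<^sub>0 int) set"
  where "tensor_assoc_inv R T M N P =
    tensor_lift (rtensor T (rtensor R M N) P)
      (\<lambda>m q. tensor_lift (rtensor T (rtensor R M N) P)
        (\<lambda>n p. tens T (rtensor R M N) P (tens R M N m n) p) q)"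

definition tensor_runit :: "('r, 'm, 'y) rmod_scheme \<Rightarrow> ('m \<times> 'r \<Rightarrow>\<^sub>0 int) set \<Rightarrow> 'm" where
  "tensor_runit M = tensor_lift M (\<lambda>m a. m \<triangleleft>\<^bsub>M\<^esub> a)"

definition tensor_lunit :: "('l, 'r, 'm, 'y) bimod_scheme \<Rightarrow> ('l \<times> 'm \<Rightarrow>\<^sub>0 int) set \<Rightarrow> 'm" where
  "tensor_lunit M = tensor_lift M (\<lambda>a m. a \<triangleright>\<^bsub>M\<^esub> m)"

section \<open>Corings and comodules\<close>

record ('a, 'c) coring = "('a, 'a, 'c) bimod" +
  comult :: "'c \<Rightarrow> ('c \<times> 'c \<Rightarrow>\<^sub>0 int) set"
  counit :: "'c \<Rightarrow> 'a"

locale coring = central_bimodule K A A C for K (structure) and A (structure) and C (structure) +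
  assumes comult_bilinear: "bilinear_map A A C (btensor A C C) (comult C)"
    and counit_bilinear: "bilinear_map A A C (regular A) (counit C)"
    and coassoc: "c \<in> carrier C \<Longrightarrow>
      tensor_assoc A A C C C
        (tensor_map A C C (btensor A C C) C (comult C) (\<lambda>x. x) (comult C c))
      = tensor_map A C C C (btensor A C C) (\<lambda>x. x) (comult C) (comult C c)"
    and counit_left: "c \<in> carrier C \<Longrightarrow>
      tensor_lunit C (tensor_map A C C (regular A) C (counit C) (\<lambda>x. x) (comult C c)) = c"
    and counit_right: "c \<in> carrier C \<Longrightarrow>
      tensor_runit C (tensor_map A C C C (regular A) (\<lambda>x. x) (counit C) (comult C c)) = c"

text \<open>\<open>'c\<close> is the type of the elements of the coring. The locale \<open>comodule\<close> does not itself require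
  \<open>C\<close> to be a coring.\<close>

record ('a, 'c, 'm) comod = "('a, 'm) rmod" +
  coact :: "'m \<Rightarrow> ('m \<times> 'c \<Rightarrow>\<^sub>0 int) set"

locale comodule = right_module A M for A (structure) and C and M (structure) +
  assumes coact_linear: "right_linear A M (rtensor A M C) (coact M)"
    and coact_coassoc: "m \<in> carrier M \<Longrightarrow>
      tensor_assoc A A M C C
        (tensor_map A M C (rtensor A M C) C (coact M) (\<lambda>x. x) (coact M m))
      = tensor_map A M C M (btensor A C C) (\<lambda>x. x) (comult C) (coact M m)"
    and coact_counit: "m \<in> carrier M \<Longrightarrow>
      tensor_runit M (tensor_map A M C M (regular A) (\<lambda>x. x) (counit C) (coact M m)) = m"

text \<open>The set of colinear maps \<open>M \<rightarrow> N\<close>. Its \<open>K\<close>-module structure uses the \<open>K\<close>-action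
  \<open>k x = x (k 1\<^sub>A)\<close> that every right module over the \<open>K\<close>-algebra \<open>A\<close> has.\<close>

definition colinear_maps ::
  "('a, 'x) ring_scheme \<Rightarrow> ('a, 'c, 'w) coring_scheme \<Rightarrow> ('a, 'c, 'm, 'y) comod_scheme
    \<Rightarrow> ('a, 'c, 'n, 'z) comod_scheme \<Rightarrow> ('m \<Rightarrow> 'n) set"
  where "colinear_maps A C M N = {f \<in> Lin A M N.
    \<forall>m\<in>carrier M. coact N (f m) = tensor_map A M C N C f (\<lambda>x. x) (coact M m)}"

definition Hom_comod ::
  "('k, 'a, 'x) module_scheme \<Rightarrow> ('a, 'c, 'w) coring_scheme \<Rightarrow> ('a, 'c, 'm, 'y) comod_scheme
    \<Rightarrow> ('a, 'c, 'n, 'z) comod_scheme \<Rightarrow> ('k, 'm \<Rightarrow> 'n) module"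
  where "Hom_comod A C M N =
    \<lparr>carrier = colinear_maps A C M N, mult = undefined, one = undefined,
     ring.zero = (\<lambda>m\<in>carrier M. \<zero>\<^bsub>N\<^esub>),
     add = (\<lambda>f g. \<lambda>m\<in>carrier M. f m \<oplus>\<^bsub>N\<^esub> g m),
     smult = (\<lambda>k f. \<lambda>m\<in>carrier M. f m \<triangleleft>\<^bsub>N\<^esub> (k \<odot>\<^bsub>A\<^esub> \<one>\<^bsub>A\<^esub>))\<rparr>"

definition linear_iso ::
  "('k, 'x) ring_scheme \<Rightarrow> ('k, 'v, 'y) module_scheme \<Rightarrow> ('k, 'w, 'z) module_scheme
    \<Rightarrow> ('v \<Rightarrow> 'w) \<Rightarrow> bool"
  where "linear_iso K V W \<phi> \<longleftrightarrow>
    module K V \<and> module K W \<and> bij_betw \<phi> (carrier V) (carrier W) \<and>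
    (\<forall>f\<in>carrier V. \<forall>g\<in>carrier V. \<phi> (f \<oplus>\<^bsub>V\<^esub> g) = \<phi> f \<oplus>\<^bsub>W\<^esub> \<phi> g) \<and>
    (\<forall>k\<in>carrier K. \<forall>f\<in>carrier V. \<phi> (k \<odot>\<^bsub>V\<^esub> f) = k \<odot>\<^bsub>W\<^esub> \<phi> f)"

section \<open>Finitely generated projective modules, duals and endomorphism rings\<close>

definition finitely_generated :: "('a, 'x) ring_scheme \<Rightarrow> ('a, 'm, 'y) rmod_scheme \<Rightarrow> bool" where
  "finitely_generated A M \<longleftrightarrow> (\<exists>G. finite G \<and> G \<subseteq> carrier M \<and>
     (\<forall>m\<in>carrier M. \<exists>c\<in>G \<rightarrow> carrier A. m = (\<Oplus>\<^bsub>M\<^esub> g\<in>G. g \<triangleleft>\<^bsub>M\<^esub> c g)))"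

text \<open>The free right module \<open>A\<^bsup>(I)\<^esup>\<close>.\<close>

definition free_rmod :: "('a, 'x) ring_scheme \<Rightarrow> 'i set \<Rightarrow> ('a, 'i \<Rightarrow> 'a) rmod" where
  "free_rmod A I =
    \<lparr>carrier = {f. (\<forall>i. f i \<in> carrier A) \<and> (\<forall>i. i \<notin> I \<longrightarrow> f i = \<zero>\<^bsub>A\<^esub>) \<and> finite {i. f i \<noteq> \<zero>\<^bsub>A\<^esub>}},
     mult = undefined, one = undefined,
     ring.zero = (\<lambda>i. \<zero>\<^bsub>A\<^esub>), add = (\<lambda>f g i. f i \<oplus>\<^bsub>A\<^esub> g i), ract = (\<lambda>f a i. f i \<otimes>\<^bsub>A\<^esub> a)\<rparr>"

text \<open>Projective: (isomorphic to) a direct summand of a free module. Every projective module is a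
  direct summand of the free module on its own elements, so nothing is lost by taking the
  index set in the type of elements of \<open>P\<close>.\<close>

definition projective :: "('a, 'x) ring_scheme \<Rightarrow> ('a, 'm, 'y) rmod_scheme \<Rightarrow> bool" where
  "projective A P \<longleftrightarrow> (\<exists>(I :: 'm set) \<iota> \<pi>.
     right_linear A P (free_rmod A I) \<iota> \<and> right_linear A (free_rmod A I) P \<pi> \<and>
     (\<forall>x\<in>carrier P. \<pi> (\<iota> x) = x))"

text \<open>The dual \<open>M\<^sup>* = Hom(M\<^sub>A, A\<^sub>A)\<close> of an \<open>(R, A)\<close>-bimodule is an \<open>(A, R)\<close>-bimodule.\<close>

definition dual ::
  "('a, 'x) ring_scheme \<Rightarrow> ('r, 'a, 'm, 'y) bimod_scheme \<Rightarrow> ('a, 'r, 'm \<Rightarrow> 'a) bimod"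
  where "dual A M =
    \<lparr>carrier = Lin A M (regular A), mult = undefined, one = undefined,
     ring.zero = (\<lambda>x\<in>carrier M. \<zero>\<^bsub>A\<^esub>),
     add = (\<lambda>\<phi> \<psi>. \<lambda>x\<in>carrier M. \<phi> x \<oplus>\<^bsub>A\<^esub> \<psi> x),
     ract = (\<lambda>\<phi> r. \<lambda>x\<in>carrier M. \<phi> (r \<triangleright>\<^bsub>M\<^esub> x)),
     lact = (\<lambda>a \<phi>. \<lambda>x\<in>carrier M. a \<otimes>\<^bsub>A\<^esub> \<phi> x)\<rparr>"

definition dual_basis ::
  "('a, 'x) ring_scheme \<Rightarrow> ('r, 'a, 'm, 'y) bimod_scheme \<Rightarrow> nat \<Rightarrow> (nat \<Rightarrow> 'm) \<Rightarrow> (nat \<Rightarrow> 'm \<Rightarrow> 'a) \<Rightarrow> bool"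
  where "dual_basis A M n e e' \<longleftrightarrow>
    (\<forall>i<n. e i \<in> carrier M \<and> e' i \<in> carrier (dual A M)) \<and>
    (\<forall>x\<in>carrier M. x = (\<Oplus>\<^bsub>M\<^esub> i\<in>{..<n}. e i \<triangleleft>\<^bsub>M\<^esub> e' i x))"

text \<open>A finitely generated projective module has a dual basis, so assuming \<^term>\<open>dual_basis A M n e e'\<close>
  in addition only names one.\<close>

lemma ex_dual_basis:
  fixes A :: "('a, 'x) ring_scheme" (structure) and M :: "('r, 'a, 'm, 'y) bimod_scheme" (structure)
  assumes M: "right_module A M" and fg: "finitely_generated A M" and proj: "projective A M"
  shows "\<exists>n e e'. dual_basis A M n e e'"
proof -
  interpret right_module A M by (rule M)
  obtain G where G: "finite G" "G \<subseteq> carrier M"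
    and gen: "\<And>m. m \<in> carrier M \<Longrightarrow> \<exists>c\<in>G \<rightarrow> carrier A. m = (\<Oplus>\<^bsub>M\<^esub> g\<in>G. g \<triangleleft>\<^bsub>M\<^esub> c g)"
    using fg unfolding finitely_generated_def by (elim exE conjE) (rule that, assumption+, erule bspec)
  obtain I :: "'m set" and \<iota> \<pi> where \<iota>: "right_linear A M (free_rmod A I) \<iota>"
    and \<pi>: "right_linear A (free_rmod A I) M \<pi>" and \<pi>\<iota>: "\<And>x. x \<in> carrier M \<Longrightarrow> \<pi> (\<iota> x) = x"
    using proj unfolding projective_def by (elim exE conjE) (rule that, assumption+, erule bspec)
  let ?F = "free_rmod A I"
  have \<iota>_in: "\<iota> x \<in> carrier ?F" if "x \<in> carrier M" for x
    using \<iota> that by (auto simp: right_linear_def)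
  have \<iota>_add: "\<iota> (x \<oplus>\<^bsub>M\<^esub> y) i = \<iota> x i \<oplus> \<iota> y i" if "x \<in> carrier M" "y \<in> carrier M" for x y i
    using \<iota> that by (auto simp: right_linear_def free_rmod_def)
  have \<iota>_act: "\<iota> (x \<triangleleft>\<^bsub>M\<^esub> a) i = \<iota> x i \<otimes> a" if "x \<in> carrier M" "a \<in> carrier A" for x a i
    using \<iota> that by (auto simp: right_linear_def free_rmod_def)
  have \<iota>_A: "\<iota> x i \<in> carrier A" if "x \<in> carrier M" for x i
    using \<iota>_in[OF that] by (simp add: free_rmod_def)
  have \<iota>_zero: "\<iota> \<zero>\<^bsub>M\<^esub> i = \<zero>" for i
    using \<iota>_add[of "\<zero>\<^bsub>M\<^esub>" "\<zero>\<^bsub>M\<^esub>" i] \<iota>_A[of "\<zero>\<^bsub>M\<^esub>" i] by simp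
  have \<pi>_in: "\<pi> f \<in> carrier M" if "f \<in> carrier ?F" for f
    using \<pi> that by (auto simp: right_linear_def)
  have \<pi>_add: "\<pi> (\<lambda>i. f i \<oplus> g i) = \<pi> f \<oplus>\<^bsub>M\<^esub> \<pi> g" if "f \<in> carrier ?F" "g \<in> carrier ?F" for f g
    using \<pi> that by (auto simp: right_linear_def free_rmod_def)
  have \<pi>_act: "\<pi> (\<lambda>i. f i \<otimes> a) = \<pi> f \<triangleleft>\<^bsub>M\<^esub> a" if "f \<in> carrier ?F" "a \<in> carrier A" for f a
    using \<pi> that by (auto simp: right_linear_def free_rmod_def)
  have F_zero: "(\<lambda>i. \<zero>) \<in> carrier ?F"
    by (auto simp: free_rmod_def)
  have \<pi>_zero: "\<pi> (\<lambda>i. \<zero>) = \<zero>\<^bsub>M\<^esub>"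
    using \<pi>_add[OF F_zero F_zero] \<pi>_in[OF F_zero] by simp
  define J where "J = (\<Union>g\<in>G. {i. \<iota> g i \<noteq> \<zero>})"
  have finJ: "finite J"
    unfolding J_def using G \<iota>_in by (auto simp: free_rmod_def)
  have J_I: "J \<subseteq> I"
    unfolding J_def using G \<iota>_in by (auto simp: free_rmod_def)
  have supp: "\<iota> x i = \<zero>" if x: "x \<in> carrier M" and i: "i \<notin> J" for x i
  proof -
    obtain c where c: "c \<in> G \<rightarrow> carrier A" and xc: "x = (\<Oplus>\<^bsub>M\<^esub> g\<in>G. g \<triangleleft>\<^bsub>M\<^esub> c g)"
      using gen[OF x] by blast
    have "\<iota> (\<Oplus>\<^bsub>M\<^esub> g\<in>H. g \<triangleleft>\<^bsub>M\<^esub> c g) i = \<zero>" if "H \<subseteq> G" for H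
      using finite_subset[OF that G(1)] that
    proof (induction H rule: finite_induct)
      case empty
      then show ?case by (simp add: \<iota>_zero)
    next
      case (insert g H)
      have cl: "h \<triangleleft>\<^bsub>M\<^esub> c h \<in> carrier M" if "h \<in> G" for h
        using that G c by (auto intro!: ract_closed)
      have gz: "\<iota> g i = \<zero>" using i insert.prems by (auto simp: J_def)
      have gM: "g \<in> carrier M" and cg: "c g \<in> carrier A"
        using insert.prems G c by auto
      have S: "(\<Oplus>\<^bsub>M\<^esub> g\<in>H. g \<triangleleft>\<^bsub>M\<^esub> c g) \<in> carrier M"
        using insert.prems cl by (intro M.finsum_closed) auto
      have "(\<Oplus>\<^bsub>M\<^esub> g\<in>insert g H. g \<triangleleft>\<^bsub>M\<^esub> c g)
          = g \<triangleleft>\<^bsub>M\<^esub> c g \<oplus>\<^bsub>M\<^esub> (\<Oplus>\<^bsub>M\<^esub> g\<in>H. g \<triangleleft>\<^bsub>M\<^esub> c g)"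
        using insert.hyps insert.prems cl by (intro M.finsum_insert) auto
      then show ?case
        using insert cl S gM cg by (simp add: \<iota>_add \<iota>_act gz)
    qed
    then show ?thesis using xc by simp
  qed
  define \<delta> where "\<delta> i = (\<lambda>j. if j = i then \<one> else \<zero>)" for i :: 'm
  have \<delta>_in: "\<delta> i \<in> carrier ?F" if "i \<in> I" for i
    using that by (auto simp: free_rmod_def \<delta>_def)
  have expand: "\<pi> f = (\<Oplus>\<^bsub>M\<^esub> i\<in>H. \<pi> (\<delta> i) \<triangleleft>\<^bsub>M\<^esub> f i)"
    if "finite H" "H \<subseteq> I" "f \<in> carrier ?F" "\<And>i. i \<notin> H \<Longrightarrow> f i = \<zero>" for H f
    using that
  proof (induction H arbitrary: f rule: finite_induct)
    case empty
    then have "f = (\<lambda>i. \<zero>)" by auto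
    then show ?case by (simp add: \<pi>_zero)
  next
    case (insert j H)
    define g where "g = f(j := \<zero>)"
    have fA: "f i \<in> carrier A" for i using insert.prems by (auto simp: free_rmod_def)
    have g_in: "g \<in> carrier ?F"
      using insert.prems(2) by (auto simp: free_rmod_def g_def elim!: finite_subset[rotated])
    have dj: "(\<lambda>i. \<delta> j i \<otimes> f j) \<in> carrier ?F"
      using insert.prems(1) fA by (auto simp: free_rmod_def \<delta>_def)
    have f_eq: "f = (\<lambda>i. (\<delta> j i \<otimes> f j) \<oplus> g i)"
      using fA by (auto simp: \<delta>_def g_def)
    have pi_cl: "\<pi> (\<delta> i) \<triangleleft>\<^bsub>M\<^esub> f i \<in> carrier M" if "i \<in> insert j H" for i
      using that insert.prems(1) fA by (auto intro!: ract_closed \<pi>_in \<delta>_in)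
    have "\<pi> f = \<pi> (\<lambda>i. \<delta> j i \<otimes> f j) \<oplus>\<^bsub>M\<^esub> \<pi> g"
      using \<pi>_add[OF dj g_in] f_eq by simp
    also have "\<pi> (\<lambda>i. \<delta> j i \<otimes> f j) = \<pi> (\<delta> j) \<triangleleft>\<^bsub>M\<^esub> f j"
      using insert.prems(1) fA by (intro \<pi>_act \<delta>_in) auto
    also have "\<pi> g = (\<Oplus>\<^bsub>M\<^esub> i\<in>H. \<pi> (\<delta> i) \<triangleleft>\<^bsub>M\<^esub> g i)"
      using insert.prems g_in by (intro insert.IH) (auto, simp add: g_def)
    also have "\<dots> = (\<Oplus>\<^bsub>M\<^esub> i\<in>H. \<pi> (\<delta> i) \<triangleleft>\<^bsub>M\<^esub> f i)"
      using insert.hyps pi_cl by (intro M.finsum_cong') (auto simp: g_def)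
    also have "\<pi> (\<delta> j) \<triangleleft>\<^bsub>M\<^esub> f j \<oplus>\<^bsub>M\<^esub> \<dots> = (\<Oplus>\<^bsub>M\<^esub> i\<in>insert j H. \<pi> (\<delta> i) \<triangleleft>\<^bsub>M\<^esub> f i)"
      using insert.hyps pi_cl by (intro M.finsum_insert[symmetric]) auto
    finally show ?case .
  qed
  obtain h where h: "bij_betw h {..<card J} J"
    using ex_bij_betw_nat_finite[OF finJ] by (auto simp: atLeast0LessThan)
  define e where "e = (\<lambda>k. \<pi> (\<delta> (h k)))"
  define e' where "e' = (\<lambda>k. \<lambda>x\<in>carrier M. \<iota> x (h k))"
  have hJ: "h k \<in> J" if "k < card J" for k
    using h that by (auto simp: bij_betw_def)
  have "e k \<in> carrier M" if "k < card J" for k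
    unfolding e_def using hJ[OF that] J_I by (intro \<pi>_in \<delta>_in) auto
  moreover have "e' k \<in> carrier (dual A M)" for k
    by (auto simp: dual_def Lin_def right_linear_def regular_def e'_def \<iota>_A \<iota>_add \<iota>_act ract_closed)
  moreover have "x = (\<Oplus>\<^bsub>M\<^esub> k\<in>{..<card J}. e k \<triangleleft>\<^bsub>M\<^esub> e' k x)" if x: "x \<in> carrier M" for x
  proof -
    have cl: "\<pi> (\<delta> i) \<triangleleft>\<^bsub>M\<^esub> \<iota> x i \<in> carrier M" if "i \<in> J" for i
      using that J_I \<iota>_A[OF x] by (auto intro!: ract_closed \<pi>_in \<delta>_in)
    have "x = (\<Oplus>\<^bsub>M\<^esub> i\<in>J. \<pi> (\<delta> i) \<triangleleft>\<^bsub>M\<^esub> \<iota> x i)"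
      using expand[OF finJ J_I \<iota>_in[OF x] supp[OF x]] \<pi>\<iota>[OF x] by simp
    also have "\<dots> = (\<Oplus>\<^bsub>M\<^esub> i\<in>h ` {..<card J}. \<pi> (\<delta> i) \<triangleleft>\<^bsub>M\<^esub> \<iota> x i)"
      using h by (simp add: bij_betw_def)
    also have "\<dots> = (\<Oplus>\<^bsub>M\<^esub> k\<in>{..<card J}. \<pi> (\<delta> (h k)) \<triangleleft>\<^bsub>M\<^esub> \<iota> x (h k))"
      using h cl by (intro M.finsum_reindex) (auto simp: bij_betw_def)
    finally show ?thesis using x by (simp add: e_def e'_def)
  qed
  ultimately have "dual_basis A M (card J) e e'"
    unfolding dual_basis_def by blast
  then show ?thesis by blast
qed

definition End_alg ::
  "('k, 'a, 'x) module_scheme \<Rightarrow> ('a, 'm, 'y) rmod_scheme \<Rightarrow> ('k, 'm \<Rightarrow> 'm) module"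
  where "End_alg A M =
    \<lparr>carrier = Lin A M M, mult = (\<lambda>s t. compose (carrier M) s t), one = (\<lambda>x\<in>carrier M. x),
     ring.zero = (\<lambda>x\<in>carrier M. \<zero>\<^bsub>M\<^esub>), add = (\<lambda>s t. \<lambda>x\<in>carrier M. s x \<oplus>\<^bsub>M\<^esub> t x),
     smult = (\<lambda>k s. \<lambda>x\<in>carrier M. s x \<triangleleft>\<^bsub>M\<^esub> (k \<odot>\<^bsub>A\<^esub> \<one>\<^bsub>A\<^esub>))\<rparr>"

text \<open>\<open>M\<close> with its canonical structure of an \<open>(End(M\<^sub>A), A)\<close>-bimodule.\<close>

definition End_bimod :: "('a, 'm, 'y) rmod_scheme \<Rightarrow> ('m \<Rightarrow> 'm, 'a, 'm) bimod" where
  "End_bimod M =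
    \<lparr>carrier = carrier M, mult = mult M, one = \<one>\<^bsub>M\<^esub>, ring.zero = \<zero>\<^bsub>M\<^esub>, add = add M,
     ract = ract M, lact = (\<lambda>s x. s x)\<rparr>"

definition End_canonical :: "('r, 'a, 'm, 'y) bimod_scheme \<Rightarrow> 'r \<Rightarrow> 'm \<Rightarrow> 'm" where
  "End_canonical M r = (\<lambda>x\<in>carrier M. r \<triangleright>\<^bsub>M\<^esub> x)"

section \<open>Comatrix corings and Sweedler corings\<close>

text \<open>The comatrix \<open>A\<close>-coring \<open>M\<^sup>* \<otimes>\<^sub>R M\<close> of an \<open>(R, A)\<close>-bimodule \<open>M\<close> with the given dual basis.\<close>

definition comatrix ::
  "('a, 'x) ring_scheme \<Rightarrow> ('r, 'w) ring_scheme \<Rightarrow> ('r, 'a, 'm, 'y) bimod_scheme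
    \<Rightarrow> nat \<Rightarrow> (nat \<Rightarrow> 'm) \<Rightarrow> (nat \<Rightarrow> 'm \<Rightarrow> 'a)
    \<Rightarrow> ('a, (('m \<Rightarrow> 'a) \<times> 'm \<Rightarrow>\<^sub>0 int) set) coring"
  where "comatrix A R M n e e' = (let C = btensor R (dual A M) M; pure = tens R (dual A M) M in
    bimod.extend C (coring.fields
      (tensor_lift (btensor A C C)
        (\<lambda>\<phi> u. \<Oplus>\<^bsub>btensor A C C\<^esub> i\<in>{..<n}. tens A C C (pure \<phi> (e i)) (pure (e' i) u)))
      (tensor_lift A (\<lambda>\<phi> u. \<phi> u))))"

text \<open>\<open>S\<close> as an \<open>(S, B)\<close>-bimodule and as a \<open>(B, S)\<close>-bimodule, along a ring map \<open>j : B \<rightarrow> S\<close>.\<close>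

definition regular_right :: "('b \<Rightarrow> 's) \<Rightarrow> ('s, 'x) ring_scheme \<Rightarrow> ('s, 'b, 's) bimod" where
  "regular_right j S =
    \<lparr>carrier = carrier S, mult = mult S, one = \<one>\<^bsub>S\<^esub>, ring.zero = \<zero>\<^bsub>S\<^esub>, add = add S,
     ract = (\<lambda>s b. s \<otimes>\<^bsub>S\<^esub> j b), lact = mult S\<rparr>"

definition regular_left :: "('b \<Rightarrow> 's) \<Rightarrow> ('s, 'x) ring_scheme \<Rightarrow> ('b, 's, 's) bimod" where
  "regular_left j S =
    \<lparr>carrier = carrier S, mult = mult S, one = \<one>\<^bsub>S\<^esub>, ring.zero = \<zero>\<^bsub>S\<^esub>, add = add S,
     ract = mult S, lact = (\<lambda>b s. j b \<otimes>\<^bsub>S\<^esub> s)\<rparr>"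

definition sweedler ::
  "('b, 'x) ring_scheme \<Rightarrow> ('s, 'y) ring_scheme \<Rightarrow> ('b \<Rightarrow> 's) \<Rightarrow> ('s, ('s \<times> 's \<Rightarrow>\<^sub>0 int) set) coring"
  where "sweedler B S j =
    (let D = btensor B (regular_right j S) (regular_left j S);
         pure = tens B (regular_right j S) (regular_left j S) in
    bimod.extend D (coring.fields
      (tensor_lift (btensor S D D) (\<lambda>s s'. tens S D D (pure s \<one>\<^bsub>S\<^esub>) (pure \<one>\<^bsub>S\<^esub> s')))
      (tensor_lift S (\<lambda>s s'. s \<otimes>\<^bsub>S\<^esub> s'))))"

section \<open>The two functors\<close>

text \<open>Throughout, \<open>M\<close> is the \<open>(B, A)\<close>-bimodule \<open>\<Sigma>\<close> and \<open>S = End(\<Sigma>\<^sub>A)\<close>. \<open>dual A M\<close> is \<open>\<Sigma>\<^sup>*\<close> as an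
  \<open>(A, B)\<close>-bimodule; \<open>End_bimod M\<close> and \<open>End_dual A M\<close> are \<open>\<Sigma>\<close> and \<open>\<Sigma>\<^sup>*\<close> as \<open>(S, A)\<close>- and
  \<open>(A, S)\<close>-bimodules.\<close>

abbreviation End_dual ::
  "('a, 'x) ring_scheme \<Rightarrow> ('a, 'm, 'y) rmod_scheme \<Rightarrow> ('a, 'm \<Rightarrow> 'm, 'm \<Rightarrow> 'a) bimod"
  where "End_dual A M \<equiv> dual A (End_bimod M)"

abbreviation End_sweedler ::
  "('k, 'a, 'x) module_scheme \<Rightarrow> ('b, 'w) ring_scheme \<Rightarrow> ('b, 'a, 'm, 'y) bimod_scheme
    \<Rightarrow> ('m \<Rightarrow> 'm, (('m \<Rightarrow> 'm) \<times> ('m \<Rightarrow> 'm) \<Rightarrow>\<^sub>0 int) set) coring"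
  where "End_sweedler A B M \<equiv> sweedler B (End_alg A M) (End_canonical M)"

text \<open>\<open>\<xi> : \<Sigma> \<otimes>\<^sub>A \<Sigma>\<^sup>* \<rightarrow> S\<close> and its inverse.\<close>

definition xi ::
  "('k, 'a, 'x) module_scheme \<Rightarrow> ('a, 'm, 'y) rmod_scheme
    \<Rightarrow> ('m \<times> ('m \<Rightarrow> 'a) \<Rightarrow>\<^sub>0 int) set \<Rightarrow> 'm \<Rightarrow> 'm"
  where "xi A M = tensor_lift (End_alg A M) (\<lambda>u v. \<lambda>x\<in>carrier M. u \<triangleleft>\<^bsub>M\<^esub> v x)"

definition xi_inv ::
  "('k, 'a, 'x) module_scheme \<Rightarrow> ('a, 'm, 'y) rmod_scheme
    \<Rightarrow> ('m \<Rightarrow> 'm) \<Rightarrow> ('m \<times> ('m \<Rightarrow> 'a) \<Rightarrow>\<^sub>0 int) set"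
  where "xi_inv A M = inv_into (carrier (btensor A (End_bimod M) (End_dual A M))) (xi A M)"

text \<open>The functor \<open>- \<otimes>\<^sub>S \<Sigma>\<close>. Its coaction is given by
  \<open>y \<otimes> u \<mapsto> \<Sum>\<^sub>i \<Sum> (y\<^sub>0 \<otimes>\<^sub>S e\<^sub>i) \<otimes>\<^sub>A (e\<^sub>i\<^sup>* \<otimes>\<^sub>B y\<^sub>1 u)\<close> when \<open>\<rho>(y)\<close> is written as \<open>\<Sum> y\<^sub>0 \<otimes>\<^sub>S (1 \<otimes>\<^sub>B y\<^sub>1)\<close>. An
  arbitrary tensor \<open>y' \<otimes>\<^sub>S (s \<otimes>\<^sub>B s')\<close> is brought into this form as \<open>y' s \<otimes>\<^sub>S (1 \<otimes>\<^sub>B s')\<close>.\<close>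

definition tensor_Sigma ::
  "('k, 'a, 'x) module_scheme \<Rightarrow> ('b, 'w) ring_scheme \<Rightarrow> ('b, 'a, 'm, 'z) bimod_scheme
    \<Rightarrow> nat \<Rightarrow> (nat \<Rightarrow> 'm) \<Rightarrow> (nat \<Rightarrow> 'm \<Rightarrow> 'a)
    \<Rightarrow> ('m \<Rightarrow> 'm, (('m \<Rightarrow> 'm) \<times> ('m \<Rightarrow> 'm) \<Rightarrow>\<^sub>0 int) set, 'y, 'v) comod_scheme
    \<Rightarrow> ('a, (('m \<Rightarrow> 'a) \<times> 'm \<Rightarrow>\<^sub>0 int) set, ('y \<times> 'm \<Rightarrow>\<^sub>0 int) set) comod"
  where "tensor_Sigma A B M n e e' Y =
    (let S = End_alg A M;
         C = btensor B (dual A M) M;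
         X = rtensor S Y (End_bimod M);
         T = rtensor A X C
     in rmod.extend X (comod.fields
       (tensor_lift T (\<lambda>y u.
          tensor_lift T (\<lambda>y' d.
            tensor_lift T (\<lambda>s s'.
              \<Oplus>\<^bsub>T\<^esub> i\<in>{..<n}. tens A X C
                (tens S Y (End_bimod M) (y' \<triangleleft>\<^bsub>Y\<^esub> s) (e i))
                (tens B (dual A M) M (e' i) (s' u)))
            d)
          (coact Y y)))))"

definition tensor_Sigma_map ::
  "('k, 'a, 'x) module_scheme \<Rightarrow> ('a, 'm, 'z) rmod_scheme
    \<Rightarrow> ('m \<Rightarrow> 'm, 'y, 'v) rmod_scheme \<Rightarrow> ('m \<Rightarrow> 'm, 'y2, 'v2) rmod_scheme \<Rightarrow> ('y \<Rightarrow> 'y2)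
    \<Rightarrow> ('y \<times> 'm \<Rightarrow>\<^sub>0 int) set \<Rightarrow> ('y2 \<times> 'm \<Rightarrow>\<^sub>0 int) set"
  where "tensor_Sigma_map A M Y Y' f =
    tensor_map (End_alg A M) Y (End_bimod M) Y' (End_bimod M) f (\<lambda>u. u)"

text \<open>The functor \<open>- \<otimes>\<^sub>A \<Sigma>\<^sup>*\<close>. The four factors of the coaction are, in order of application:
  \<open>\<rho> \<otimes>\<^sub>A \<Sigma>\<^sup>*\<close>, the rebracketing
  \<open>(X \<otimes>\<^sub>A (\<Sigma>\<^sup>* \<otimes>\<^sub>B \<Sigma>)) \<otimes>\<^sub>A \<Sigma>\<^sup>* \<cong> (X \<otimes>\<^sub>A \<Sigma>\<^sup>*) \<otimes>\<^sub>B (\<Sigma> \<otimes>\<^sub>A \<Sigma>\<^sup>*)\<close>, the map induced by \<open>\<xi>\<close>, and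
  \<open>(X \<otimes>\<^sub>A \<Sigma>\<^sup>*) \<otimes>\<^sub>B S \<cong> (X \<otimes>\<^sub>A \<Sigma>\<^sup>*) \<otimes>\<^sub>S (S \<otimes>\<^sub>B S)\<close>. Here \<open>ZB\<close> and \<open>ZS\<close> are the same abelian group
  \<open>X \<otimes>\<^sub>A \<Sigma>\<^sup>*\<close>, as a right module over \<open>B\<close> and \<open>S\<close>.\<close>

definition tensor_Sigma_dual ::
  "('k, 'a, 'x) module_scheme \<Rightarrow> ('b, 'w) ring_scheme \<Rightarrow> ('b, 'a, 'm, 'z) bimod_scheme
    \<Rightarrow> ('a, (('m \<Rightarrow> 'a) \<times> 'm \<Rightarrow>\<^sub>0 int) set, 'y, 'v) comod_scheme
    \<Rightarrow> ('m \<Rightarrow> 'm, (('m \<Rightarrow> 'm) \<times> ('m \<Rightarrow> 'm) \<Rightarrow>\<^sub>0 int) set, ('y \<times> ('m \<Rightarrow> 'a) \<Rightarrow>\<^sub>0 int) set) comod"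
  where "tensor_Sigma_dual A B M X =
    (let S = End_alg A M;
         S\<^sub>l = regular_left (End_canonical M) S;
         S\<^sub>r = regular_right (End_canonical M) S;
         D = btensor B S\<^sub>r S\<^sub>l;
         C = btensor B (dual A M) M;
         ZB = rtensor A X (dual A M);
         ZS = rtensor A X (End_dual A M);
         E = btensor A M (End_dual A M);
         coaction = tensor_map A X (End_dual A M) (rtensor A X C) (End_dual A M) (coact X) (\<lambda>v. v);
         rebracket = tensor_lift (rtensor B ZB E) (\<lambda>t v.
           tensor_lift (rtensor B ZB E) (\<lambda>x c.
             tensor_lift (rtensor B ZB E) (\<lambda>\<phi> u.
               tens B ZB E (tens A X (dual A M) x \<phi>) (tens A M (End_dual A M) u v)) c) t);
         map_xi = tensor_map B ZB E ZB S\<^sub>l (\<lambda>z. z) (xi A M);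
         insert_one = tensor_lift (rtensor S ZS D) (\<lambda>z s. tens S ZS D z (tens B S\<^sub>r S\<^sub>l \<one>\<^bsub>S\<^esub> s))
     in rmod.extend ZS (comod.fields (\<lambda>z. insert_one (map_xi (rebracket (coaction z))))))"

definition tensor_Sigma_dual_map ::
  "('a, 'x) ring_scheme \<Rightarrow> ('a, 'm, 'z) rmod_scheme
    \<Rightarrow> ('a, 'y, 'v) rmod_scheme \<Rightarrow> ('a, 'y2, 'v2) rmod_scheme \<Rightarrow> ('y \<Rightarrow> 'y2)
    \<Rightarrow> ('y \<times> ('m \<Rightarrow> 'a) \<Rightarrow>\<^sub>0 int) set \<Rightarrow> ('y2 \<times> ('m \<Rightarrow> 'a) \<Rightarrow>\<^sub>0 int) set"
  where "tensor_Sigma_dual_map A M X X' f =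
    tensor_map A X (End_dual A M) X' (End_dual A M) f (\<lambda>v. v)"

section \<open>The adjunction maps\<close>

definition iota' :: "('s, 'x) ring_scheme \<Rightarrow> ('s, 'y, 'v) rmod_scheme \<Rightarrow> 'y \<Rightarrow> ('y \<times> 's \<Rightarrow>\<^sub>0 int) set"
  where "iota' S Y y = tens S Y (regular S) y \<one>\<^bsub>S\<^esub>"

definition Psi ::
  "('k, 'a, 'x) module_scheme \<Rightarrow> ('a, 'm, 'z) rmod_scheme
    \<Rightarrow> ('m \<Rightarrow> 'm, 'y, 'v) rmod_scheme \<Rightarrow> ('a, 'w, 'u) rmod_scheme
    \<Rightarrow> (('y \<times> 'm \<Rightarrow>\<^sub>0 int) set \<Rightarrow> 'w) \<Rightarrow> 'y \<Rightarrow> ('w \<times> ('m \<Rightarrow> 'a) \<Rightarrow>\<^sub>0 int) set"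
  where "Psi A M Y X f = (\<lambda>y\<in>carrier Y.
    (let S = End_alg A M; E = btensor A (End_bimod M) (End_dual A M)
     in tensor_Sigma_dual_map A M (rtensor S Y (End_bimod M)) X f
          (tensor_assoc_inv S A Y (End_bimod M) (End_dual A M)
            (tensor_map S Y (regular S) Y E (\<lambda>y. y) (xi_inv A M) (iota' S Y y)))))"

text \<open>The counit of the comatrix coring \<open>\<Sigma>\<^sup>* \<otimes>\<^sub>S \<Sigma>\<close> does not involve the dual basis, which is only
  an argument of \<^const>\<open>comatrix\<close>.\<close>

definition Psi_inv ::
  "('k, 'a, 'x) module_scheme \<Rightarrow> ('a, 'm, 'z) rmod_scheme \<Rightarrow> nat \<Rightarrow> (nat \<Rightarrow> 'm) \<Rightarrow> (nat \<Rightarrow> 'm \<Rightarrow> 'a)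
    \<Rightarrow> ('m \<Rightarrow> 'm, 'y, 'v) rmod_scheme \<Rightarrow> ('a, 'w, 'u) rmod_scheme
    \<Rightarrow> ('y \<Rightarrow> ('w \<times> ('m \<Rightarrow> 'a) \<Rightarrow>\<^sub>0 int) set) \<Rightarrow> ('y \<times> 'm \<Rightarrow>\<^sub>0 int) set \<Rightarrow> 'w"
  where "Psi_inv A M n e e' Y X g =
    (let S = End_alg A M; C' = comatrix A S (End_bimod M) n e e'
     in (\<lambda>t\<in>carrier (rtensor S Y (End_bimod M)).
          tensor_runit X
            (tensor_map A X C' X (regular A) (\<lambda>x. x) (counit C')
              (tensor_assoc A S X (End_dual A M) (End_bimod M)
                (tensor_Sigma_map A M Y (rtensor A X (End_dual A M)) g t)))))"

end

theory Submission
  imports Defs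
begin

text \<open>A dual basis turns both coactions into explicit maps. For a right \<open>S\<close>-module \<open>Y\<close> and \<open>u\<close> in
  \<open>\<Sigma>\<close> let \<open>\<Theta>\<^sub>u(y \<otimes> (s \<otimes> s')) = \<Sum>\<^sub>i (y s \<otimes> e\<^sub>i) \<otimes> (e\<^sub>i\<^sup>* \<otimes> s' u)\<close>, and for a right \<open>A\<close>-module \<open>X\<close> and
  \<open>\<phi>\<close> in \<open>\<Sigma>\<^sup>*\<close> let \<open>\<Omega>\<^sub>\<phi>(x \<otimes> (\<psi> \<otimes> u)) = (x \<otimes> \<psi>) \<otimes> (1 \<otimes> \<xi>(u \<otimes> \<phi>))\<close>. The transported coactions are
  \<open>y \<otimes> u \<mapsto> \<Theta>\<^sub>u(\<rho> y)\<close> and \<open>x \<otimes> \<phi> \<mapsto> \<Omega>\<^sub>\<phi>(\<rho> x)\<close>. Since \<open>\<Theta>\<close> and \<open>\<Omega>\<close> are natural and compatible with the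
  comultiplications and counits, the comodule axioms carry over from \<open>Y\<close> and \<open>X\<close>. Moreover
  \<open>\<Psi> f y = \<Sum>\<^sub>i f(y \<otimes> e\<^sub>i) \<otimes> e\<^sub>i\<^sup>*\<close>, while the claimed inverse sends \<open>g\<close> to \<open>y \<otimes> u \<mapsto> ev\<^sub>u(g y)\<close> with
  \<open>ev\<^sub>u(x \<otimes> \<phi>) = x \<phi>(u)\<close>; these are mutually inverse by the dual basis identities
  \<open>u = \<Sum>\<^sub>i e\<^sub>i e\<^sub>i\<^sup>*(u)\<close> and \<open>\<phi> = \<Sum>\<^sub>i \<phi>(e\<^sub>i) e\<^sub>i\<^sup>*\<close>, and the identity
  \<open>\<Sum>\<^sub>i s e\<^sub>i \<otimes> e\<^sub>i\<^sup>* = \<Sum>\<^sub>i e\<^sub>i \<otimes> e\<^sub>i\<^sup>* s\<close> makes \<open>\<Psi> f\<close> right \<open>S\<close>-linear.\<close>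

section \<open>Additive maps and one-sided modules\<close>

text \<open>A tensor product is a quotient of a free abelian group, and a coaction value rho(y) in
  it comes with no preferred expression by pure tensors. So each compatibility is proved as an
  equation of additive maps, valid for every t in Y \<otimes> D or X \<otimes> C and compared on
  pure tensors by \<open>tensor_eqI\<close>; only then is t specialised to rho(y), where a comodule
  axiom applies. This is why Theta and Omega, not the coactions, are the central objects, and why
  coassociativity also needs them for the modules Y \<otimes> D and X \<otimes> C.

  The other recurring point is well-definedness. The shift identity for the canonical element, the
  sum of e_i \<otimes> e'_i, is also used with s the endomorphism given by some b in B: it shows
  that the comatrix comultiplication and Theta respect the tensor product over B. In the opposite
  direction xi maps the canonical element to the identity of S, so the dual basis inserted by the
  comatrix comultiplication becomes the unit inserted by the Sweedler one.\<close>

lemma foldSetD_cong: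
  assumes "(A, z) \<in> foldSetD D f e" and "\<And>x. x \<in> A \<Longrightarrow> f x = g x"
  shows "(A, z) \<in> foldSetD D g e"
  using assms
proof (induction rule: foldSetD.induct)
  case (insertI x A y)
  then show ?case using foldSetD.insertI[of x A g y D e] by auto
qed (rule foldSetD.emptyI)

text \<open>Unlike the library's congruence rules this needs no membership in the carrier, because
  \<^const>\<open>foldSetD\<close> only depends on the values on \<open>A\<close>.\<close>

lemma finsum_ext:
  assumes "\<And>i. i \<in> A \<Longrightarrow> f i = g i"
  shows "finsum G f A = finsum G g A"
proof -
  have "(A, z) \<in> foldSetD (carrier G) (add G \<circ> f) \<zero>\<^bsub>G\<^esub> \<longleftrightarrow>
      (A, z) \<in> foldSetD (carrier G) (add G \<circ> g) \<zero>\<^bsub>G\<^esub>" for z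
    using assms foldSetD_cong[of A z "carrier G" "add G \<circ> f" "\<zero>\<^bsub>G\<^esub>" "add G \<circ> g"]
      foldSetD_cong[of A z "carrier G" "add G \<circ> g" "\<zero>\<^bsub>G\<^esub>" "add G \<circ> f"]
    by auto
  then show ?thesis
    by (simp add: finsum_def finprod_def foldD_def comp_def)
qed

lemma finsum_record_cong:
  assumes "carrier G = carrier H" "add G = add H" "\<zero>\<^bsub>G\<^esub> = \<zero>\<^bsub>H\<^esub>"
  shows "finsum G f I = finsum H f I"
  using assms by (simp add: finsum_def finprod_def)

lemma abelian_group_record_cong:
  assumes "carrier G = carrier H" "add G = add H" "\<zero>\<^bsub>G\<^esub> = \<zero>\<^bsub>H\<^esub>"
  shows "abelian_group G \<longleftrightarrow> abelian_group H"
proof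
  show "abelian_group H" if "abelian_group G"
    using abelian_groupE[OF that] assms by (intro abelian_groupI) auto
  show "abelian_group G" if "abelian_group H"
    using abelian_groupE[OF that] assms by (intro abelian_groupI) auto
qed

text \<open>Additivity and module linearity are kept apart: comparing two maps on a tensor product
  uses only their additivity, and this notion depends on nothing but the carriers and additions of
  the two records.\<close>

definition addhom :: "('p, 'x) ring_scheme \<Rightarrow> ('q, 'y) ring_scheme \<Rightarrow> ('p \<Rightarrow> 'q) \<Rightarrow> bool" where
  "addhom P Q f \<longleftrightarrow> f \<in> carrier P \<rightarrow> carrier Q \<and>
     (\<forall>x\<in>carrier P. \<forall>y\<in>carrier P. f (x \<oplus>\<^bsub>P\<^esub> y) = f x \<oplus>\<^bsub>Q\<^esub> f y)"

lemma addhomI: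
  assumes "\<And>x. x \<in> carrier P \<Longrightarrow> f x \<in> carrier Q"
    and "\<And>x y. \<lbrakk>x \<in> carrier P; y \<in> carrier P\<rbrakk> \<Longrightarrow> f (x \<oplus>\<^bsub>P\<^esub> y) = f x \<oplus>\<^bsub>Q\<^esub> f y"
  shows "addhom P Q f"
  using assms by (auto simp: addhom_def)

lemma addhom_closed: "addhom P Q f \<Longrightarrow> x \<in> carrier P \<Longrightarrow> f x \<in> carrier Q"
  by (auto simp: addhom_def)

lemma addhom_add:
  "addhom P Q f \<Longrightarrow> x \<in> carrier P \<Longrightarrow> y \<in> carrier P \<Longrightarrow> f (x \<oplus>\<^bsub>P\<^esub> y) = f x \<oplus>\<^bsub>Q\<^esub> f y"
  by (auto simp: addhom_def)

lemma addhom_zero: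
  assumes "abelian_group P" "abelian_group Q" "addhom P Q f"
  shows "f \<zero>\<^bsub>P\<^esub> = \<zero>\<^bsub>Q\<^esub>"
proof -
  interpret P: abelian_group P by fact
  interpret Q: abelian_group Q by fact
  have "f \<zero>\<^bsub>P\<^esub> \<oplus>\<^bsub>Q\<^esub> f \<zero>\<^bsub>P\<^esub> = f \<zero>\<^bsub>P\<^esub>"
    using addhom_add[OF assms(3), of "\<zero>\<^bsub>P\<^esub>" "\<zero>\<^bsub>P\<^esub>"] by simp
  then show ?thesis
    using addhom_closed[OF assms(3), of "\<zero>\<^bsub>P\<^esub>"] by simp
qed

lemma addhom_finsum:
  assumes P: "abelian_group P" and Q: "abelian_group Q" and f: "addhom P Q f"
    and fin: "finite I" and g: "\<And>i. i \<in> I \<Longrightarrow> g i \<in> carrier P"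
  shows "f (finsum P g I) = finsum Q (\<lambda>i. f (g i)) I"
proof -
  interpret P: abelian_group P by (rule P)
  interpret Q: abelian_group Q by (rule Q)
  show ?thesis using fin g
  proof (induction I rule: finite_induct)
    case empty
    then show ?case using addhom_zero[OF P Q f] by simp
  next
    case (insert i I)
    then have "finsum P g I \<in> carrier P" by (intro P.finsum_closed) auto
    with insert have "f (finsum P g (insert i I)) = f (g i) \<oplus>\<^bsub>Q\<^esub> f (finsum P g I)"
      by (subst P.finsum_insert) (auto simp: addhom_add[OF f])
    also have "\<dots> = finsum Q (\<lambda>i. f (g i)) (insert i I)"
      using insert by (subst Q.finsum_insert) (auto intro: addhom_closed[OF f])
    finally show ?case .
  qed
qed

lemma addhom_ident: "addhom P P (\<lambda>x. x)"
  by (auto simp: addhom_def)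

lemma addhom_compose: "addhom Q G g \<Longrightarrow> addhom P Q f \<Longrightarrow> addhom P G (\<lambda>x. g (f x))"
  by (auto simp: addhom_def Pi_def)

lemma addhom_sum2:
  assumes "abelian_group Q" "addhom P Q f" "addhom P Q g"
  shows "addhom P Q (\<lambda>x. f x \<oplus>\<^bsub>Q\<^esub> g x)"
proof -
  interpret Q: abelian_group Q by fact
  show ?thesis using assms(2,3)
    by (auto simp: addhom_def Pi_def Q.a_ac)
qed

lemma addhom_const_zero: "abelian_group Q \<Longrightarrow> addhom P Q (\<lambda>x. \<zero>\<^bsub>Q\<^esub>)"
  using abelian_groupE(2,5) by (fastforce simp: addhom_def)

lemma addhom_finsum_fun:
  assumes Q: "abelian_group Q" and "\<And>i. i \<in> I \<Longrightarrow> addhom P Q (f i)"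
  shows "addhom P Q (\<lambda>x. finsum Q (\<lambda>i. f i x) I)"
proof -
  interpret Q: abelian_group Q by (rule Q)
  show ?thesis
  proof (rule addhomI)
    show "finsum Q (\<lambda>i. f i x) I \<in> carrier Q" if "x \<in> carrier P" for x
      using that assms(2) by (intro Q.finsum_closed) (auto intro: addhom_closed)
    show "finsum Q (\<lambda>i. f i (x \<oplus>\<^bsub>P\<^esub> y)) I = finsum Q (\<lambda>i. f i x) I \<oplus>\<^bsub>Q\<^esub> finsum Q (\<lambda>i. f i y) I"
      if "x \<in> carrier P" "y \<in> carrier P" for x y
    proof -
      have "finsum Q (\<lambda>i. f i (x \<oplus>\<^bsub>P\<^esub> y)) I = finsum Q (\<lambda>i. f i x \<oplus>\<^bsub>Q\<^esub> f i y) I"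
        using that addhom_add[OF assms(2)] by (intro finsum_ext) auto
      also have "\<dots> = finsum Q (\<lambda>i. f i x) I \<oplus>\<^bsub>Q\<^esub> finsum Q (\<lambda>i. f i y) I"
        using that assms(2) by (intro Q.finsum_addf) (auto intro: addhom_closed)
      finally show ?thesis .
    qed
  qed
qed

lemma finsum_closed' [simp]:
  assumes "abelian_group Q" and "\<And>i. i \<in> I \<Longrightarrow> f i \<in> carrier Q"
  shows "finsum Q f I \<in> carrier Q"
proof -
  interpret Q: abelian_group Q by fact
  show ?thesis using assms(2) by (intro Q.finsum_closed) auto
qed

lemma finsum_add_fun:
  assumes "abelian_group Q" and "\<And>i. i \<in> I \<Longrightarrow> f i \<in> carrier Q" and "\<And>i. i \<in> I \<Longrightarrow> g i \<in> carrier Q"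
  shows "finsum Q (\<lambda>i. f i \<oplus>\<^bsub>Q\<^esub> g i) I = finsum Q f I \<oplus>\<^bsub>Q\<^esub> finsum Q g I"
proof -
  interpret Q: abelian_group Q by fact
  show ?thesis using assms(2,3) by (intro Q.finsum_addf) auto
qed

lemma finsum_swap:
  assumes Q: "abelian_group Q" and fin: "finite I" "finite J"
    and f: "\<And>i j. \<lbrakk>i \<in> I; j \<in> J\<rbrakk> \<Longrightarrow> f i j \<in> carrier Q"
  shows "finsum Q (\<lambda>i. finsum Q (\<lambda>j. f i j) J) I = finsum Q (\<lambda>j. finsum Q (\<lambda>i. f i j) I) J"
proof -
  interpret Q: abelian_group Q by (rule Q)
  show ?thesis using fin(1) f
  proof (induction I rule: finite_induct)
    case empty
    then show ?case by simp
  next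
    case (insert a I)
    have "finsum Q (\<lambda>i. finsum Q (\<lambda>j. f i j) J) (insert a I)
        = finsum Q (\<lambda>j. f a j) J \<oplus>\<^bsub>Q\<^esub> finsum Q (\<lambda>j. finsum Q (\<lambda>i. f i j) I) J"
      using insert by (subst Q.finsum_insert) (auto intro!: finsum_closed'[OF Q])
    also have "\<dots> = finsum Q (\<lambda>j. f a j \<oplus>\<^bsub>Q\<^esub> finsum Q (\<lambda>i. f i j) I) J"
      using insert by (intro finsum_add_fun[symmetric] Q finsum_closed') auto
    also have "\<dots> = finsum Q (\<lambda>j. finsum Q (\<lambda>i. f i j) (insert a I)) J"
      using insert by (intro finsum_ext) (auto simp: Q.finsum_insert Pi_def)
    finally show ?case .
  qed
qed

text \<open>A right tensor factor enters the construction only through its left action. This locale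
  isolates that action from the right action and the ground ring that come with
  \<open>central_bimodule\<close>.\<close>

locale left_module = Alg?: ring R + M?: abelian_group M for R (structure) and M (structure) +
  assumes lact_closed: "\<lbrakk>r \<in> carrier R; m \<in> carrier M\<rbrakk> \<Longrightarrow> r \<triangleright>\<^bsub>M\<^esub> m \<in> carrier M"
    and lact_add_right: "\<lbrakk>r \<in> carrier R; m \<in> carrier M; m' \<in> carrier M\<rbrakk>
        \<Longrightarrow> r \<triangleright>\<^bsub>M\<^esub> (m \<oplus>\<^bsub>M\<^esub> m') = (r \<triangleright>\<^bsub>M\<^esub> m) \<oplus>\<^bsub>M\<^esub> (r \<triangleright>\<^bsub>M\<^esub> m')"
    and lact_add_left: "\<lbrakk>r \<in> carrier R; r' \<in> carrier R; m \<in> carrier M\<rbrakk>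
        \<Longrightarrow> (r \<oplus>\<^bsub>R\<^esub> r') \<triangleright>\<^bsub>M\<^esub> m = (r \<triangleright>\<^bsub>M\<^esub> m) \<oplus>\<^bsub>M\<^esub> (r' \<triangleright>\<^bsub>M\<^esub> m)"
    and lact_mult: "\<lbrakk>r \<in> carrier R; r' \<in> carrier R; m \<in> carrier M\<rbrakk>
        \<Longrightarrow> (r \<otimes>\<^bsub>R\<^esub> r') \<triangleright>\<^bsub>M\<^esub> m = r \<triangleright>\<^bsub>M\<^esub> (r' \<triangleright>\<^bsub>M\<^esub> m)"
    and lact_one: "m \<in> carrier M \<Longrightarrow> \<one>\<^bsub>R\<^esub> \<triangleright>\<^bsub>M\<^esub> m = m"

text \<open>Two commuting actions suffice for forming tensor products. The algebra structures over
  \<open>K\<close> are left out here and return where centrality of the corings is proved.\<close>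

definition bimodule ::
  "('l, 'w) ring_scheme \<Rightarrow> ('r, 'x) ring_scheme \<Rightarrow> ('l, 'r, 'm, 'y) bimod_scheme \<Rightarrow> bool" where
  "bimodule R T M \<longleftrightarrow> left_module R M \<and> right_module T M \<and>
     (\<forall>r\<in>carrier R. \<forall>m\<in>carrier M. \<forall>t\<in>carrier T. (r \<triangleright>\<^bsub>M\<^esub> m) \<triangleleft>\<^bsub>M\<^esub> t = r \<triangleright>\<^bsub>M\<^esub> (m \<triangleleft>\<^bsub>M\<^esub> t))"

lemma bimodule_left: "bimodule R T M \<Longrightarrow> left_module R M"
  and bimodule_right: "bimodule R T M \<Longrightarrow> right_module T M"
  and bimodule_commute: "\<lbrakk>bimodule R T M; r \<in> carrier R; m \<in> carrier M; t \<in> carrier T\<rbrakk>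
    \<Longrightarrow> (r \<triangleright>\<^bsub>M\<^esub> m) \<triangleleft>\<^bsub>M\<^esub> t = r \<triangleright>\<^bsub>M\<^esub> (m \<triangleleft>\<^bsub>M\<^esub> t)"
  by (auto simp: bimodule_def)

lemma right_module_abelian: "right_module A M \<Longrightarrow> abelian_group M"
  and right_module_ring: "right_module A M \<Longrightarrow> ring A"
  and left_module_abelian: "left_module A N \<Longrightarrow> abelian_group N"
  and left_module_ring: "left_module A N \<Longrightarrow> ring A"
  by (simp_all add: right_module_def left_module_def)

lemma ring_abelian: "ring A \<Longrightarrow> abelian_group A"
  by (simp add: ring_def)

lemma central_bimodule_bimodule:
  assumes "central_bimodule K R T M" shows "bimodule R T M"
proof -
  interpret central_bimodule K R T M by fact
  have "left_module R M"
    by (intro left_module.intro left_module_axioms.intro L.ring_axioms M.abelian_group_axioms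
        lact_closed lact_add_right lact_add_left lact_mult lact_one)
  then show ?thesis
    by (simp add: bimodule_def right_module_axioms lact_ract)
qed

lemma addhom_ract:
  assumes "right_module A M" "a \<in> carrier A" "addhom P M f"
  shows "addhom P M (\<lambda>x. f x \<triangleleft>\<^bsub>M\<^esub> a)"
  using assms(2,3)
  by (auto simp: addhom_def Pi_def right_module.ract_add_left[OF assms(1)]
      right_module.ract_closed[OF assms(1)])

lemma addhom_lact:
  assumes "left_module A M" "a \<in> carrier A" "addhom P M f"
  shows "addhom P M (\<lambda>x. a \<triangleright>\<^bsub>M\<^esub> f x)"
  using assms(2,3)
  by (auto simp: addhom_def Pi_def left_module.lact_add_right[OF assms(1)]
      left_module.lact_closed[OF assms(1)])

lemma right_linearI:
  assumes "addhom M N f"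
    and "\<And>x a. \<lbrakk>x \<in> carrier M; a \<in> carrier A\<rbrakk> \<Longrightarrow> f (x \<triangleleft>\<^bsub>M\<^esub> a) = f x \<triangleleft>\<^bsub>N\<^esub> a"
  shows "right_linear A M N f"
  using assms by (auto simp: right_linear_def addhom_def)

lemma right_linear_addhom: "right_linear A M N f \<Longrightarrow> addhom M N f"
  and right_linear_ract:
    "\<lbrakk>right_linear A M N f; x \<in> carrier M; a \<in> carrier A\<rbrakk> \<Longrightarrow> f (x \<triangleleft>\<^bsub>M\<^esub> a) = f x \<triangleleft>\<^bsub>N\<^esub> a"
  by (auto simp: right_linear_def addhom_def)

definition left_linear ::
  "('l, 'x) ring_scheme \<Rightarrow> ('l, 'r, 'm, 'y) bimod_scheme \<Rightarrow> ('l, 's, 'n, 'z) bimod_scheme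
    \<Rightarrow> ('m \<Rightarrow> 'n) \<Rightarrow> bool" where
  "left_linear R M N f \<longleftrightarrow> addhom M N f \<and>
     (\<forall>r\<in>carrier R. \<forall>x\<in>carrier M. f (r \<triangleright>\<^bsub>M\<^esub> x) = r \<triangleright>\<^bsub>N\<^esub> f x)"

lemma left_linear_ident: "left_linear R M M (\<lambda>x. x)"
  by (simp add: left_linear_def addhom_ident)

lemma right_linear_ident: "right_linear R M M (\<lambda>x. x)"
  by (simp add: right_linear_def)

lemma bilinear_map_right_linear: "bilinear_map R T M N f \<Longrightarrow> right_linear T M N f"
  by (simp add: bilinear_map_def)

lemma bilinear_map_left_linear: "bilinear_map R T M N f \<Longrightarrow> left_linear R M N f"
  by (auto simp: bilinear_map_def left_linear_def intro: right_linear_addhom)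

section \<open>Tensor products of abelian groups\<close>

text \<open>The tensor group sees only the carriers, the additions and the two inner actions.
  Records that agree in these but differ in an outer action, such as the dual of Sigma as a module
  over B or over S, therefore give identical tensor groups, not just isomorphic ones.\<close>

lemma tens_cong:
  assumes "carrier M = carrier M'" "add M = add M'" "ract M = ract M'"
    and "carrier N = carrier N'" "add N = add N'" "lact N = lact N'"
  shows "tens R M N = tens R M' N'" and "tensor_group R M N = tensor_group R M' N'"
proof -
  have F: "tensor_free M N = tensor_free M' N'"
    by (simp add: tensor_free_def assms)
  have "tensor_null R M N = tensor_null R M' N'"
    by (simp add: tensor_null_def F) (simp add: tensor_relators_def assms)
  with F show "tens R M N = tens R M' N'" "tensor_group R M N = tensor_group R M' N'"
    by (auto simp: tens_def tensor_group_def fun_eq_iff)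
qed

definition balanced ::
  "('r, 'x) ring_scheme \<Rightarrow> ('r, 'm, 'y) rmod_scheme \<Rightarrow> ('r, 's, 'n, 'z) bimod_scheme
    \<Rightarrow> ('g, 'w) ring_scheme \<Rightarrow> ('m \<Rightarrow> 'n \<Rightarrow> 'g) \<Rightarrow> bool" where
  "balanced R M N G \<phi> \<longleftrightarrow>
     (\<forall>n\<in>carrier N. addhom M G (\<lambda>m. \<phi> m n)) \<and>
     (\<forall>m\<in>carrier M. addhom N G (\<phi> m)) \<and>
     (\<forall>m\<in>carrier M. \<forall>r\<in>carrier R. \<forall>n\<in>carrier N. \<phi> (m \<triangleleft>\<^bsub>M\<^esub> r) n = \<phi> m (r \<triangleright>\<^bsub>N\<^esub> n))"

lemma balancedI:
  assumes "\<And>n. n \<in> carrier N \<Longrightarrow> addhom M G (\<lambda>m. \<phi> m n)"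
    and "\<And>m. m \<in> carrier M \<Longrightarrow> addhom N G (\<lambda>n. \<phi> m n)"
    and "\<And>m r n. \<lbrakk>m \<in> carrier M; r \<in> carrier R; n \<in> carrier N\<rbrakk>
      \<Longrightarrow> \<phi> (m \<triangleleft>\<^bsub>M\<^esub> r) n = \<phi> m (r \<triangleright>\<^bsub>N\<^esub> n)"
  shows "balanced R M N G \<phi>"
  using assms by (auto simp: balanced_def)

lemma tens_closed [simp]:
  "\<lbrakk>m \<in> carrier M; n \<in> carrier N\<rbrakk> \<Longrightarrow> tens R M N m n \<in> carrier (tensor_group R M N)"
  by (auto simp: tensor_group_def FactGroup_def RCOSETS_def tens_def tensor_free_def Let_def
      keys_frag_of)

locale tensor_pair =
  fixes R :: "('r, 'xr) ring_scheme" and M :: "('r, 'm, 'xm) rmod_scheme"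
    and N :: "('r, 's, 'n, 'xn) bimod_scheme"
  assumes M: "right_module R M" and N: "left_module R N"
begin

interpretation M: right_module R M by (rule M)
interpretation N: left_module R N by (rule N)

abbreviation "F \<equiv> tensor_free M N"
abbreviation "Z \<equiv> tensor_null R M N"

interpretation F: comm_group F
  unfolding tensor_free_def by (rule abelian_free_Abelian_group)

lemma F_simps [simp]:
  "x \<otimes>\<^bsub>F\<^esub> y = x + y" "\<one>\<^bsub>F\<^esub> = 0"
  by (simp_all add: tensor_free_def)

lemma frag_of_in_F [simp]: "m \<in> carrier M \<Longrightarrow> n \<in> carrier N \<Longrightarrow> frag_of (m, n) \<in> carrier F"
  by (simp add: tensor_free_def keys_frag_of)

lemma F_carrier: "x \<in> carrier F \<longleftrightarrow> Poly_Mapping.keys x \<subseteq> carrier M \<times> carrier N"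
  by (simp add: tensor_free_def)

lemma F_diff: "x \<in> carrier F \<Longrightarrow> y \<in> carrier F \<Longrightarrow> x - y \<in> carrier F"
  using keys_diff[of x y] by (auto simp: tensor_free_def)

lemma inv_F: "x \<in> carrier F \<Longrightarrow> inv\<^bsub>F\<^esub> x = - x"
  by (simp add: tensor_free_def)

lemma relators_subset: "tensor_relators R M N \<subseteq> carrier F"
  by (auto simp: tensor_relators_def M.ract_closed N.lact_closed intro!: F_diff)

lemma Z_subgroup: "subgroup Z F"
  unfolding tensor_null_def by (rule F.generate_is_subgroup[OF relators_subset])

lemma Z_normal: "Z \<lhd> F"
  using Z_subgroup by (simp add: F.normal_iff_subgroup)

lemma tensor_group_simps:
  "carrier (tensor_group R M N) = {Z #>\<^bsub>F\<^esub> c | c. c \<in> carrier F}"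
  "add (tensor_group R M N) = mult (F Mod Z)"
  "\<zero>\<^bsub>tensor_group R M N\<^esub> = \<one>\<^bsub>F Mod Z\<^esub>"
  by (auto simp: tensor_group_def FactGroup_def RCOSETS_def Let_def)

lemma coset_add:
  "\<lbrakk>a \<in> carrier F; b \<in> carrier F\<rbrakk>
    \<Longrightarrow> (Z #>\<^bsub>F\<^esub> a) \<oplus>\<^bsub>tensor_group R M N\<^esub> (Z #>\<^bsub>F\<^esub> b) = Z #>\<^bsub>F\<^esub> (a + b)"
  using normal.rcos_sum[OF Z_normal, of a b] by (simp add: tensor_group_simps FactGroup_def)

lemma abelian_tensor_group: "abelian_group (tensor_group R M N)"
proof -
  interpret Q: comm_group "F Mod Z"
    by (rule F.abelian_FactGroup[OF Z_subgroup])
  have c: "carrier (tensor_group R M N) = carrier (F Mod Z)"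
    by (simp add: tensor_group_def Let_def)
  show ?thesis
  proof (rule abelian_groupI, unfold c tensor_group_simps(2,3))
    show "\<exists>y\<in>carrier (F Mod Z). y \<otimes>\<^bsub>F Mod Z\<^esub> x = \<one>\<^bsub>F Mod Z\<^esub>" if "x \<in> carrier (F Mod Z)" for x
      using Q.l_inv_ex[OF that] by blast
  qed (fact Q.m_closed Q.one_closed Q.m_assoc Q.m_comm Q.l_one)+
qed

lemma coset_eqI:
  assumes "a \<in> carrier F" "b \<in> carrier F" "a - b \<in> Z"
  shows "Z #>\<^bsub>F\<^esub> a = Z #>\<^bsub>F\<^esub> b"
proof -
  have "a \<in> Z #>\<^bsub>F\<^esub> b"
    using assms by (auto simp: r_coset_def intro!: bexI[of _ "a - b"])
  then show ?thesis
    using F.repr_independence[OF _ assms(2) Z_subgroup] by auto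
qed

lemma coset_add_eqI:
  assumes "a \<in> carrier F" "b \<in> carrier F" "c \<in> carrier F" "a - b - c \<in> tensor_relators R M N"
  shows "Z #>\<^bsub>F\<^esub> a = (Z #>\<^bsub>F\<^esub> b) \<oplus>\<^bsub>tensor_group R M N\<^esub> (Z #>\<^bsub>F\<^esub> c)"
proof -
  have "a - (b + c) \<in> Z"
    using assms(4) by (auto simp: tensor_null_def algebra_simps intro: generate.incl)
  moreover have "b + c \<in> carrier F"
    using F.m_closed[OF assms(2,3)] by simp
  ultimately show ?thesis
    using assms by (simp add: coset_add coset_eqI)
qed

lemma tens_add_left:
  "\<lbrakk>m \<in> carrier M; m' \<in> carrier M; n \<in> carrier N\<rbrakk> \<Longrightarrow>
    tens R M N (m \<oplus>\<^bsub>M\<^esub> m') n = tens R M N m n \<oplus>\<^bsub>tensor_group R M N\<^esub> tens R M N m' n"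
  unfolding tens_def by (rule coset_add_eqI) (auto simp: tensor_relators_def)

lemma tens_add_right:
  "\<lbrakk>m \<in> carrier M; n \<in> carrier N; n' \<in> carrier N\<rbrakk> \<Longrightarrow>
    tens R M N m (n \<oplus>\<^bsub>N\<^esub> n') = tens R M N m n \<oplus>\<^bsub>tensor_group R M N\<^esub> tens R M N m n'"
  unfolding tens_def by (rule coset_add_eqI) (auto simp: tensor_relators_def)

lemma tens_ract:
  "\<lbrakk>m \<in> carrier M; r \<in> carrier R; n \<in> carrier N\<rbrakk> \<Longrightarrow>
    tens R M N (m \<triangleleft>\<^bsub>M\<^esub> r) n = tens R M N m (r \<triangleright>\<^bsub>N\<^esub> n)"
  unfolding tens_def
  by (rule coset_eqI)
    (auto simp: tensor_null_def M.ract_closed N.lact_closed tensor_relators_def intro!: generate.incl)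

text \<open>Zero and negatives are themselves pure tensors: 0 is 0 \<otimes> 0, and the negative of
  m \<otimes> n is (-m) \<otimes> n. Hence every element is a sum of pure tensors and two cases are
  enough.\<close>

lemma tens_induct [consumes 1, case_names tens add]:
  assumes t: "t \<in> carrier (tensor_group R M N)"
    and tens: "\<And>m n. \<lbrakk>m \<in> carrier M; n \<in> carrier N\<rbrakk> \<Longrightarrow> P (tens R M N m n)"
    and add: "\<And>t u. \<lbrakk>t \<in> carrier (tensor_group R M N); u \<in> carrier (tensor_group R M N); P t; P u\<rbrakk>
      \<Longrightarrow> P (t \<oplus>\<^bsub>tensor_group R M N\<^esub> u)"
  shows "P t"
proof -
  let ?T = "tensor_group R M N"
  interpret T: abelian_group ?T by (rule abelian_tensor_group)
  obtain c where c: "c \<in> carrier F" "t = Z #>\<^bsub>F\<^esub> c"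
    using t by (auto simp: tensor_group_simps)
  have cl: "Z #>\<^bsub>F\<^esub> x \<in> carrier ?T" if "x \<in> carrier F" for x
    using that by (auto simp: tensor_group_simps)
  have zero: "P (Z #>\<^bsub>F\<^esub> 0)"
  proof -
    have h: "addhom M ?T (\<lambda>m. tens R M N m \<zero>\<^bsub>N\<^esub>)"
      by (auto intro: addhomI simp: tens_add_left)
    have "tens R M N \<zero>\<^bsub>M\<^esub> \<zero>\<^bsub>N\<^esub> = \<zero>\<^bsub>?T\<^esub>"
      using addhom_zero[OF M.M.abelian_group_axioms abelian_tensor_group h] .
    also have "\<dots> = Z #>\<^bsub>F\<^esub> 0"
      using subgroup.rcos_const[OF Z_subgroup F.group_axioms, of 0] subgroup.one_closed[OF Z_subgroup]
      by (simp add: tensor_group_simps FactGroup_def)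
    finally show ?thesis using tens[of "\<zero>\<^bsub>M\<^esub>" "\<zero>\<^bsub>N\<^esub>"] by simp
  qed
  \<comment> \<open>The class of the negated generator and (-m) \<otimes> n are both additive
    inverses of m \<otimes> n.\<close>
  have neg: "Z #>\<^bsub>F\<^esub> (- frag_of (m, n)) = tens R M N (\<ominus>\<^bsub>M\<^esub> m) n"
    if "m \<in> carrier M" "n \<in> carrier N" for m n
  proof -
    have h: "addhom M ?T (\<lambda>m. tens R M N m n)"
      using that by (auto intro: addhomI simp: tens_add_left)
    have 1: "tens R M N (\<ominus>\<^bsub>M\<^esub> m) n \<oplus>\<^bsub>?T\<^esub> tens R M N m n = \<zero>\<^bsub>?T\<^esub>"
      using that by (simp add: tens_add_left[symmetric] M.l_neg
          addhom_zero[OF M.M.abelian_group_axioms abelian_tensor_group h])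
    have mF: "- frag_of (m, n) \<in> carrier F"
      using that by (simp add: tensor_free_def)
    have "(Z #>\<^bsub>F\<^esub> (- frag_of (m, n))) \<oplus>\<^bsub>?T\<^esub> tens R M N m n = Z #>\<^bsub>F\<^esub> 0"
      using that mF by (simp add: tens_def coset_add)
    also have "\<dots> = \<zero>\<^bsub>?T\<^esub>"
      using subgroup.rcos_const[OF Z_subgroup F.group_axioms, of 0] subgroup.one_closed[OF Z_subgroup]
      by (simp add: tensor_group_simps FactGroup_def)
    finally have "(Z #>\<^bsub>F\<^esub> (- frag_of (m, n))) \<oplus>\<^bsub>?T\<^esub> tens R M N m n
        = tens R M N (\<ominus>\<^bsub>M\<^esub> m) n \<oplus>\<^bsub>?T\<^esub> tens R M N m n"
      using 1 by simp
    then show ?thesis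
      using that mF cl by (subst (asm) T.add.right_cancel) auto
  qed
  have neg_F: "- b \<in> carrier F" if "b \<in> carrier F" for b
    using F.inv_closed[OF that] that by (simp add: inv_F)
  \<comment> \<open>\<open>frag_induction\<close> proceeds by differences, so the predicate is
    carried for c and for -c at once; membership in the free group is carried along because the
    difference case does not supply it.\<close>
  have "Poly_Mapping.keys c \<subseteq> carrier M \<times> carrier N \<and> P (Z #>\<^bsub>F\<^esub> c) \<and> P (Z #>\<^bsub>F\<^esub> (- c))"
    using c(1) unfolding F_carrier
  proof (induction c rule: frag_induction)
    case zero
    then show ?case using \<open>P (Z #>\<^bsub>F\<^esub> 0)\<close> by simp
  next
    case (one x)
    obtain m n where "x = (m, n)" by (cases x)
    then show ?case
      using one neg[of m n] tens[of m n] tens[of "\<ominus>\<^bsub>M\<^esub> m" n]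
      by (simp add: tens_def keys_frag_of)
  next
    case (diff a b)
    have "P (Z #>\<^bsub>F\<^esub> (x - y))" if "x \<in> carrier F" "y \<in> carrier F"
      "P (Z #>\<^bsub>F\<^esub> x)" "P (Z #>\<^bsub>F\<^esub> (- y))" for x y
      using add[OF cl cl that(3,4)] that(1) neg_F[OF that(2)] by (simp add: coset_add)
    from this[of a b] this[of b a] show ?case using diff F_diff[of a b] by (simp add: F_carrier)
  qed
  then show ?thesis by (simp add: c(2))
qed


text \<open>\<open>tensor_lift\<close> evaluates on a chosen representative. The free group provides
  a homomorphism h with the prescribed values on generators; balancedness makes h vanish on the
  relators, hence on the subgroup they generate, so every representative gives the value of
  h.\<close>

lemma tensor_lift_coset:
  assumes G: "abelian_group G" and \<phi>: "balanced R M N G \<phi>"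
  obtains h where "h \<in> hom F (add_monoid G)"
    and "\<And>c. c \<in> carrier F \<Longrightarrow> tensor_lift G \<phi> (Z #>\<^bsub>F\<^esub> c) = h c"
    and "\<And>m n. \<lbrakk>m \<in> carrier M; n \<in> carrier N\<rbrakk> \<Longrightarrow> h (frag_of (m, n)) = \<phi> m n"
proof -
  interpret G: abelian_group G by (rule G)
  have \<phi>_cl: "\<phi> m n \<in> carrier G" if "m \<in> carrier M" "n \<in> carrier N" for m n
    using \<phi> that by (auto simp: balanced_def addhom_def)
  have im: "(\<lambda>p. \<phi> (fst p) (snd p)) ` (carrier M \<times> carrier N) \<subseteq> carrier (add_monoid G)"
    using \<phi>_cl by auto
  obtain h where h: "h \<in> hom F (add_monoid G)"
    and h_frag: "\<And>p. p \<in> carrier M \<times> carrier N \<Longrightarrow> h (frag_of p) = \<phi> (fst p) (snd p)"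
    using comm_group.free_Abelian_group_universal[OF G.a_comm_group im]
    unfolding tensor_free_def by blast
  interpret h: group_hom F "add_monoid G" h
    by (simp add: group_hom_def group_hom_axioms_def h G.a_group)
  have h_add: "h (x + y) = h x \<oplus>\<^bsub>G\<^esub> h y" if "x \<in> carrier F" "y \<in> carrier F" for x y
    using h.hom_mult[OF that] by simp
  have h_cl: "h x \<in> carrier G" if "x \<in> carrier F" for x
    using h.hom_closed[OF that] by simp
  have h_diff: "h (x - y) = h x \<ominus>\<^bsub>G\<^esub> h y" if "x \<in> carrier F" "y \<in> carrier F" for x y
  proof -
    have "h x = h (x - y) \<oplus>\<^bsub>G\<^esub> h y"
      using h_add[OF F_diff[OF that] that(2)] by simp
    then show ?thesis
      using h_cl that F_diff[OF that] by (simp add: a_minus_def G.a_assoc G.r_neg)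
  qed
  have h_cmul: "h (frag_cmul k (frag_of p)) = [k] \<cdot>\<^bsub>G\<^esub> \<phi> (fst p) (snd p)"
    if "p \<in> carrier M \<times> carrier N" for k p
  proof -
    have "frag_cmul k (frag_of p) = frag_of p [^]\<^bsub>F\<^esub> k"
      using that by (simp add: tensor_free_def keys_frag_of)
    moreover have "frag_of p \<in> carrier F"
      using that by (simp add: tensor_free_def keys_frag_of)
    ultimately show ?thesis
      using h.hom_int_pow[of "frag_of p" k] h_frag[OF that] by (simp add: add_pow_def)
  qed
  have sum: "(\<Oplus>\<^bsub>G\<^esub>p\<in>J. [k p] \<cdot>\<^bsub>G\<^esub> \<phi> (fst p) (snd p)) = h (\<Sum>p\<in>J. frag_cmul (k p) (frag_of p))
      \<and> (\<Sum>p\<in>J. frag_cmul (k p) (frag_of p)) \<in> carrier F"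
    if "finite J" "J \<subseteq> carrier M \<times> carrier N" for J k
    using that
  proof (induction J rule: finite_induct)
    case empty
    then show ?case using h.hom_one F.one_closed by simp
  next
    case (insert p J)
    have 1: "frag_cmul (k p) (frag_of p) \<in> carrier F"
      using insert.prems by (auto simp: F_carrier)
    have "[k x] \<cdot>\<^bsub>G\<^esub> \<phi> (fst x) (snd x) \<in> carrier G" if "x \<in> insert p J" for x
      using that insert.prems \<phi>_cl by (intro G.add.int_pow_closed) auto
    then have "(\<Oplus>\<^bsub>G\<^esub>x\<in>insert p J. [k x] \<cdot>\<^bsub>G\<^esub> \<phi> (fst x) (snd x))
        = [k p] \<cdot>\<^bsub>G\<^esub> \<phi> (fst p) (snd p) \<oplus>\<^bsub>G\<^esub> (\<Oplus>\<^bsub>G\<^esub>x\<in>J. [k x] \<cdot>\<^bsub>G\<^esub> \<phi> (fst x) (snd x))"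
      using insert.hyps by (intro G.finsum_insert) auto
    then show ?case
      using insert 1 F.m_closed[OF 1] h_cmul[of p "k p"] by (simp add: h_add)
  qed
  \<comment> \<open>The sum in the definition of \<open>tensor_lift\<close> is h applied to the
    expansion of c into generators.\<close>
  have rep: "(\<Oplus>\<^bsub>G\<^esub>p\<in>Poly_Mapping.keys c. [Poly_Mapping.lookup c p] \<cdot>\<^bsub>G\<^esub> \<phi> (fst p) (snd p)) = h c"
    if "c \<in> carrier F" for c
    using sum[of "Poly_Mapping.keys c" "Poly_Mapping.lookup c"] that frag_expansion[of c]
    by (simp add: F_carrier frag_extend_def)
  have eq0: "h (x - y) = \<zero>\<^bsub>G\<^esub>" if "x \<in> carrier F" "y \<in> carrier F" "h x = h y" for x y
    using that h_cl by (simp add: h_diff a_minus_def G.r_neg)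
  \<comment> \<open>Each relator is a generator minus one or two others, and balancedness says
    exactly that their values under \<phi> cancel.\<close>
  have rel: "h x = \<zero>\<^bsub>G\<^esub>" if "x \<in> tensor_relators R M N" for x
  proof -
    have m: "\<phi> (m \<oplus>\<^bsub>M\<^esub> m') n = \<phi> m n \<oplus>\<^bsub>G\<^esub> \<phi> m' n"
      if "m \<in> carrier M" "m' \<in> carrier M" "n \<in> carrier N" for m m' n
      using \<phi> that by (auto simp: balanced_def addhom_def)
    have n: "\<phi> m (n \<oplus>\<^bsub>N\<^esub> n') = \<phi> m n \<oplus>\<^bsub>G\<^esub> \<phi> m n'"
      if "m \<in> carrier M" "n' \<in> carrier N" "n \<in> carrier N" for m n n'
      using \<phi> that by (auto simp: balanced_def addhom_def)
    have r: "\<phi> (m \<triangleleft>\<^bsub>M\<^esub> r) n = \<phi> m (r \<triangleright>\<^bsub>N\<^esub> n)"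
      if "m \<in> carrier M" "r \<in> carrier R" "n \<in> carrier N" for m r n
      using \<phi> that by (auto simp: balanced_def)
    have F2: "frag_of x + frag_of y \<in> carrier F"
      if "x \<in> carrier M \<times> carrier N" "y \<in> carrier M \<times> carrier N" for x y
      using that F.m_closed[of "frag_of x" "frag_of y"] by (auto simp: frag_of_in_F)
    have "h (frag_of x - frag_of y - frag_of z) = \<zero>\<^bsub>G\<^esub>"
      if "x \<in> carrier M \<times> carrier N" "y \<in> carrier M \<times> carrier N" "z \<in> carrier M \<times> carrier N"
        "\<phi> (fst x) (snd x) = \<phi> (fst y) (snd y) \<oplus>\<^bsub>G\<^esub> \<phi> (fst z) (snd z)" for x y z
    proof -
      have "frag_of p \<in> carrier F" if "p \<in> carrier M \<times> carrier N" for p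
        using that by (auto simp: frag_of_in_F)
      then have "h (frag_of x - (frag_of y + frag_of z)) = \<zero>\<^bsub>G\<^esub>"
        using that by (intro eq0 F2) (auto simp: h_add h_frag)
      then show ?thesis by (simp add: diff_diff_eq)
    qed
    moreover have "h (frag_of x - frag_of y) = \<zero>\<^bsub>G\<^esub>"
      if "x \<in> carrier M \<times> carrier N" "y \<in> carrier M \<times> carrier N"
        "\<phi> (fst x) (snd x) = \<phi> (fst y) (snd y)" for x y
    proof (rule eq0)
      show "h (frag_of x) = h (frag_of y)" using that by (simp add: h_frag)
    qed (use that in \<open>auto simp: F_carrier keys_frag_of\<close>)
    ultimately show ?thesis
      using that by (auto simp: tensor_relators_def m n r M.ract_closed N.lact_closed)
  qed
  have Z0: "h z = \<zero>\<^bsub>G\<^esub>" if "z \<in> Z" for z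
    using that unfolding tensor_null_def
  proof (induction rule: generate.induct)
    case (inv x)
    then have "x \<in> carrier F" using relators_subset by auto
    then show ?case
      using h.hom_inv[of x] rel[OF inv] G.add.inv_one by (simp add: a_inv_def)
  next
    case (eng x y)
    then have "x \<in> carrier F" "y \<in> carrier F"
      using F.generate_incl[OF relators_subset] by auto
    then show ?case using eng h_add by simp
  qed (use rel h.hom_one in auto)
  have "tensor_lift G \<phi> (Z #>\<^bsub>F\<^esub> c) = h c" if c: "c \<in> carrier F" for c
  proof -
    define c' where "c' = (SOME c'. c' \<in> Z #>\<^bsub>F\<^esub> c)"
    have "c \<in> Z #>\<^bsub>F\<^esub> c"
      by (rule F.rcos_self[OF c Z_subgroup])
    then have "c' \<in> Z #>\<^bsub>F\<^esub> c"
      unfolding c'_def by (rule someI)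
    then obtain z where z: "z \<in> Z" "c' = z + c"
      by (auto simp: r_coset_def)
    have zF: "z \<in> carrier F"
      using subgroup.subset[OF Z_subgroup] z(1) by blast
    then have c'F: "c' \<in> carrier F"
      using F.m_closed[OF zF c] z(2) by simp
    have "tensor_lift G \<phi> (Z #>\<^bsub>F\<^esub> c) = h c'"
      using rep[OF c'F] by (simp add: tensor_lift_def c'_def)
    then show ?thesis
      using z zF c h_cl Z0 by (simp add: h_add)
  qed
  then show ?thesis
    using that[OF h] h_frag by auto
qed

lemma tensor_lift_addhom:
  assumes G: "abelian_group G" and \<phi>: "balanced R M N G \<phi>"
  shows "addhom (tensor_group R M N) G (tensor_lift G \<phi>)"
proof -
  obtain h where h: "h \<in> hom F (add_monoid G)"
    and eq: "\<And>c. c \<in> carrier F \<Longrightarrow> tensor_lift G \<phi> (Z #>\<^bsub>F\<^esub> c) = h c"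
    by (rule tensor_lift_coset[OF assms]) (rule that)
  have "a + b \<in> carrier F" if "a \<in> carrier F" "b \<in> carrier F" for a b
    using F.m_closed[OF that] by simp
  then show ?thesis
    using hom_in_carrier[OF h] hom_mult[OF h]
    by (intro addhomI) (auto simp: tensor_group_simps(1) eq coset_add)
qed

lemma tensor_lift_tens:
  assumes "abelian_group G" and "balanced R M N G \<phi>" and "m \<in> carrier M" "n \<in> carrier N"
  shows "tensor_lift G \<phi> (tens R M N m n) = \<phi> m n"
proof -
  obtain h where "h \<in> hom F (add_monoid G)"
    and "\<And>c. c \<in> carrier F \<Longrightarrow> tensor_lift G \<phi> (Z #>\<^bsub>F\<^esub> c) = h c"
    and "\<And>m n. \<lbrakk>m \<in> carrier M; n \<in> carrier N\<rbrakk> \<Longrightarrow> h (frag_of (m, n)) = \<phi> m n"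
    by (rule tensor_lift_coset[OF assms(1,2)]) (rule that)
  then show ?thesis
    using assms(3,4) by (simp add: tens_def)
qed

end

lemmas abelian_tensor_group [simp] = tensor_pair.abelian_tensor_group[OF tensor_pair.intro]
lemmas tens_add_left = tensor_pair.tens_add_left[OF tensor_pair.intro]
lemmas tens_add_right = tensor_pair.tens_add_right[OF tensor_pair.intro]
lemmas tens_ract = tensor_pair.tens_ract[OF tensor_pair.intro]
lemmas tens_induct = tensor_pair.tens_induct[OF tensor_pair.intro, consumes 3, case_names tens add]
lemmas tensor_lift_addhom = tensor_pair.tensor_lift_addhom[OF tensor_pair.intro]
lemmas tensor_lift_tens = tensor_pair.tensor_lift_tens[OF tensor_pair.intro]

text \<open>Pure tensors generate the group additively and both maps already live on the quotient,
  so no relation has to be checked. Most identities below are reduced to an explicit computation by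
  this rule; its price is that each composite must first be shown to be additive.\<close>

lemma tensor_eqI:
  assumes "right_module R M" "left_module R N"
    and "addhom (tensor_group R M N) G f" "addhom (tensor_group R M N) G g"
    and "t \<in> carrier (tensor_group R M N)"
    and "\<And>m n. \<lbrakk>m \<in> carrier M; n \<in> carrier N\<rbrakk> \<Longrightarrow> f (tens R M N m n) = g (tens R M N m n)"
  shows "f t = g t"
  using assms(1,2,5)
proof (induction rule: tens_induct)
  case (tens m n)
  then show ?case by (rule assms(6))
next
  case (add t u)
  then show ?case by (simp add: addhom_add[OF assms(3)] addhom_add[OF assms(4)])
qed

lemma addhom_tens_left:
  assumes "right_module R M" "left_module R N" "n \<in> carrier N" "addhom P M f"
  shows "addhom P (tensor_group R M N) (\<lambda>x. tens R M N (f x) n)"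
  using assms(3,4) by (auto simp: addhom_def Pi_def tens_add_left[OF assms(1,2)])

lemma addhom_tens_right:
  assumes "right_module R M" "left_module R N" "m \<in> carrier M" "addhom P N f"
  shows "addhom P (tensor_group R M N) (\<lambda>x. tens R M N m (f x))"
  using assms(3,4) by (auto simp: addhom_def Pi_def tens_add_right[OF assms(1,2)])

lemma tens_finsum_left:
  assumes "right_module R M" "left_module R N" "n \<in> carrier N" "finite I"
    and "\<And>i. i \<in> I \<Longrightarrow> f i \<in> carrier M"
  shows "tens R M N (finsum M f I) n = finsum (tensor_group R M N) (\<lambda>i. tens R M N (f i) n) I"
  using assms by (intro addhom_finsum addhom_tens_left addhom_ident right_module_abelian abelian_tensor_group)

lemma tens_finsum_right:
  assumes "right_module R M" "left_module R N" "m \<in> carrier M" "finite I"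
    and "\<And>i. i \<in> I \<Longrightarrow> f i \<in> carrier N"
  shows "tens R M N m (finsum N f I) = finsum (tensor_group R M N) (\<lambda>i. tens R M N m (f i)) I"
  using assms by (intro addhom_finsum addhom_tens_right addhom_ident left_module_abelian abelian_tensor_group)

lemma balanced_tens:
  assumes "right_module R M" "left_module R N"
  shows "balanced R M N (tensor_group R M N) (tens R M N)"
  using assms by (intro balancedI addhom_tens_left addhom_tens_right addhom_ident) (auto simp: tens_ract)

section \<open>Module structures on tensor products\<close>

lemma rtensor_simps [simp]:
  "carrier (rtensor R M N) = carrier (tensor_group R M N)"
  "add (rtensor R M N) = add (tensor_group R M N)"
  "\<zero>\<^bsub>rtensor R M N\<^esub> = \<zero>\<^bsub>tensor_group R M N\<^esub>"
  by (simp_all add: rtensor_def ring.defs)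

lemma btensor_simps [simp]:
  "carrier (btensor R M N) = carrier (tensor_group R M N)"
  "add (btensor R M N) = add (tensor_group R M N)"
  "\<zero>\<^bsub>btensor R M N\<^esub> = \<zero>\<^bsub>tensor_group R M N\<^esub>"
  "ract (btensor R M N) = ract (rtensor R M N)"
  by (simp_all add: btensor_def rmod.defs)

text \<open>Negative multiples involve inverses, whose definition refers to the carrier; hence the
  third premise.\<close>

lemma add_pow_record_cong:
  assumes "add G = add H" "\<zero>\<^bsub>G\<^esub> = \<zero>\<^bsub>H\<^esub>" "carrier G = carrier H"
  shows "[(k::int)] \<cdot>\<^bsub>G\<^esub> x = [k] \<cdot>\<^bsub>H\<^esub> x"
  using assms by (simp add: add_pow_def int_pow_def nat_pow_def m_inv_def Let_def)

lemma tensor_lift_record_cong: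
  assumes "add G = add H" "\<zero>\<^bsub>G\<^esub> = \<zero>\<^bsub>H\<^esub>" "carrier G = carrier H"
  shows "tensor_lift G \<phi> = tensor_lift H \<phi>"
  by (intro ext)
    (simp only: tensor_lift_def add_pow_record_cong[OF assms] finsum_record_cong[OF assms(3,1,2)])

lemma addhom_record_cong:
  assumes "add G = add H" "carrier G = carrier H"
  shows "addhom P G = addhom P H" "addhom G Q = addhom H Q"
  using assms by (auto simp: addhom_def fun_eq_iff)

text \<open>Simplification moves additive statements about the module records to the bare
  \<open>tensor_group\<close>, so that they have one normal form whichever actions are
  attached.\<close>

lemma rtensor_record_simps [simp]:
  "finsum (rtensor R M N) f I = finsum (tensor_group R M N) f I"
  "abelian_group (rtensor R M N) \<longleftrightarrow> abelian_group (tensor_group R M N)"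
  "tensor_lift (rtensor R M N) \<phi> = tensor_lift (tensor_group R M N) \<phi>"
  "addhom P (rtensor R M N) = addhom P (tensor_group R M N)"
  "addhom (rtensor R M N) Q = addhom (tensor_group R M N) Q"
  by (intro finsum_record_cong abelian_group_record_cong
      tensor_lift_record_cong addhom_record_cong; simp)+

lemma btensor_record_simps [simp]:
  "finsum (btensor R M N) f I = finsum (tensor_group R M N) f I"
  "abelian_group (btensor R M N) \<longleftrightarrow> abelian_group (tensor_group R M N)"
  "tensor_lift (btensor R M N) \<phi> = tensor_lift (tensor_group R M N) \<phi>"
  "addhom P (btensor R M N) = addhom P (tensor_group R M N)"
  "addhom (btensor R M N) Q = addhom (tensor_group R M N) Q"
  by (intro finsum_record_cong abelian_group_record_cong
      tensor_lift_record_cong addhom_record_cong; simp)+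

context
  fixes R :: "('r, 'xr) ring_scheme" and T :: "('t, 'xt) ring_scheme"
    and M :: "('r, 'm, 'xm) rmod_scheme" and N :: "('r, 't, 'n, 'xn) bimod_scheme"
  assumes M: "right_module R M" and N: "bimodule R T N"
begin

private lemma N_left: "left_module R N" by (rule bimodule_left[OF N])
private lemma N_right: "right_module T N" by (rule bimodule_right[OF N])

text \<open>The right action on the second factor respects the middle relation because the two
  actions on \<open>N\<close> commute.\<close>

lemma rtensor_ract_balanced:
  assumes "t \<in> carrier T"
  shows "balanced R M N (tensor_group R M N) (\<lambda>m n. tens R M N m (n \<triangleleft>\<^bsub>N\<^esub> t))"
  using assms
  by (intro balancedI addhom_tens_left[OF M N_left] addhom_tens_right[OF M N_left]
      addhom_ract[OF N_right] addhom_ident)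
    (auto simp: bimodule_commute[OF N] right_module.ract_closed[OF N_right] tens_ract[OF M N_left])

lemma rtensor_ract_tens:
  assumes "m \<in> carrier M" "n \<in> carrier N" "t \<in> carrier T"
  shows "tens R M N m n \<triangleleft>\<^bsub>rtensor R M N\<^esub> t = tens R M N m (n \<triangleleft>\<^bsub>N\<^esub> t)"
  using assms
  by (simp add: rtensor_def ring.defs rmod.defs
      tensor_lift_tens[OF M N_left abelian_tensor_group[OF M N_left] rtensor_ract_balanced])

lemma rtensor_ract_addhom:
  assumes "t \<in> carrier T"
  shows "addhom (tensor_group R M N) (tensor_group R M N) (\<lambda>q. q \<triangleleft>\<^bsub>rtensor R M N\<^esub> t)"
  using tensor_lift_addhom[OF M N_left abelian_tensor_group[OF M N_left] rtensor_ract_balanced[OF assms]]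
  by (simp add: rtensor_def ring.defs rmod.defs)

lemma rtensor_right_module [simp]: "right_module T (rtensor R M N)"
proof -
  interpret T: ring T by (rule right_module_ring[OF N_right])
  interpret N: right_module T N by (rule N_right)
  let ?T = "tensor_group R M N"
  interpret Q: abelian_group ?T by (rule abelian_tensor_group[OF M N_left])
  note h = rtensor_ract_addhom
  note cl = addhom_closed[OF h]
  show ?thesis
  proof (intro right_module.intro right_module_axioms.intro T.ring_axioms, goal_cases)
    case 1
    then show ?case by (simp add: Q.abelian_group_axioms)
  next
    case (2 q t)
    then show ?case by (simp add: cl)
  next
    case (3 q q' t)
    then show ?case by (simp add: addhom_add[OF h])
  next
    case (4 q t t')
    have "q \<triangleleft>\<^bsub>rtensor R M N\<^esub> (t \<oplus>\<^bsub>T\<^esub> t') = q \<triangleleft>\<^bsub>rtensor R M N\<^esub> t \<oplus>\<^bsub>?T\<^esub> q \<triangleleft>\<^bsub>rtensor R M N\<^esub> t'"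
      by (rule tensor_eqI[OF M N_left])
        (use 4 in \<open>auto intro!: h addhom_sum2 Q.abelian_group_axioms
          simp: rtensor_ract_tens N.ract_add_right N.ract_closed tens_add_right[OF M N_left]\<close>)
    then show ?case by simp
  next
    case (5 q t t')
    show ?case
      by (rule tensor_eqI[OF M N_left])
        (use 5 in \<open>auto intro!: h addhom_compose[OF h h] simp: rtensor_ract_tens N.ract_mult N.ract_closed\<close>)
  next
    case (6 q)
    show ?case
      by (rule tensor_eqI[OF M N_left])
        (use 6 in \<open>auto intro!: h addhom_ident simp: rtensor_ract_tens N.ract_one\<close>)
  qed
qed

end

context
  fixes L :: "('l, 'xl) ring_scheme" and R :: "('r, 'xr) ring_scheme"
    and M :: "('l, 'r, 'm, 'xm) bimod_scheme" and N :: "('r, 't, 'n, 'xn) bimod_scheme"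
  assumes M: "bimodule L R M" and N: "left_module R N"
begin

private lemma M_left: "left_module L M" by (rule bimodule_left[OF M])
private lemma M_right: "right_module R M" by (rule bimodule_right[OF M])

lemma btensor_lact_balanced:
  assumes "l \<in> carrier L"
  shows "balanced R M N (tensor_group R M N) (\<lambda>m n. tens R M N (l \<triangleright>\<^bsub>M\<^esub> m) n)"
  using assms
  by (intro balancedI addhom_tens_left[OF M_right N] addhom_tens_right[OF M_right N]
      addhom_lact[OF M_left] addhom_ident)
    (auto simp: bimodule_commute[OF M, symmetric] left_module.lact_closed[OF M_left]
      tens_ract[OF M_right N])

lemma btensor_lact_tens:
  assumes "m \<in> carrier M" "n \<in> carrier N" "l \<in> carrier L"
  shows "l \<triangleright>\<^bsub>btensor R M N\<^esub> tens R M N m n = tens R M N (l \<triangleright>\<^bsub>M\<^esub> m) n"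
  using assms
  by (simp add: btensor_def rmod.defs bimod.defs
      tensor_lift_tens[OF M_right N abelian_tensor_group[OF M_right N] btensor_lact_balanced])

lemma btensor_lact_addhom:
  assumes "l \<in> carrier L"
  shows "addhom (tensor_group R M N) (tensor_group R M N) (\<lambda>q. l \<triangleright>\<^bsub>btensor R M N\<^esub> q)"
  using tensor_lift_addhom[OF M_right N abelian_tensor_group[OF M_right N] btensor_lact_balanced[OF assms]]
  by (simp add: btensor_def rmod.defs bimod.defs)

lemma btensor_left_module [simp]: "left_module L (btensor R M N)"
proof -
  interpret L: ring L by (rule left_module_ring[OF M_left])
  interpret M: left_module L M by (rule M_left)
  let ?T = "tensor_group R M N"
  interpret Q: abelian_group ?T by (rule abelian_tensor_group[OF M_right N])
  note h = btensor_lact_addhom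
  note cl = addhom_closed[OF h]
  show ?thesis
  proof (intro left_module.intro left_module_axioms.intro L.ring_axioms, goal_cases)
    case 1
    then show ?case by (simp add: Q.abelian_group_axioms)
  next
    case (2 l q)
    then show ?case by (simp add: cl)
  next
    case (3 l q q')
    then show ?case by (simp add: addhom_add[OF h])
  next
    case (4 l l' q)
    have "(l \<oplus>\<^bsub>L\<^esub> l') \<triangleright>\<^bsub>btensor R M N\<^esub> q = l \<triangleright>\<^bsub>btensor R M N\<^esub> q \<oplus>\<^bsub>?T\<^esub> l' \<triangleright>\<^bsub>btensor R M N\<^esub> q"
      by (rule tensor_eqI[OF M_right N])
        (use 4 in \<open>auto intro!: h addhom_sum2 Q.abelian_group_axioms
          simp: btensor_lact_tens M.lact_add_left M.lact_closed tens_add_left[OF M_right N]\<close>)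
    then show ?case by simp
  next
    case (5 l l' q)
    show ?case
      by (rule tensor_eqI[OF M_right N])
        (use 5 in \<open>auto intro!: h addhom_compose[OF h h] simp: btensor_lact_tens M.lact_mult M.lact_closed\<close>)
  next
    case (6 q)
    show ?case
      by (rule tensor_eqI[OF M_right N])
        (use 6 in \<open>auto intro!: h addhom_ident simp: btensor_lact_tens M.lact_one\<close>)
  qed
qed

end

lemma right_module_record_cong:
  assumes "right_module A M" "carrier M = carrier M'" "add M = add M'" "\<zero>\<^bsub>M\<^esub> = \<zero>\<^bsub>M'\<^esub>"
    "ract M = ract M'"
  shows "right_module A M'"
proof -
  interpret right_module A M by fact
  have "abelian_group M'"
    using abelian_group_record_cong[OF assms(2-4)] M.abelian_group_axioms by simp
  then show ?thesis
    using right_module_axioms assms(2-5)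
    by (simp add: right_module_def right_module_axioms_def)
qed

lemma btensor_right_module [simp]:
  "\<lbrakk>right_module R M; bimodule R T N\<rbrakk> \<Longrightarrow> right_module T (btensor R M N)"
  by (rule right_module_record_cong[OF rtensor_right_module]) auto

text \<open>The outer actions touch different factors, so they commute on pure tensors and hence
  everywhere.\<close>

lemma btensor_bimodule [simp]:
  assumes M: "bimodule L R M" and N: "bimodule R T N"
  shows "bimodule L T (btensor R M N)"
proof -
  note m = bimodule_right[OF M] and n = bimodule_left[OF N]
  have "(l \<triangleright>\<^bsub>btensor R M N\<^esub> q) \<triangleleft>\<^bsub>rtensor R M N\<^esub> t = l \<triangleright>\<^bsub>btensor R M N\<^esub> (q \<triangleleft>\<^bsub>rtensor R M N\<^esub> t)"
    if "l \<in> carrier L" "t \<in> carrier T" "q \<in> carrier (tensor_group R M N)" for l t q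
    by (rule tensor_eqI[OF m n, where G = "tensor_group R M N"
          and f = "\<lambda>q. (l \<triangleright>\<^bsub>btensor R M N\<^esub> q) \<triangleleft>\<^bsub>rtensor R M N\<^esub> t"
          and g = "\<lambda>q. l \<triangleright>\<^bsub>btensor R M N\<^esub> (q \<triangleleft>\<^bsub>rtensor R M N\<^esub> t)"])
      (use that in \<open>auto intro!: addhom_compose[OF btensor_lact_addhom[OF M n] rtensor_ract_addhom[OF m N]]
        addhom_compose[OF rtensor_ract_addhom[OF m N] btensor_lact_addhom[OF M n]]
        simp: rtensor_ract_tens[OF m N] btensor_lact_tens[OF M n] bimodule_commute[OF M] left_module.lact_closed[OF bimodule_left[OF M]] right_module.ract_closed[OF bimodule_right[OF N]]\<close>)
  then show ?thesis
    using m n M N by (auto simp: bimodule_def[of L T "btensor R M N"])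
qed

lemma rtensor_cong:
  assumes "carrier M = carrier M'" "add M = add M'" "ract M = ract M'"
    and "carrier N = carrier N'" "add N = add N'" "lact N = lact N'" "ract N = ract N'"
  shows "rtensor R M N = rtensor R M' N'"
  using tens_cong[OF assms(1-6), where R = R] assms(7) by (simp add: rtensor_def)

lemma left_module_record_cong:
  assumes "left_module A M" "carrier M = carrier M'" "add M = add M'" "\<zero>\<^bsub>M\<^esub> = \<zero>\<^bsub>M'\<^esub>"
    "lact M = lact M'"
  shows "left_module A M'"
proof -
  interpret left_module A M by fact
  have "abelian_group M'"
    using abelian_group_record_cong[OF assms(2-4)] M.abelian_group_axioms by simp
  then show ?thesis
    using left_module_axioms assms(2-5)
    by (simp add: left_module_def left_module_axioms_def)
qed

lemma bimodule_record_cong: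
  assumes "bimodule R T M" "carrier M = carrier M'" "add M = add M'" "\<zero>\<^bsub>M\<^esub> = \<zero>\<^bsub>M'\<^esub>"
    "lact M = lact M'" "ract M = ract M'"
  shows "bimodule R T M'"
  unfolding bimodule_def
proof (intro conjI ballI)
  show "left_module R M'"
    by (rule left_module_record_cong[OF bimodule_left[OF assms(1)] assms(2-5)])
  show "right_module T M'"
    by (rule right_module_record_cong[OF bimodule_right[OF assms(1)] assms(2-4,6)])
qed (use bimodule_commute[OF assms(1)] assms(2-6) in simp)

lemma central_bimoduleI:
  assumes "unital_algebra K R" "unital_algebra K T" and M: "bimodule R T M"
    and "\<And>k m. \<lbrakk>k \<in> carrier K; m \<in> carrier M\<rbrakk>
        \<Longrightarrow> (k \<odot>\<^bsub>R\<^esub> \<one>\<^bsub>R\<^esub>) \<triangleright>\<^bsub>M\<^esub> m = m \<triangleleft>\<^bsub>M\<^esub> (k \<odot>\<^bsub>T\<^esub> \<one>\<^bsub>T\<^esub>)"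
  shows "central_bimodule K R T M"
proof -
  interpret left_module R M by (rule bimodule_left[OF M])
  show ?thesis
    by (intro central_bimodule.intro central_bimodule_axioms.intro assms(1,2) bimodule_right[OF M]
        lact_closed lact_add_right lact_add_left lact_mult lact_one bimodule_commute[OF M] assms(4))
qed

section \<open>Maps between tensor products\<close>

text \<open>Supplies the second additivity of an iterated lift: if a family of balanced maps depends
  additively on a parameter, so do the lifts. This makes the outer map of a nested
  \<open>tensor_lift\<close> biadditive.\<close>

lemma addhom_tensor_lift_param:
  assumes M: "right_module R M" and N: "left_module R N" and G: "abelian_group G"
    and \<phi>: "\<And>x. x \<in> carrier P \<Longrightarrow> balanced R M N G (\<phi> x)"
    and P: "abelian_group P"
    and add: "\<And>m n. \<lbrakk>m \<in> carrier M; n \<in> carrier N\<rbrakk> \<Longrightarrow> addhom P G (\<lambda>x. \<phi> x m n)"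
    and q: "q \<in> carrier (tensor_group R M N)"
  shows "addhom P G (\<lambda>x. tensor_lift G (\<phi> x) q)"
proof (rule addhomI)
  note h = tensor_lift_addhom[OF M N G \<phi>]
  show "tensor_lift G (\<phi> x) q \<in> carrier G" if "x \<in> carrier P" for x
    by (rule addhom_closed[OF h[OF that] q])
  show "tensor_lift G (\<phi> (x \<oplus>\<^bsub>P\<^esub> y)) q = tensor_lift G (\<phi> x) q \<oplus>\<^bsub>G\<^esub> tensor_lift G (\<phi> y) q"
    if xy: "x \<in> carrier P" "y \<in> carrier P" for x y
  proof -
    have s: "x \<oplus>\<^bsub>P\<^esub> y \<in> carrier P" using abelian_groupE(1)[OF P] xy by blast
    show ?thesis
      by (rule tensor_eqI[OF M N h[OF s] addhom_sum2[OF G h[OF xy(1)] h[OF xy(2)]] q])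
        (simp add: tensor_lift_tens[OF M N G \<phi>] s xy addhom_add[OF add])
  qed
qed

locale tensor_map_setup =
  fixes R :: "('r, 'xr) ring_scheme"
    and M :: "('r, 'm, 'xm) rmod_scheme" and N :: "('r, 's, 'n, 'xn) bimod_scheme"
    and M' :: "('r, 'm1, 'xm1) rmod_scheme" and N' :: "('r, 's1, 'n1, 'xn1) bimod_scheme"
    and f g
  assumes M: "right_module R M" and N: "left_module R N"
    and M': "right_module R M'" and N': "left_module R N'"
    and f: "right_linear R M M' f" and g: "left_linear R N N' g"
begin

lemma balanced_map: "balanced R M N (tensor_group R M' N') (\<lambda>m n. tens R M' N' (f m) (g n))"
proof -
  have gh: "addhom N N' g" and gr: "\<And>r x. \<lbrakk>r \<in> carrier R; x \<in> carrier N\<rbrakk> \<Longrightarrow> g (r \<triangleright>\<^bsub>N\<^esub> x) = r \<triangleright>\<^bsub>N'\<^esub> g x"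
    using g by (auto simp: left_linear_def)
  note fh = right_linear_addhom[OF f]
  show ?thesis
    by (intro balancedI addhom_tens_left[OF M' N'] addhom_tens_right[OF M' N'] fh gh)
      (auto simp: addhom_closed[OF fh] addhom_closed[OF gh] gr right_linear_ract[OF f] tens_ract[OF M' N'])
qed

lemma addhom_tensor_map:
  "addhom (tensor_group R M N) (tensor_group R M' N') (tensor_map R M N M' N' f g)"
proof -
  note h = tensor_lift_addhom[OF M N abelian_tensor_group[OF M' N'] balanced_map]
  interpret abelian_group "tensor_group R M N" by (rule abelian_tensor_group[OF M N])
  show ?thesis
    by (rule addhomI) (auto simp: tensor_map_def addhom_closed[OF h] addhom_add[OF h])
qed

lemma tensor_map_tens:
  "\<lbrakk>m \<in> carrier M; n \<in> carrier N\<rbrakk>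
    \<Longrightarrow> tensor_map R M N M' N' f g (tens R M N m n) = tens R M' N' (f m) (g n)"
  by (simp add: tensor_map_def tensor_lift_tens[OF M N abelian_tensor_group[OF M' N'] balanced_map])

end

lemmas addhom_tensor_map = tensor_map_setup.addhom_tensor_map[OF tensor_map_setup.intro]
lemmas tensor_map_tens = tensor_map_setup.tensor_map_tens[OF tensor_map_setup.intro]

lemma tensor_map_extensional: "tensor_map R M N M' N' f g \<in> extensional (carrier (tensor_group R M N))"
  by (simp add: tensor_map_def)

lemma right_linear_tensor_map:
  assumes M: "right_module R M" and N: "bimodule R T N"
    and M': "right_module R M'" and N': "bimodule R T N'"
    and f: "right_linear R M M' f" and g: "left_linear R N N' g" "right_linear T N N' g"
  shows "right_linear T (rtensor R M N) (rtensor R M' N') (tensor_map R M N M' N' f g)"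
proof (rule right_linearI)
  note NL = bimodule_left[OF N] and NL' = bimodule_left[OF N']
  note h = addhom_tensor_map[OF M NL M' NL' f g(1)]
  show "addhom (rtensor R M N) (rtensor R M' N') (tensor_map R M N M' N' f g)"
    using h by simp
  show "tensor_map R M N M' N' f g (q \<triangleleft>\<^bsub>rtensor R M N\<^esub> t)
      = tensor_map R M N M' N' f g q \<triangleleft>\<^bsub>rtensor R M' N'\<^esub> t"
    if q: "q \<in> carrier (rtensor R M N)" and t: "t \<in> carrier T" for q t
  proof (rule tensor_eqI[OF M NL, where t = q])
    show "addhom (tensor_group R M N) (tensor_group R M' N')
        (\<lambda>q. tensor_map R M N M' N' f g (q \<triangleleft>\<^bsub>rtensor R M N\<^esub> t))"
      by (rule addhom_compose[OF h rtensor_ract_addhom[OF M N t]])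
    show "addhom (tensor_group R M N) (tensor_group R M' N')
        (\<lambda>q. tensor_map R M N M' N' f g q \<triangleleft>\<^bsub>rtensor R M' N'\<^esub> t)"
      by (rule addhom_compose[OF rtensor_ract_addhom[OF M' N' t] h])
    show "tensor_map R M N M' N' f g (tens R M N m n \<triangleleft>\<^bsub>rtensor R M N\<^esub> t)
        = tensor_map R M N M' N' f g (tens R M N m n) \<triangleleft>\<^bsub>rtensor R M' N'\<^esub> t"
      if "m \<in> carrier M" "n \<in> carrier N" for m n
      using that t g
      by (simp add: rtensor_ract_tens[OF M N] rtensor_ract_tens[OF M' N']
          tensor_map_tens[OF M NL M' NL' f g(1)] right_module.ract_closed[OF bimodule_right[OF N]]
          right_linear_ract[OF g(2)] addhom_closed[OF right_linear_addhom[OF f]]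
          addhom_closed[OF right_linear_addhom[OF g(2)]])
  qed (use q in simp)
qed

section \<open>Maps out of threefold tensor products and associativity\<close>

definition balanced3 ::
  "('r, 'x) ring_scheme \<Rightarrow> ('t, 'w) ring_scheme \<Rightarrow> ('r, 'm, 'y) rmod_scheme
    \<Rightarrow> ('r, 't, 'n, 'z) bimod_scheme \<Rightarrow> ('t, 's, 'p, 'v) bimod_scheme
    \<Rightarrow> ('g, 'u) ring_scheme \<Rightarrow> ('m \<Rightarrow> 'n \<Rightarrow> 'p \<Rightarrow> 'g) \<Rightarrow> bool" where
  "balanced3 R T M N P G \<Phi> \<longleftrightarrow>
     (\<forall>n\<in>carrier N. \<forall>p\<in>carrier P. addhom M G (\<lambda>m. \<Phi> m n p)) \<and>
     (\<forall>m\<in>carrier M. \<forall>p\<in>carrier P. addhom N G (\<lambda>n. \<Phi> m n p)) \<and>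
     (\<forall>m\<in>carrier M. \<forall>n\<in>carrier N. addhom P G (\<Phi> m n)) \<and>
     (\<forall>m\<in>carrier M. \<forall>r\<in>carrier R. \<forall>n\<in>carrier N. \<forall>p\<in>carrier P.
        \<Phi> (m \<triangleleft>\<^bsub>M\<^esub> r) n p = \<Phi> m (r \<triangleright>\<^bsub>N\<^esub> n) p) \<and>
     (\<forall>m\<in>carrier M. \<forall>n\<in>carrier N. \<forall>t\<in>carrier T. \<forall>p\<in>carrier P.
        \<Phi> m (n \<triangleleft>\<^bsub>N\<^esub> t) p = \<Phi> m n (t \<triangleright>\<^bsub>P\<^esub> p))"

lemma balanced3I:
  assumes "\<And>n p. \<lbrakk>n \<in> carrier N; p \<in> carrier P\<rbrakk> \<Longrightarrow> addhom M G (\<lambda>m. \<Phi> m n p)"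
    and "\<And>m p. \<lbrakk>m \<in> carrier M; p \<in> carrier P\<rbrakk> \<Longrightarrow> addhom N G (\<lambda>n. \<Phi> m n p)"
    and "\<And>m n. \<lbrakk>m \<in> carrier M; n \<in> carrier N\<rbrakk> \<Longrightarrow> addhom P G (\<lambda>p. \<Phi> m n p)"
    and "\<And>m r n p. \<lbrakk>m \<in> carrier M; r \<in> carrier R; n \<in> carrier N; p \<in> carrier P\<rbrakk>
      \<Longrightarrow> \<Phi> (m \<triangleleft>\<^bsub>M\<^esub> r) n p = \<Phi> m (r \<triangleright>\<^bsub>N\<^esub> n) p"
    and "\<And>m n t p. \<lbrakk>m \<in> carrier M; n \<in> carrier N; t \<in> carrier T; p \<in> carrier P\<rbrakk>
      \<Longrightarrow> \<Phi> m (n \<triangleleft>\<^bsub>N\<^esub> t) p = \<Phi> m n (t \<triangleright>\<^bsub>P\<^esub> p)"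
  shows "balanced3 R T M N P G \<Phi>"
  using assms by (auto simp: balanced3_def)

text \<open>The nested lifts in \<open>tensor_assoc_inv\<close>, in the coaction of
  \<open>tensor_Sigma\<close> and in the rebracketing of \<open>tensor_Sigma_dual\<close> all have
  this shape, so one proof of well-definedness serves for all of them.\<close>

definition lift_right ::
  "('g, 'x) ring_scheme \<Rightarrow> ('m \<Rightarrow> 'n \<Rightarrow> 'p \<Rightarrow> 'g) \<Rightarrow> ('m \<times> ('n \<times> 'p \<Rightarrow>\<^sub>0 int) set \<Rightarrow>\<^sub>0 int) set \<Rightarrow> 'g"
  where "lift_right G \<Phi> = tensor_lift G (\<lambda>m q. tensor_lift G (\<Phi> m) q)"

definition lift_left ::
  "('g, 'x) ring_scheme \<Rightarrow> ('m \<Rightarrow> 'n \<Rightarrow> 'p \<Rightarrow> 'g) \<Rightarrow> (('m \<times> 'n \<Rightarrow>\<^sub>0 int) set \<times> 'p \<Rightarrow>\<^sub>0 int) set \<Rightarrow> 'g"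
  where "lift_left G \<Phi> = tensor_lift G (\<lambda>q p. tensor_lift G (\<lambda>m n. \<Phi> m n p) q)"

locale triple =
  fixes R :: "('r, 'xr) ring_scheme" and T :: "('t, 'xt) ring_scheme"
    and M :: "('r, 'm, 'xm) rmod_scheme" and N :: "('r, 't, 'n, 'xn) bimod_scheme"
    and P :: "('t, 's, 'p, 'xp) bimod_scheme"
  assumes M: "right_module R M" and N: "bimodule R T N" and P: "left_module T P"
begin

lemma NL: "left_module R N" by (rule bimodule_left[OF N])
lemma NR: "right_module T N" by (rule bimodule_right[OF N])
lemma NP: "left_module R (btensor T N P)" by (rule btensor_left_module[OF N P])
lemma MN: "right_module T (rtensor R M N)" by (rule rtensor_right_module[OF M N])

context
  fixes G :: "('g, 'xg) ring_scheme" and \<Phi>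
  assumes G: "abelian_group G" and \<Phi>: "balanced3 R T M N P G \<Phi>"
begin

lemma \<Phi>_1: "\<lbrakk>n \<in> carrier N; p \<in> carrier P\<rbrakk> \<Longrightarrow> addhom M G (\<lambda>m. \<Phi> m n p)"
  and \<Phi>_2: "\<lbrakk>m \<in> carrier M; p \<in> carrier P\<rbrakk> \<Longrightarrow> addhom N G (\<lambda>n. \<Phi> m n p)"
  and \<Phi>_3: "\<lbrakk>m \<in> carrier M; n \<in> carrier N\<rbrakk> \<Longrightarrow> addhom P G (\<Phi> m n)"
  and \<Phi>_R: "\<lbrakk>m \<in> carrier M; r \<in> carrier R; n \<in> carrier N; p \<in> carrier P\<rbrakk>
      \<Longrightarrow> \<Phi> (m \<triangleleft>\<^bsub>M\<^esub> r) n p = \<Phi> m (r \<triangleright>\<^bsub>N\<^esub> n) p"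
  and \<Phi>_T: "\<lbrakk>m \<in> carrier M; n \<in> carrier N; t \<in> carrier T; p \<in> carrier P\<rbrakk>
      \<Longrightarrow> \<Phi> m (n \<triangleleft>\<^bsub>N\<^esub> t) p = \<Phi> m n (t \<triangleright>\<^bsub>P\<^esub> p)"
  using \<Phi> by (auto simp: balanced3_def)

lemma inner_right: "m \<in> carrier M \<Longrightarrow> balanced T N P G (\<Phi> m)"
  using \<Phi>_2 \<Phi>_3 \<Phi>_T by (intro balancedI) auto

lemma inner_left: "p \<in> carrier P \<Longrightarrow> balanced R M N G (\<lambda>m n. \<Phi> m n p)"
  using \<Phi>_1 \<Phi>_2 \<Phi>_R by (intro balancedI) auto

text \<open>The relation over \<open>T\<close> is absorbed by the inner lift. The one over
  \<open>R\<close> compares inner lifts for two values of the first argument, so it is verified on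
  pure tensors of N \<otimes> P, where \<open>balanced3\<close> applies.\<close>

lemma outer_right: "balanced R M (btensor T N P) G (\<lambda>m q. tensor_lift G (\<Phi> m) q)"
proof (rule balancedI)
  show "addhom M G (\<lambda>m. tensor_lift G (\<Phi> m) q)" if "q \<in> carrier (btensor T N P)" for q
    using that
    by (intro addhom_tensor_lift_param[OF NR P G inner_right right_module_abelian[OF M] \<Phi>_1]) auto
  show "addhom (btensor T N P) G (\<lambda>q. tensor_lift G (\<Phi> m) q)" if "m \<in> carrier M" for m
    using tensor_lift_addhom[OF NR P G inner_right[OF that]] by simp
  show "tensor_lift G (\<Phi> (m \<triangleleft>\<^bsub>M\<^esub> r)) q = tensor_lift G (\<Phi> m) (r \<triangleright>\<^bsub>btensor T N P\<^esub> q)"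
    if m: "m \<in> carrier M" and r: "r \<in> carrier R" and q: "q \<in> carrier (btensor T N P)" for m r q
  proof (rule tensor_eqI[OF NR P, where t = q])
    have mr: "m \<triangleleft>\<^bsub>M\<^esub> r \<in> carrier M"
      by (rule right_module.ract_closed[OF M m r])
    show "addhom (tensor_group T N P) G (\<lambda>q. tensor_lift G (\<Phi> (m \<triangleleft>\<^bsub>M\<^esub> r)) q)"
      by (rule tensor_lift_addhom[OF NR P G inner_right[OF mr]])
    show "addhom (tensor_group T N P) G (\<lambda>q. tensor_lift G (\<Phi> m) (r \<triangleright>\<^bsub>btensor T N P\<^esub> q))"
      by (rule addhom_compose[OF tensor_lift_addhom[OF NR P G inner_right[OF m]] btensor_lact_addhom[OF N P r]])
    show "tensor_lift G (\<Phi> (m \<triangleleft>\<^bsub>M\<^esub> r)) (tens T N P n p)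
        = tensor_lift G (\<Phi> m) (r \<triangleright>\<^bsub>btensor T N P\<^esub> tens T N P n p)"
      if "n \<in> carrier N" "p \<in> carrier P" for n p
      using that m r mr
      by (simp add: btensor_lact_tens[OF N P] tensor_lift_tens[OF NR P G inner_right] \<Phi>_R
          left_module.lact_closed[OF NL])
  qed (use q in simp)
qed

lemma outer_left: "balanced T (rtensor R M N) P G (\<lambda>q p. tensor_lift G (\<lambda>m n. \<Phi> m n p) q)"
proof (rule balancedI)
  show "addhom P G (\<lambda>p. tensor_lift G (\<lambda>m n. \<Phi> m n p) q)" if "q \<in> carrier (rtensor R M N)" for q
    using that
    by (intro addhom_tensor_lift_param[OF M NL G inner_left left_module_abelian[OF P] \<Phi>_3]) auto
  show "addhom (rtensor R M N) G (\<lambda>q. tensor_lift G (\<lambda>m n. \<Phi> m n p) q)" if "p \<in> carrier P" for p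
    using tensor_lift_addhom[OF M NL G inner_left[OF that]] by simp
  show "tensor_lift G (\<lambda>m n. \<Phi> m n p) (q \<triangleleft>\<^bsub>rtensor R M N\<^esub> t)
      = tensor_lift G (\<lambda>m n. \<Phi> m n (t \<triangleright>\<^bsub>P\<^esub> p)) q"
    if p: "p \<in> carrier P" and t: "t \<in> carrier T" and q: "q \<in> carrier (rtensor R M N)" for p t q
  proof (rule tensor_eqI[OF M NL, where t = q])
    have tp: "t \<triangleright>\<^bsub>P\<^esub> p \<in> carrier P"
      by (rule left_module.lact_closed[OF P t p])
    show "addhom (tensor_group R M N) G (\<lambda>q. tensor_lift G (\<lambda>m n. \<Phi> m n (t \<triangleright>\<^bsub>P\<^esub> p)) q)"
      by (rule tensor_lift_addhom[OF M NL G inner_left[OF tp]])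
    show "addhom (tensor_group R M N) G
        (\<lambda>q. tensor_lift G (\<lambda>m n. \<Phi> m n p) (q \<triangleleft>\<^bsub>rtensor R M N\<^esub> t))"
      by (rule addhom_compose[OF tensor_lift_addhom[OF M NL G inner_left[OF p]] rtensor_ract_addhom[OF M N t]])
    show "tensor_lift G (\<lambda>m n. \<Phi> m n p) (tens R M N m n \<triangleleft>\<^bsub>rtensor R M N\<^esub> t)
        = tensor_lift G (\<lambda>m n. \<Phi> m n (t \<triangleright>\<^bsub>P\<^esub> p)) (tens R M N m n)"
      if "m \<in> carrier M" "n \<in> carrier N" for m n
      using that p t tp
      by (simp add: rtensor_ract_tens[OF M N] tensor_lift_tens[OF M NL G inner_left] \<Phi>_T
          right_module.ract_closed[OF NR])
  qed (use q in simp)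
qed

lemma lift_right_addhom: "addhom (tensor_group R M (btensor T N P)) G (lift_right G \<Phi>)"
  unfolding lift_right_def by (rule tensor_lift_addhom[OF M NP G outer_right])

lemma lift_right_tens:
  "\<lbrakk>m \<in> carrier M; n \<in> carrier N; p \<in> carrier P\<rbrakk>
    \<Longrightarrow> lift_right G \<Phi> (tens R M (btensor T N P) m (tens T N P n p)) = \<Phi> m n p"
  by (simp add: lift_right_def tensor_lift_tens[OF M NP G outer_right]
      tensor_lift_tens[OF NR P G inner_right])

lemma lift_left_addhom: "addhom (tensor_group T (rtensor R M N) P) G (lift_left G \<Phi>)"
  unfolding lift_left_def by (rule tensor_lift_addhom[OF MN P G outer_left])

lemma lift_left_tens:
  "\<lbrakk>m \<in> carrier M; n \<in> carrier N; p \<in> carrier P\<rbrakk>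
    \<Longrightarrow> lift_left G \<Phi> (tens T (rtensor R M N) P (tens R M N m n) p) = \<Phi> m n p"
  by (simp add: lift_left_def tensor_lift_tens[OF MN P G outer_left]
      tensor_lift_tens[OF M NL G inner_left])

end

lemma eqI_right:
  assumes "addhom (tensor_group R M (btensor T N P)) G f" "addhom (tensor_group R M (btensor T N P)) G g"
    and "t \<in> carrier (tensor_group R M (btensor T N P))"
    and "\<And>m n p. \<lbrakk>m \<in> carrier M; n \<in> carrier N; p \<in> carrier P\<rbrakk>
      \<Longrightarrow> f (tens R M (btensor T N P) m (tens T N P n p)) = g (tens R M (btensor T N P) m (tens T N P n p))"
  shows "f t = g t"
proof (rule tensor_eqI[OF M NP assms(1-3)])
  fix m q assume m: "m \<in> carrier M" and q: "q \<in> carrier (btensor T N P)"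
  have h: "addhom (tensor_group T N P) G (\<lambda>q. k (tens R M (btensor T N P) m q))"
    if "addhom (tensor_group R M (btensor T N P)) G k" for k
    using m by (intro addhom_compose[OF that] addhom_tens_right[OF M NP])
      (simp_all add: addhom_ident)
  show "f (tens R M (btensor T N P) m q) = g (tens R M (btensor T N P) m q)"
    by (rule tensor_eqI[OF NR P h[OF assms(1)] h[OF assms(2)]]) (use m q assms(4) in auto)
qed

lemma eqI_left:
  assumes "addhom (tensor_group T (rtensor R M N) P) G f" "addhom (tensor_group T (rtensor R M N) P) G g"
    and "t \<in> carrier (tensor_group T (rtensor R M N) P)"
    and "\<And>m n p. \<lbrakk>m \<in> carrier M; n \<in> carrier N; p \<in> carrier P\<rbrakk>
      \<Longrightarrow> f (tens T (rtensor R M N) P (tens R M N m n) p) = g (tens T (rtensor R M N) P (tens R M N m n) p)"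
  shows "f t = g t"
proof (rule tensor_eqI[OF MN P assms(1-3)])
  fix q p assume p: "p \<in> carrier P" and q: "q \<in> carrier (rtensor R M N)"
  have h: "addhom (tensor_group R M N) G (\<lambda>q. k (tens T (rtensor R M N) P q p))"
    if "addhom (tensor_group T (rtensor R M N) P) G k" for k
    using p by (intro addhom_compose[OF that] addhom_tens_left[OF MN P])
      (simp_all add: addhom_ident)
  show "f (tens T (rtensor R M N) P q p) = g (tens T (rtensor R M N) P q p)"
    by (rule tensor_eqI[OF M NL h[OF assms(1)] h[OF assms(2)]]) (use p q assms(4) in auto)
qed

abbreviation "RR \<equiv> tensor_group R M (btensor T N P)"
abbreviation "LL \<equiv> tensor_group T (rtensor R M N) P"

lemma abelian_RR: "abelian_group RR" and abelian_LL: "abelian_group LL"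
  by (simp_all add: M NP MN P)

lemma assoc_balanced:
  "balanced3 R T M N P RR (\<lambda>m n p. tens R M (btensor T N P) m (tens T N P n p))"
proof (rule balanced3I)
  show "addhom N RR (\<lambda>n. tens R M (btensor T N P) m (tens T N P n p))"
    if "m \<in> carrier M" "p \<in> carrier P" for m p
    using that by (intro addhom_tens_right[OF M NP]) (auto intro: addhom_tens_left[OF NR P] addhom_ident)
  show "addhom P RR (\<lambda>p. tens R M (btensor T N P) m (tens T N P n p))"
    if "m \<in> carrier M" "n \<in> carrier N" for m n
    using that by (intro addhom_tens_right[OF M NP]) (auto intro: addhom_tens_right[OF NR P] addhom_ident)
  show "addhom M RR (\<lambda>m. tens R M (btensor T N P) m (tens T N P n p))"
    if "n \<in> carrier N" "p \<in> carrier P" for n p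
    using that by (intro addhom_tens_left[OF M NP] addhom_ident) auto
qed (auto simp: tens_ract[OF M NP] tens_ract[OF NR P] btensor_lact_tens[OF N P])

lemma assoc_inv_balanced:
  "balanced3 R T M N P LL (\<lambda>m n p. tens T (rtensor R M N) P (tens R M N m n) p)"
proof (rule balanced3I)
  show "addhom N LL (\<lambda>n. tens T (rtensor R M N) P (tens R M N m n) p)"
    if "m \<in> carrier M" "p \<in> carrier P" for m p
    using that by (intro addhom_tens_left[OF MN P]) (auto intro: addhom_tens_right[OF M NL] addhom_ident)
  show "addhom P LL (\<lambda>p. tens T (rtensor R M N) P (tens R M N m n) p)"
    if "m \<in> carrier M" "n \<in> carrier N" for m n
    using that by (intro addhom_tens_right[OF MN P] addhom_ident) auto
  show "addhom M LL (\<lambda>m. tens T (rtensor R M N) P (tens R M N m n) p)"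
    if "n \<in> carrier N" "p \<in> carrier P" for n p
    using that by (intro addhom_tens_left[OF MN P]) (auto intro: addhom_tens_left[OF M NL] addhom_ident)
  fix m n t p assume "m \<in> carrier M" "n \<in> carrier N" "t \<in> carrier T" "p \<in> carrier P"
  then show "tens T (rtensor R M N) P (tens R M N m (n \<triangleleft>\<^bsub>N\<^esub> t)) p
      = tens T (rtensor R M N) P (tens R M N m n) (t \<triangleright>\<^bsub>P\<^esub> p)"
    by (simp add: rtensor_ract_tens[OF M N, symmetric] tens_ract[OF MN P])
qed (auto simp: tens_ract[OF M NL])

lemma tensor_assoc_lift: "tensor_assoc R T M N P = lift_left RR (\<lambda>m n p. tens R M (btensor T N P) m (tens T N P n p))"
  by (simp add: tensor_assoc_def lift_left_def)

lemma tensor_assoc_inv_lift: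
  "tensor_assoc_inv R T M N P = lift_right LL (\<lambda>m n p. tens T (rtensor R M N) P (tens R M N m n) p)"
  by (simp add: tensor_assoc_inv_def lift_right_def)

lemma tensor_assoc_addhom: "addhom LL RR (tensor_assoc R T M N P)"
  unfolding tensor_assoc_lift by (rule lift_left_addhom[OF abelian_RR assoc_balanced])

lemma tensor_assoc_tens:
  "\<lbrakk>m \<in> carrier M; n \<in> carrier N; p \<in> carrier P\<rbrakk>
    \<Longrightarrow> tensor_assoc R T M N P (tens T (rtensor R M N) P (tens R M N m n) p)
      = tens R M (btensor T N P) m (tens T N P n p)"
  unfolding tensor_assoc_lift by (simp add: lift_left_tens[OF abelian_RR assoc_balanced])

lemma tensor_assoc_inv_addhom: "addhom RR LL (tensor_assoc_inv R T M N P)"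
  unfolding tensor_assoc_inv_lift by (rule lift_right_addhom[OF abelian_LL assoc_inv_balanced])

lemma tensor_assoc_inv_tens:
  "\<lbrakk>m \<in> carrier M; n \<in> carrier N; p \<in> carrier P\<rbrakk>
    \<Longrightarrow> tensor_assoc_inv R T M N P (tens R M (btensor T N P) m (tens T N P n p))
      = tens T (rtensor R M N) P (tens R M N m n) p"
  unfolding tensor_assoc_inv_lift by (simp add: lift_right_tens[OF abelian_LL assoc_inv_balanced])

text \<open>Lets coassociativity, which is stated through \<open>tensor_assoc\<close>, be solved for
  the twice applied coaction in the bracketing (M \<otimes> C) \<otimes> C.\<close>

lemma tensor_assoc_inv_assoc:
  assumes "t \<in> carrier LL" shows "tensor_assoc_inv R T M N P (tensor_assoc R T M N P t) = t"
  by (rule eqI_left[OF addhom_compose[OF tensor_assoc_inv_addhom tensor_assoc_addhom] addhom_ident assms])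
    (simp add: tensor_assoc_tens tensor_assoc_inv_tens)

end

lemmas lift_right_addhom = triple.lift_right_addhom[OF triple.intro]
lemmas lift_right_tens = triple.lift_right_tens[OF triple.intro]
lemmas tensor_eqI_right = triple.eqI_right[OF triple.intro]
lemmas tensor_eqI_left = triple.eqI_left[OF triple.intro]
lemmas tensor_assoc_addhom = triple.tensor_assoc_addhom[OF triple.intro]
lemmas tensor_assoc_tens = triple.tensor_assoc_tens[OF triple.intro]
lemmas tensor_assoc_inv_addhom = triple.tensor_assoc_inv_addhom[OF triple.intro]
lemmas tensor_assoc_inv_tens = triple.tensor_assoc_inv_tens[OF triple.intro]
lemmas tensor_assoc_inv_assoc = triple.tensor_assoc_inv_assoc[OF triple.intro]

section \<open>Regular bimodules and the unit isomorphisms\<close>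

lemma regular_simps [simp]:
  "carrier (regular A) = carrier A" "add (regular A) = add A" "\<zero>\<^bsub>regular A\<^esub> = \<zero>\<^bsub>A\<^esub>"
  "ract (regular A) = mult A" "lact (regular A) = mult A"
  by (simp_all add: regular_def)

lemma regular_record_simps [simp]:
  "finsum (regular A) f I = finsum A f I"
  "abelian_group (regular A) \<longleftrightarrow> abelian_group A"
  "addhom P (regular A) = addhom P A" "addhom (regular A) Q = addhom A Q"
  by (intro finsum_record_cong abelian_group_record_cong addhom_record_cong; simp)+

lemma regular_bimodule [simp]:
  assumes "ring A" shows "bimodule A A (regular A)"
proof -
  interpret ring A by fact
  have ab: "abelian_group (regular A)" by (simp add: abelian_group_axioms)
  show ?thesis
    unfolding bimodule_def
    by (intro conjI left_module.intro left_module_axioms.intro right_module.intro right_module_axioms.intro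
        ring_axioms ab) (auto simp: l_distr r_distr m_assoc)
qed

lemma runit_balanced:
  assumes "right_module A M" shows "balanced A M (regular A) M (\<lambda>m a. m \<triangleleft>\<^bsub>M\<^esub> a)"
proof -
  interpret right_module A M by fact
  show ?thesis
    by (rule balancedI) (auto intro!: addhomI simp: ract_closed ract_add_left ract_add_right ract_mult)
qed

lemma tensor_runit_addhom:
  assumes "right_module A M" shows "addhom (tensor_group A M (regular A)) M (tensor_runit M)"
  unfolding tensor_runit_def
  using assms by (intro tensor_lift_addhom runit_balanced right_module_abelian bimodule_left[OF regular_bimodule])
    (auto dest: right_module_ring)

lemma tensor_runit_tens:
  assumes "right_module A M" "m \<in> carrier M" "a \<in> carrier A"
  shows "tensor_runit M (tens A M (regular A) m a) = m \<triangleleft>\<^bsub>M\<^esub> a"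
proof -
  note r = bimodule_left[OF regular_bimodule[OF right_module_ring[OF assms(1)]]]
  show ?thesis
    using assms(2,3)
    by (simp add: tensor_runit_def tensor_lift_tens[OF assms(1) r right_module_abelian[OF assms(1)]
          runit_balanced[OF assms(1)]])
qed

lemma lunit_balanced:
  assumes "left_module A M" shows "balanced A (regular A) M M (\<lambda>a m. a \<triangleright>\<^bsub>M\<^esub> m)"
proof -
  interpret left_module A M by fact
  show ?thesis
    by (rule balancedI) (auto intro!: addhomI simp: lact_closed lact_add_left lact_add_right lact_mult)
qed

lemma tensor_lunit_addhom:
  assumes "left_module A M" shows "addhom (tensor_group A (regular A) M) M (tensor_lunit M)"
  unfolding tensor_lunit_def
  using assms by (intro tensor_lift_addhom lunit_balanced left_module_abelian bimodule_right[OF regular_bimodule])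
    (auto dest: left_module_ring)

lemma tensor_lunit_tens:
  assumes "left_module A M" "m \<in> carrier M" "a \<in> carrier A"
  shows "tensor_lunit M (tens A (regular A) M a m) = a \<triangleright>\<^bsub>M\<^esub> m"
proof -
  note r = bimodule_right[OF regular_bimodule[OF left_module_ring[OF assms(1)]]]
  show ?thesis
    using assms(2,3)
    by (simp add: tensor_lunit_def tensor_lift_tens[OF r assms(1) left_module_abelian[OF assms(1)]
          lunit_balanced[OF assms(1)]])
qed

section \<open>The module of colinear maps\<close>

lemma colinear_mapsI:
  assumes "f \<in> extensional (carrier M)" "right_linear A M N f"
    and "\<And>m. m \<in> carrier M \<Longrightarrow> coact N (f m) = tensor_map A M C N C f (\<lambda>x. x) (coact M m)"
  shows "f \<in> colinear_maps A C M N"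
  using assms by (auto simp: colinear_maps_def Lin_def)

lemma colinear_maps_extensional: "f \<in> colinear_maps A C M N \<Longrightarrow> f \<in> extensional (carrier M)"
  and colinear_maps_right_linear: "f \<in> colinear_maps A C M N \<Longrightarrow> right_linear A M N f"
  and colinear_maps_coact: "\<lbrakk>f \<in> colinear_maps A C M N; m \<in> carrier M\<rbrakk>
    \<Longrightarrow> coact N (f m) = tensor_map A M C N C f (\<lambda>x. x) (coact M m)"
  by (auto simp: colinear_maps_def Lin_def)

lemma unital_algebra_central:
  assumes "unital_algebra K A" "k \<in> carrier K" "a \<in> carrier A"
  shows "(k \<odot>\<^bsub>A\<^esub> \<one>\<^bsub>A\<^esub>) \<otimes>\<^bsub>A\<^esub> a = a \<otimes>\<^bsub>A\<^esub> (k \<odot>\<^bsub>A\<^esub> \<one>\<^bsub>A\<^esub>)"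
    and "k \<odot>\<^bsub>A\<^esub> \<one>\<^bsub>A\<^esub> \<in> carrier A"
proof -
  interpret unital_algebra K A by fact
  show "(k \<odot>\<^bsub>A\<^esub> \<one>\<^bsub>A\<^esub>) \<otimes>\<^bsub>A\<^esub> a = a \<otimes>\<^bsub>A\<^esub> (k \<odot>\<^bsub>A\<^esub> \<one>\<^bsub>A\<^esub>)" "k \<odot>\<^bsub>A\<^esub> \<one>\<^bsub>A\<^esub> \<in> carrier A"
    using assms(2,3) by (simp_all add: smult_mult_left smult_mult_right)
qed

locale comodule_pair =
  fixes K :: "('k, 'xk) ring_scheme" and A :: "('k, 'a, 'xa) module_scheme"
    and C :: "('a, 'c, 'xc) coring_scheme"
    and M :: "('a, 'c, 'm, 'xm) comod_scheme" and N :: "('a, 'c, 'n, 'xn) comod_scheme"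
  assumes C: "central_bimodule K A A C" and M: "comodule A C M" and N: "comodule A C N"
begin

interpretation C: central_bimodule K A A C by (rule C)
interpretation M: comodule A C M by (rule M)
interpretation N: comodule A C N by (rule N)

lemma C_left: "left_module A C"
  by (rule bimodule_left[OF central_bimodule_bimodule[OF C]])

abbreviation "one_smult k \<equiv> k \<odot>\<^bsub>A\<^esub> \<one>\<^bsub>A\<^esub>"

lemmas one_smult_central = unital_algebra_central(1)[OF C.L.unital_algebra_axioms]

lemmas map_addhom = addhom_tensor_map[OF M.right_module_axioms C_left N.right_module_axioms C_left _ left_linear_ident]
lemmas map_tens = tensor_map_tens[OF M.right_module_axioms C_left N.right_module_axioms C_left _ left_linear_ident]

lemma coact_closed: "m \<in> carrier M \<Longrightarrow> coact M m \<in> carrier (tensor_group A M C)"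
  using addhom_closed[OF right_linear_addhom[OF M.coact_linear]] by simp

lemma abelian_NC: "abelian_group (tensor_group A N C)"
  by (rule abelian_tensor_group[OF N.right_module_axioms C_left])

lemma coact_addhom: "addhom N (tensor_group A N C) (coact N)"
  using right_linear_addhom[OF N.coact_linear] by simp

lemma zero_colinear: "(\<lambda>m\<in>carrier M. \<zero>\<^bsub>N\<^esub>) \<in> colinear_maps A C M N"
proof (rule colinear_mapsI)
  have z: "\<zero>\<^bsub>N\<^esub> \<triangleleft>\<^bsub>N\<^esub> a = \<zero>\<^bsub>N\<^esub>" if "a \<in> carrier A" for a
    using addhom_zero[OF _ _ addhom_ract[OF N.right_module_axioms that addhom_ident]] N.M.abelian_group_axioms
    by blast
  then show lin: "right_linear A M N (\<lambda>m\<in>carrier M. \<zero>\<^bsub>N\<^esub>)"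
    by (auto intro!: right_linearI addhomI simp: M.ract_closed)
  fix m assume m: "m \<in> carrier M"
  have "tensor_map A M C N C (\<lambda>m\<in>carrier M. \<zero>\<^bsub>N\<^esub>) (\<lambda>x. x) (coact M m) = \<zero>\<^bsub>tensor_group A N C\<^esub>"
  proof (rule tensor_eqI[OF M.right_module_axioms C_left map_addhom[OF lin]
        addhom_const_zero[OF abelian_NC] coact_closed[OF m]])
    fix m c assume "m \<in> carrier M" "c \<in> carrier C"
    then show "tensor_map A M C N C (\<lambda>m\<in>carrier M. \<zero>\<^bsub>N\<^esub>) (\<lambda>x. x) (tens A M C m c)
        = \<zero>\<^bsub>tensor_group A N C\<^esub>"
      using addhom_zero[OF N.M.abelian_group_axioms abelian_NC
          addhom_tens_left[OF N.right_module_axioms C_left _ addhom_ident]]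
      by (simp add: map_tens[OF lin])
  qed
  then show "coact N ((\<lambda>m\<in>carrier M. \<zero>\<^bsub>N\<^esub>) m)
      = tensor_map A M C N C (\<lambda>m\<in>carrier M. \<zero>\<^bsub>N\<^esub>) (\<lambda>x. x) (coact M m)"
    using m addhom_zero[OF N.M.abelian_group_axioms abelian_NC coact_addhom] by simp
qed simp

lemma add_colinear:
  assumes f: "f \<in> colinear_maps A C M N" and g: "g \<in> colinear_maps A C M N"
  shows "(\<lambda>m\<in>carrier M. f m \<oplus>\<^bsub>N\<^esub> g m) \<in> colinear_maps A C M N"
proof (rule colinear_mapsI)
  note fl = colinear_maps_right_linear[OF f] and gl = colinear_maps_right_linear[OF g]
  note fh = right_linear_addhom[OF fl] and gh = right_linear_addhom[OF gl]
  note cl = addhom_closed[OF fh] addhom_closed[OF gh]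
  show lin: "right_linear A M N (\<lambda>m\<in>carrier M. f m \<oplus>\<^bsub>N\<^esub> g m)"
    using addhom_sum2[OF N.M.abelian_group_axioms fh gh]
    by (auto intro!: right_linearI addhomI
        simp: cl N.ract_add_left addhom_add[OF fh] addhom_add[OF gh] M.ract_closed N.M.a_ac
          right_linear_ract[OF fl] right_linear_ract[OF gl])
  fix m assume m: "m \<in> carrier M"
  have "tensor_map A M C N C (\<lambda>m\<in>carrier M. f m \<oplus>\<^bsub>N\<^esub> g m) (\<lambda>x. x) (coact M m)
      = tensor_map A M C N C f (\<lambda>x. x) (coact M m) \<oplus>\<^bsub>tensor_group A N C\<^esub> tensor_map A M C N C g (\<lambda>x. x) (coact M m)"
    by (rule tensor_eqI[OF M.right_module_axioms C_left map_addhom[OF lin]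
          addhom_sum2[OF abelian_NC map_addhom[OF fl] map_addhom[OF gl]] coact_closed[OF m]])
      (simp add: map_tens[OF lin] map_tens[OF fl] map_tens[OF gl] cl
        tens_add_left[OF N.right_module_axioms C_left])
  then show "coact N ((\<lambda>m\<in>carrier M. f m \<oplus>\<^bsub>N\<^esub> g m) m)
      = tensor_map A M C N C (\<lambda>m\<in>carrier M. f m \<oplus>\<^bsub>N\<^esub> g m) (\<lambda>x. x) (coact M m)"
    using m cl by (simp add: addhom_add[OF coact_addhom] colinear_maps_coact[OF f] colinear_maps_coact[OF g])
qed simp

text \<open>The element \<open>one_smult k\<close> is central in \<open>A\<close>, which keeps the
  scaled map right linear. For colinearity, the scalar acts on the first factor of N \<otimes> C; it
  crosses the tensor sign, becomes a right action by centrality of \<open>C\<close> over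
  \<open>K\<close>, and then matches right linearity of the coaction of N.\<close>

lemma smult_colinear:
  assumes f: "f \<in> colinear_maps A C M N" and k: "k \<in> carrier K"
  shows "(\<lambda>m\<in>carrier M. f m \<triangleleft>\<^bsub>N\<^esub> one_smult k) \<in> colinear_maps A C M N"
proof (rule colinear_mapsI)
  note fl = colinear_maps_right_linear[OF f]
  note fh = right_linear_addhom[OF fl]
  note cl = addhom_closed[OF fh]
  note Cb = central_bimodule_bimodule[OF C]
  show lin: "right_linear A M N (\<lambda>m\<in>carrier M. f m \<triangleleft>\<^bsub>N\<^esub> one_smult k)"
    using k
    by (auto intro!: right_linearI addhomI
        simp: cl N.ract_add_left N.ract_closed addhom_add[OF fh] M.ract_closed
          right_linear_ract[OF fl] N.ract_mult[symmetric] one_smult_central)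
  fix m assume m: "m \<in> carrier M"
  have "tensor_map A M C N C (\<lambda>m\<in>carrier M. f m \<triangleleft>\<^bsub>N\<^esub> one_smult k) (\<lambda>x. x) (coact M m)
      = tensor_map A M C N C f (\<lambda>x. x) (coact M m) \<triangleleft>\<^bsub>rtensor A N C\<^esub> one_smult k"
    by (rule tensor_eqI[OF M.right_module_axioms C_left map_addhom[OF lin]
          addhom_compose[OF rtensor_ract_addhom[OF N.right_module_axioms Cb] map_addhom[OF fl]]
            coact_closed[OF m]])
      (simp_all add: k map_tens[OF lin] map_tens[OF fl] cl rtensor_ract_tens[OF N.right_module_axioms Cb]
        tens_ract[OF N.right_module_axioms C_left] C.central)
  then show "coact N ((\<lambda>m\<in>carrier M. f m \<triangleleft>\<^bsub>N\<^esub> one_smult k) m)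
      = tensor_map A M C N C (\<lambda>m\<in>carrier M. f m \<triangleleft>\<^bsub>N\<^esub> one_smult k) (\<lambda>x. x) (coact M m)"
    using m cl k by (simp add: right_linear_ract[OF N.coact_linear] colinear_maps_coact[OF f])
qed simp

lemma module_Hom_comod: "module K (Hom_comod A C M N)"
proof -
  have s: "carrier (Hom_comod A C M N) = colinear_maps A C M N"
    "\<And>f g. f \<oplus>\<^bsub>Hom_comod A C M N\<^esub> g = (\<lambda>m\<in>carrier M. f m \<oplus>\<^bsub>N\<^esub> g m)"
    "\<zero>\<^bsub>Hom_comod A C M N\<^esub> = (\<lambda>m\<in>carrier M. \<zero>\<^bsub>N\<^esub>)"
    "\<And>k f. k \<odot>\<^bsub>Hom_comod A C M N\<^esub> f = (\<lambda>m\<in>carrier M. f m \<triangleleft>\<^bsub>N\<^esub> one_smult k)"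
    by (simp_all add: Hom_comod_def)
  have cl: "f m \<in> carrier N" if "f \<in> colinear_maps A C M N" "m \<in> carrier M" for f m
    by (rule addhom_closed[OF right_linear_addhom[OF colinear_maps_right_linear[OF that(1)]] that(2)])
  have ext: "f = g" if "f \<in> colinear_maps A C M N" "g \<in> extensional (carrier M)"
    "\<And>m. m \<in> carrier M \<Longrightarrow> f m = g m" for f g
    using extensionalityI[OF colinear_maps_extensional[OF that(1)] that(2)] that(3) by blast
  \<comment> \<open>A right action multiplies scalars in reversed order; commutativity of
    \<open>K\<close> restores associativity of the scalar action.\<close>
  have comm: "a \<odot>\<^bsub>A\<^esub> one_smult b = b \<odot>\<^bsub>A\<^esub> one_smult a" if "a \<in> carrier K" "b \<in> carrier K" for a b
    using that by (simp add: C.L.smult_assoc1[symmetric] C.L.R.m_comm)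
  note ab = N.M.a_ac N.ract_add_left N.ract_add_right
  show ?thesis
  proof (rule moduleI)
    show "cring K" by (rule C.L.is_cring)
    show "abelian_group (Hom_comod A C M N)"
    proof (rule abelian_groupI, unfold s)
      fix f assume f: "f \<in> colinear_maps A C M N"
      show "(\<lambda>m\<in>carrier M. (\<lambda>m\<in>carrier M. \<zero>\<^bsub>N\<^esub>) m \<oplus>\<^bsub>N\<^esub> f m) = f"
        by (rule ext[symmetric, OF f]) (auto simp: cl[OF f])
      \<comment> \<open>Negatives are obtained by scaling with -1, so their colinearity is already
        covered by \<open>smult_colinear\<close>.\<close>
      let ?g = "\<lambda>m\<in>carrier M. f m \<triangleleft>\<^bsub>N\<^esub> one_smult (\<ominus>\<^bsub>K\<^esub> \<one>\<^bsub>K\<^esub>)"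
      have "x \<triangleleft>\<^bsub>N\<^esub> one_smult (\<ominus>\<^bsub>K\<^esub> \<one>\<^bsub>K\<^esub>) \<oplus>\<^bsub>N\<^esub> x = \<zero>\<^bsub>N\<^esub>" if x: "x \<in> carrier N" for x
      proof -
        have "x \<triangleleft>\<^bsub>N\<^esub> one_smult (\<ominus>\<^bsub>K\<^esub> \<one>\<^bsub>K\<^esub>) \<oplus>\<^bsub>N\<^esub> x \<triangleleft>\<^bsub>N\<^esub> one_smult \<one>\<^bsub>K\<^esub>
            = x \<triangleleft>\<^bsub>N\<^esub> one_smult (\<ominus>\<^bsub>K\<^esub> \<one>\<^bsub>K\<^esub> \<oplus>\<^bsub>K\<^esub> \<one>\<^bsub>K\<^esub>)"
          using x by (simp add: N.ract_add_right[symmetric] C.L.smult_l_distr[symmetric] del: C.L.smult_one)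
        also have "\<dots> = x \<triangleleft>\<^bsub>N\<^esub> \<zero>\<^bsub>A\<^esub>"
          by (simp add: C.L.R.l_neg)
        also have "\<dots> = \<zero>\<^bsub>N\<^esub>"
          using N.ract_add_right[OF x, of "\<zero>\<^bsub>A\<^esub>" "\<zero>\<^bsub>A\<^esub>"] N.ract_closed[OF x, of "\<zero>\<^bsub>A\<^esub>"] by simp
        finally show ?thesis using x by (simp add: N.ract_one)
      qed
      then have "(\<lambda>m\<in>carrier M. ?g m \<oplus>\<^bsub>N\<^esub> f m) = (\<lambda>m\<in>carrier M. \<zero>\<^bsub>N\<^esub>)"
        using cl[OF f] by (intro restrict_ext) simp
      then show "\<exists>g\<in>colinear_maps A C M N. (\<lambda>m\<in>carrier M. g m \<oplus>\<^bsub>N\<^esub> f m) = (\<lambda>m\<in>carrier M. \<zero>\<^bsub>N\<^esub>)"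
        using smult_colinear[OF f, of "\<ominus>\<^bsub>K\<^esub> \<one>\<^bsub>K\<^esub>"] C.L.R.one_closed C.L.R.a_inv_closed by blast
    qed (auto intro!: add_colinear zero_colinear restrict_ext simp: cl ab)
  qed (auto simp: s intro!: smult_colinear restrict_ext ext[symmetric]
      simp: cl ab N.ract_closed C.L.smult_l_distr N.ract_one N.ract_mult[symmetric] C.L.smult_assoc1
        C.L.smult_mult_left comm)
qed

end

lemmas module_Hom_comod = comodule_pair.module_Hom_comod[OF comodule_pair.intro]

section \<open>The endomorphism ring, the dual module and dual bases\<close>

lemma comatrix_fields:
  fixes A R M
  defines "C \<equiv> btensor R (dual A M) M"
  shows "comult (comatrix A R M n e e') = tensor_lift (btensor A C C)
      (\<lambda>\<phi> u. \<Oplus>\<^bsub>btensor A C C\<^esub>i\<in>{..<n}.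
        tens A C C (tens R (dual A M) M \<phi> (e i)) (tens R (dual A M) M (e' i) u))"
    and "counit (comatrix A R M n e e') = tensor_lift A (\<lambda>\<phi> u. \<phi> u)"
  unfolding C_def by (simp_all add: comatrix_def Let_def coring.defs bimod.defs)

lemma sweedler_fields:
  fixes B S j
  defines "D \<equiv> btensor B (regular_right j S) (regular_left j S)"
    and "p \<equiv> tens B (regular_right j S) (regular_left j S)"
  shows "comult (sweedler B S j) =
      tensor_lift (btensor S D D) (\<lambda>s s'. tens S D D (p s \<one>\<^bsub>S\<^esub>) (p \<one>\<^bsub>S\<^esub> s'))"
    and "counit (sweedler B S j) = tensor_lift S (\<lambda>s s'. s \<otimes>\<^bsub>S\<^esub> s')"
  unfolding D_def p_def by (simp_all add: sweedler_def Let_def coring.defs bimod.defs)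

text \<open>The values of \<open>e\<close> and \<open>e'\<close> at \<open>i \<ge> n\<close> are irrelevant; having all of them in the carriers
  avoids the side condition \<open>i < n\<close> inside sums.\<close>

locale comatrix_setup =
  fixes K :: "('k, 'xk) ring_scheme"
    and A :: "('k, 'a, 'xa) module_scheme"
    and B :: "('k, 'b, 'xb) module_scheme"
    and M :: "('b, 'a, 'm, 'xm) bimod_scheme"
    and n :: nat and e :: "nat \<Rightarrow> 'm" and e' :: "nat \<Rightarrow> 'm \<Rightarrow> 'a"
  assumes central_M: "central_bimodule K B A M" and basis: "dual_basis A M n e e'"
    and e_closed [simp]: "e i \<in> carrier M"
    and e'_closed_dual: "e' i \<in> carrier (dual A M)"
begin

text \<open>\<open>Ms\<close> is \<open>\<Sigma>\<close> as an \<open>(S, A)\<close>-bimodule; \<open>Md\<close> and \<open>Mt\<close> are \<open>\<Sigma>\<^sup>*\<close> as an \<open>(A, B)\<close>- and as an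
  \<open>(A, S)\<close>-bimodule. Records that differ only in fields a construction ignores give the same
  result; the simplification rules choose \<open>M\<close> over \<open>Ms\<close>, \<open>Mt\<close> over \<open>Md\<close>, and the corings \<open>C\<close> and \<open>D\<close>
  over their underlying tensor products.\<close>

abbreviation "S \<equiv> End_alg A M"
abbreviation "Ms \<equiv> End_bimod M"
abbreviation "Md \<equiv> dual A M"
abbreviation "Mt \<equiv> End_dual A M"
abbreviation "j \<equiv> End_canonical M"
abbreviation "Sr \<equiv> regular_right j S"
abbreviation "Sl \<equiv> regular_left j S"
abbreviation "C \<equiv> comatrix A B M n e e'"
abbreviation "D \<equiv> End_sweedler A B M"
abbreviation "pc \<equiv> tens B Md M"
abbreviation "pd \<equiv> tens B Sr Sl"
abbreviation "I \<equiv> {..<n}"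

sublocale MM: central_bimodule K B A M by (rule central_M)

lemma M_bimodule [simp]: "bimodule B A M" by (rule central_bimodule_bimodule[OF central_M])
lemma M_left [simp]: "left_module B M" by (rule bimodule_left[OF M_bimodule])
lemma M_right [simp]: "right_module A M" by (rule MM.right_module_axioms)
lemma M_abelian [simp]: "abelian_group M" by (rule right_module_abelian[OF M_right])
lemma A_ring [simp]: "ring A" by (rule MM.T.ring_axioms)
lemma B_ring [simp]: "ring B" by (rule MM.L.ring_axioms)
lemma A_abelian [simp]: "abelian_group A" by (rule ring_abelian[OF A_ring])
lemma A_algebra: "unital_algebra K A" by (rule MM.T.unital_algebra_axioms)

lemmas M_simps [simp] = MM.ract_closed MM.lact_closed MM.ract_add_left MM.lact_add_right
  MM.lact_one MM.ract_one MM.lact_ract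

subsection \<open>Endomorphisms\<close>

lemma S_memI:
  assumes "s \<in> extensional (carrier M)" "addhom M M s"
    and "\<And>x a. \<lbrakk>x \<in> carrier M; a \<in> carrier A\<rbrakk> \<Longrightarrow> s (x \<triangleleft>\<^bsub>M\<^esub> a) = s x \<triangleleft>\<^bsub>M\<^esub> a"
  shows "s \<in> carrier S"
  using assms by (simp add: End_alg_def Lin_def right_linearI)

lemma S_restrictI:
  assumes "addhom M M s"
    and "\<And>x a. \<lbrakk>x \<in> carrier M; a \<in> carrier A\<rbrakk> \<Longrightarrow> s (x \<triangleleft>\<^bsub>M\<^esub> a) = s x \<triangleleft>\<^bsub>M\<^esub> a"
  shows "(\<lambda>x\<in>carrier M. s x) \<in> carrier S"
proof (rule S_memI)
  show "addhom M M (\<lambda>x\<in>carrier M. s x)" using assms(1) by (auto simp: addhom_def)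
  show "(\<lambda>x\<in>carrier M. s x) (x \<triangleleft>\<^bsub>M\<^esub> a) = (\<lambda>x\<in>carrier M. s x) x \<triangleleft>\<^bsub>M\<^esub> a"
    if "x \<in> carrier M" "a \<in> carrier A" for x a
    using that assms(2)[OF that] by simp
qed simp

lemma S_right_linear: "s \<in> carrier S \<Longrightarrow> right_linear A M M s"
  by (simp add: End_alg_def Lin_def)

lemma S_addhom: "s \<in> carrier S \<Longrightarrow> addhom M M s"
  by (rule right_linear_addhom[OF S_right_linear])

lemma S_app_closed [simp]: "s \<in> carrier S \<Longrightarrow> x \<in> carrier M \<Longrightarrow> s x \<in> carrier M"
  by (rule addhom_closed[OF S_addhom])

lemma S_app_add [simp]:
  "\<lbrakk>s \<in> carrier S; x \<in> carrier M; y \<in> carrier M\<rbrakk> \<Longrightarrow> s (x \<oplus>\<^bsub>M\<^esub> y) = s x \<oplus>\<^bsub>M\<^esub> s y"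
  by (rule addhom_add[OF S_addhom])

lemma S_app_ract [simp]:
  "\<lbrakk>s \<in> carrier S; x \<in> carrier M; a \<in> carrier A\<rbrakk> \<Longrightarrow> s (x \<triangleleft>\<^bsub>M\<^esub> a) = s x \<triangleleft>\<^bsub>M\<^esub> a"
  by (rule right_linear_ract[OF S_right_linear])

lemma S_eqI:
  assumes "s \<in> carrier S" "t \<in> carrier S" "\<And>x. x \<in> carrier M \<Longrightarrow> s x = t x"
  shows "s = t"
  using assms by (intro extensionalityI[of s "carrier M" t]) (auto simp: End_alg_def Lin_def)

lemma S_app_simps [simp]:
  "x \<in> carrier M \<Longrightarrow> (s \<otimes>\<^bsub>S\<^esub> t) x = s (t x)"
  "x \<in> carrier M \<Longrightarrow> \<one>\<^bsub>S\<^esub> x = x"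
  "x \<in> carrier M \<Longrightarrow> \<zero>\<^bsub>S\<^esub> x = \<zero>\<^bsub>M\<^esub>"
  "x \<in> carrier M \<Longrightarrow> (s \<oplus>\<^bsub>S\<^esub> t) x = s x \<oplus>\<^bsub>M\<^esub> t x"
  "x \<in> carrier M \<Longrightarrow> (k \<odot>\<^bsub>S\<^esub> s) x = s x \<triangleleft>\<^bsub>M\<^esub> (k \<odot>\<^bsub>A\<^esub> \<one>\<^bsub>A\<^esub>)"
  by (simp_all add: End_alg_def compose_eq)

lemmas A_central = unital_algebra_central(1)[OF A_algebra]

lemma S_mult_closed [simp]: "\<lbrakk>s \<in> carrier S; t \<in> carrier S\<rbrakk> \<Longrightarrow> s \<otimes>\<^bsub>S\<^esub> t \<in> carrier S"
  by (rule S_memI) (auto intro!: addhomI, simp add: End_alg_def)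

lemma S_one_closed [simp]: "\<one>\<^bsub>S\<^esub> \<in> carrier S"
  by (rule S_memI) (auto intro!: addhomI, simp add: End_alg_def)

lemma zero_ract [simp]: "a \<in> carrier A \<Longrightarrow> \<zero>\<^bsub>M\<^esub> \<triangleleft>\<^bsub>M\<^esub> a = \<zero>\<^bsub>M\<^esub>"
  using addhom_zero[OF M_abelian M_abelian addhom_ract[OF M_right _ addhom_ident]] by blast

lemma S_zero_closed [simp]: "\<zero>\<^bsub>S\<^esub> \<in> carrier S"
  by (rule S_memI) (auto intro!: addhomI, simp add: End_alg_def)

lemma S_add_closed [simp]: "\<lbrakk>s \<in> carrier S; t \<in> carrier S\<rbrakk> \<Longrightarrow> s \<oplus>\<^bsub>S\<^esub> t \<in> carrier S"
  by (rule S_memI) (auto intro!: addhomI simp: MM.M.a_ac, simp add: End_alg_def)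

text \<open>The scalar acts through the right action of \<open>A\<close>, so right linearity of the
  scaled endomorphism rests on the centrality of that scalar in \<open>A\<close>.\<close>

lemma S_smult_closed [simp]: "\<lbrakk>k \<in> carrier K; s \<in> carrier S\<rbrakk> \<Longrightarrow> k \<odot>\<^bsub>S\<^esub> s \<in> carrier S"
  by (rule S_memI)
    (auto intro!: addhomI simp: MM.ract_mult[symmetric] A_central, simp add: End_alg_def)

lemma S_abelian [simp]: "abelian_group S"
proof (rule abelian_groupI)
  fix s assume s: "s \<in> carrier S"
  have h: "addhom M M (\<lambda>x. \<ominus>\<^bsub>M\<^esub> s x)"
    using s by (intro addhomI) (auto simp: MM.M.minus_add)
  have m: "\<ominus>\<^bsub>M\<^esub> (x \<triangleleft>\<^bsub>M\<^esub> a) = (\<ominus>\<^bsub>M\<^esub> x) \<triangleleft>\<^bsub>M\<^esub> a" if "x \<in> carrier M" "a \<in> carrier A" for x a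
  proof (rule MM.M.minus_equality)
    show "(\<ominus>\<^bsub>M\<^esub> x) \<triangleleft>\<^bsub>M\<^esub> a \<oplus>\<^bsub>M\<^esub> x \<triangleleft>\<^bsub>M\<^esub> a = \<zero>\<^bsub>M\<^esub>"
      using that by (simp add: MM.ract_add_left[symmetric] MM.M.l_neg del: MM.ract_add_left)
  qed (use that in auto)
  have "(\<lambda>x\<in>carrier M. \<ominus>\<^bsub>M\<^esub> s x) \<in> carrier S"
    by (rule S_restrictI[OF h]) (use s in \<open>simp add: m\<close>)
  moreover have "(\<lambda>x\<in>carrier M. \<ominus>\<^bsub>M\<^esub> s x) \<oplus>\<^bsub>S\<^esub> s = \<zero>\<^bsub>S\<^esub>"
    using calculation s by (intro S_eqI) (auto simp: MM.M.l_neg)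
  ultimately show "\<exists>t\<in>carrier S. t \<oplus>\<^bsub>S\<^esub> s = \<zero>\<^bsub>S\<^esub>" by blast
qed (auto intro!: S_eqI simp: MM.M.a_ac)

lemma S_ring [simp]: "ring S"
  by (rule ringI[OF S_abelian monoidI]) (auto intro!: S_eqI)

lemma S_algebra: "unital_algebra K S"
proof -
  have "module K S"
    by (rule moduleI) (auto intro!: S_eqI MM.L.is_cring S_abelian
        simp: MM.T.smult_l_distr MM.ract_add_right MM.ract_mult[symmetric] MM.T.smult_mult_left
          MM.T.smult_assoc1[symmetric] MM.L.R.m_comm)
  moreover have "unital_algebra_axioms K S"
    by (rule unital_algebra_axioms.intro) (auto intro!: S_eqI)
  ultimately show ?thesis
    by (intro unital_algebra.intro S_ring)
qed

interpretation S: ring S by (rule S_ring)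

lemma S_assoc [simp]: "\<lbrakk>s \<in> carrier S; t \<in> carrier S; r \<in> carrier S\<rbrakk> \<Longrightarrow> s \<otimes>\<^bsub>S\<^esub> t \<otimes>\<^bsub>S\<^esub> r = s \<otimes>\<^bsub>S\<^esub> (t \<otimes>\<^bsub>S\<^esub> r)"
  by (rule S.m_assoc)

lemma S_one_left [simp]: "s \<in> carrier S \<Longrightarrow> \<one>\<^bsub>S\<^esub> \<otimes>\<^bsub>S\<^esub> s = s"
  and S_one_right [simp]: "s \<in> carrier S \<Longrightarrow> s \<otimes>\<^bsub>S\<^esub> \<one>\<^bsub>S\<^esub> = s"
  by auto

lemma Ms_simps [simp]:
  "carrier Ms = carrier M" "add Ms = add M" "\<zero>\<^bsub>Ms\<^esub> = \<zero>\<^bsub>M\<^esub>" "ract Ms = ract M" "s \<triangleright>\<^bsub>Ms\<^esub> x = s x"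
  by (simp_all add: End_bimod_def)

lemma Ms_record_simps [simp]:
  "finsum Ms f J = finsum M f J"
  "abelian_group Ms \<longleftrightarrow> abelian_group M"
  "addhom P Ms = addhom P M" "addhom Ms Q = addhom M Q"
  by (intro finsum_record_cong abelian_group_record_cong addhom_record_cong; simp)+

lemma Ms_left [simp]: "left_module S Ms"
  by (intro left_module.intro left_module_axioms.intro) auto

lemma Ms_right [simp]: "right_module A Ms"
  by (rule right_module_record_cong[OF M_right]) auto

lemma Ms_bimodule [simp]: "bimodule S A Ms"
  by (simp add: bimodule_def)

lemma tens_Ms [simp]: "tens A Ms N = tens A M N" "tensor_group A Ms N = tensor_group A M N"
  by (rule tens_cong; simp)+

lemma j_simps [simp]:
  "b \<in> carrier B \<Longrightarrow> j b \<in> carrier S"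
  "x \<in> carrier M \<Longrightarrow> j b x = b \<triangleright>\<^bsub>M\<^esub> x"
  "\<lbrakk>b \<in> carrier B; b' \<in> carrier B\<rbrakk> \<Longrightarrow> j (b \<oplus>\<^bsub>B\<^esub> b') = j b \<oplus>\<^bsub>S\<^esub> j b'"
  "\<lbrakk>b \<in> carrier B; b' \<in> carrier B\<rbrakk> \<Longrightarrow> j (b \<otimes>\<^bsub>B\<^esub> b') = j b \<otimes>\<^bsub>S\<^esub> j b'"
  "j \<one>\<^bsub>B\<^esub> = \<one>\<^bsub>S\<^esub>"
proof -
  have cl: "j b \<in> carrier S" if "b \<in> carrier B" for b
    unfolding End_canonical_def using that by (intro S_restrictI) (auto intro!: addhomI)
  have ap: "x \<in> carrier M \<Longrightarrow> j b x = b \<triangleright>\<^bsub>M\<^esub> x" for x b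
    by (simp add: End_canonical_def)
  show "b \<in> carrier B \<Longrightarrow> j b \<in> carrier S" "x \<in> carrier M \<Longrightarrow> j b x = b \<triangleright>\<^bsub>M\<^esub> x"
    by (simp_all add: cl ap)
  show "\<lbrakk>b \<in> carrier B; b' \<in> carrier B\<rbrakk> \<Longrightarrow> j (b \<oplus>\<^bsub>B\<^esub> b') = j b \<oplus>\<^bsub>S\<^esub> j b'"
    by (rule S_eqI) (auto simp: cl ap MM.lact_add_left)
  show "\<lbrakk>b \<in> carrier B; b' \<in> carrier B\<rbrakk> \<Longrightarrow> j (b \<otimes>\<^bsub>B\<^esub> b') = j b \<otimes>\<^bsub>S\<^esub> j b'"
    by (rule S_eqI) (auto simp: cl ap MM.lact_mult)
  show "j \<one>\<^bsub>B\<^esub> = \<one>\<^bsub>S\<^esub>"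
    by (rule S_eqI) (auto simp: cl ap)
qed

text \<open>Centrality of Sigma over \<open>K\<close> identifies the left action of this scalar of
  \<open>B\<close> with the right action of the corresponding scalar of \<open>A\<close>, and the
  latter defines the \<open>K\<close>-structure of \<open>S\<close>.\<close>

lemma j_smult_one: "k \<in> carrier K \<Longrightarrow> j (k \<odot>\<^bsub>B\<^esub> \<one>\<^bsub>B\<^esub>) = k \<odot>\<^bsub>S\<^esub> \<one>\<^bsub>S\<^esub>"
  by (rule S_eqI) (auto simp: MM.central)

lemma Sr_simps [simp]:
  "carrier Sr = carrier S" "add Sr = add S" "\<zero>\<^bsub>Sr\<^esub> = \<zero>\<^bsub>S\<^esub>" "lact Sr = mult S"
  "s \<triangleleft>\<^bsub>Sr\<^esub> b = s \<otimes>\<^bsub>S\<^esub> j b"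
  by (simp_all add: regular_right_def)

lemma Sl_simps [simp]:
  "carrier Sl = carrier S" "add Sl = add S" "\<zero>\<^bsub>Sl\<^esub> = \<zero>\<^bsub>S\<^esub>" "ract Sl = mult S"
  "b \<triangleright>\<^bsub>Sl\<^esub> s = j b \<otimes>\<^bsub>S\<^esub> s"
  by (simp_all add: regular_left_def)

lemma Sr_record_simps [simp]:
  "abelian_group Sr" "addhom P Sr = addhom P S" "addhom Sr Q = addhom S Q"
proof -
  show "abelian_group Sr" using S_abelian abelian_group_record_cong[of Sr S] by simp
qed (intro addhom_record_cong; simp)+

lemma Sl_record_simps [simp]:
  "abelian_group Sl" "addhom P Sl = addhom P S" "addhom Sl Q = addhom S Q"
proof -
  show "abelian_group Sl" using S_abelian abelian_group_record_cong[of Sl S] by simp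
qed (intro addhom_record_cong; simp)+

lemma Sr_bimodule [simp]: "bimodule S B Sr"
  unfolding bimodule_def
  by (intro conjI left_module.intro left_module_axioms.intro right_module.intro right_module_axioms.intro)
    (auto simp: S.l_distr S.r_distr)

lemma Sl_bimodule [simp]: "bimodule B S Sl"
  unfolding bimodule_def
  by (intro conjI left_module.intro left_module_axioms.intro right_module.intro right_module_axioms.intro)
    (auto simp: S.l_distr S.r_distr)

lemma S_sides [simp]:
  "left_module S Sr" "right_module B Sr" "left_module B Sl" "right_module S Sl"
  by (rule bimodule_left[OF Sr_bimodule] bimodule_right[OF Sr_bimodule]
      bimodule_left[OF Sl_bimodule] bimodule_right[OF Sl_bimodule])+

subsection \<open>The dual module\<close>

text \<open>Linear forms on Sigma depend only on its right \<open>A\<close>-structure, hence the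
  duals of \<open>M\<close> and of \<open>Ms\<close> can differ only in the right action.\<close>

lemma Md_simps [simp]:
  "carrier Md = carrier Mt" "add Md = add Mt" "\<zero>\<^bsub>Md\<^esub> = \<zero>\<^bsub>Mt\<^esub>" "lact Md = lact Mt"
  by (simp_all add: dual_def Lin_def right_linear_def)

lemma Md_record_simps [simp]:
  "finsum Md f J = finsum Mt f J" "abelian_group Md \<longleftrightarrow> abelian_group Mt"
  "addhom P Md = addhom P Mt" "addhom Md Q = addhom Mt Q"
  by (intro finsum_record_cong abelian_group_record_cong addhom_record_cong; simp)+

lemma tens_Md [simp]: "tens A X Md = tens A X Mt" "tensor_group A X Md = tensor_group A X Mt"
  by (rule tens_cong; simp)+

lemma Mt_memI:
  assumes "\<phi> \<in> extensional (carrier M)" "addhom M A \<phi>"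
    and "\<And>x a. \<lbrakk>x \<in> carrier M; a \<in> carrier A\<rbrakk> \<Longrightarrow> \<phi> (x \<triangleleft>\<^bsub>M\<^esub> a) = \<phi> x \<otimes>\<^bsub>A\<^esub> a"
  shows "\<phi> \<in> carrier Mt"
  using assms by (simp add: dual_def Lin_def) (intro right_linearI; simp)

lemma Mt_right_linear: "\<phi> \<in> carrier Mt \<Longrightarrow> right_linear A Ms (regular A) \<phi>"
  by (simp add: dual_def Lin_def)

lemma Mt_addhom: "\<phi> \<in> carrier Mt \<Longrightarrow> addhom M A \<phi>"
  using right_linear_addhom[OF Mt_right_linear] by simp

lemma Mt_app_closed [simp]: "\<phi> \<in> carrier Mt \<Longrightarrow> x \<in> carrier M \<Longrightarrow> \<phi> x \<in> carrier A"
  by (rule addhom_closed[OF Mt_addhom])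

lemma Mt_app_add [simp]:
  "\<lbrakk>\<phi> \<in> carrier Mt; x \<in> carrier M; y \<in> carrier M\<rbrakk> \<Longrightarrow> \<phi> (x \<oplus>\<^bsub>M\<^esub> y) = \<phi> x \<oplus>\<^bsub>A\<^esub> \<phi> y"
  by (rule addhom_add[OF Mt_addhom])

lemma Mt_app_ract [simp]:
  "\<lbrakk>\<phi> \<in> carrier Mt; x \<in> carrier M; a \<in> carrier A\<rbrakk> \<Longrightarrow> \<phi> (x \<triangleleft>\<^bsub>M\<^esub> a) = \<phi> x \<otimes>\<^bsub>A\<^esub> a"
  using right_linear_ract[OF Mt_right_linear] by simp

lemma Mt_eqI:
  assumes "\<phi> \<in> carrier Mt" "\<psi> \<in> carrier Mt" "\<And>x. x \<in> carrier M \<Longrightarrow> \<phi> x = \<psi> x"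
  shows "\<phi> = \<psi>"
  using assms by (intro extensionalityI[of \<phi> "carrier M" \<psi>]) (auto simp: dual_def Lin_def)

lemma Mt_app_simps [simp]:
  "x \<in> carrier M \<Longrightarrow> (\<phi> \<triangleleft>\<^bsub>Mt\<^esub> s) x = \<phi> (s x)"
  "x \<in> carrier M \<Longrightarrow> (a \<triangleright>\<^bsub>Mt\<^esub> \<phi>) x = a \<otimes>\<^bsub>A\<^esub> \<phi> x"
  "x \<in> carrier M \<Longrightarrow> \<zero>\<^bsub>Mt\<^esub> x = \<zero>\<^bsub>A\<^esub>"
  "x \<in> carrier M \<Longrightarrow> (\<phi> \<oplus>\<^bsub>Mt\<^esub> \<psi>) x = \<phi> x \<oplus>\<^bsub>A\<^esub> \<psi> x"
  by (simp_all add: dual_def)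

lemma Mt_ract_closed [simp]: "\<lbrakk>\<phi> \<in> carrier Mt; s \<in> carrier S\<rbrakk> \<Longrightarrow> \<phi> \<triangleleft>\<^bsub>Mt\<^esub> s \<in> carrier Mt"
  by (rule Mt_memI) (auto intro!: addhomI, simp add: dual_def)

lemma Mt_lact_closed [simp]: "\<lbrakk>\<phi> \<in> carrier Mt; a \<in> carrier A\<rbrakk> \<Longrightarrow> a \<triangleright>\<^bsub>Mt\<^esub> \<phi> \<in> carrier Mt"
  by (rule Mt_memI) (auto intro!: addhomI simp: MM.T.r_distr MM.T.m_assoc, simp add: dual_def)

lemma Mt_zero_closed [simp]: "\<zero>\<^bsub>Mt\<^esub> \<in> carrier Mt"
  by (rule Mt_memI) (auto intro!: addhomI, simp add: dual_def)

lemma Mt_add_closed [simp]: "\<lbrakk>\<phi> \<in> carrier Mt; \<psi> \<in> carrier Mt\<rbrakk> \<Longrightarrow> \<phi> \<oplus>\<^bsub>Mt\<^esub> \<psi> \<in> carrier Mt"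
  by (rule Mt_memI) (auto intro!: addhomI simp: MM.T.a_ac MM.T.l_distr, simp add: dual_def)

lemma Mt_abelian [simp]: "abelian_group Mt"
proof (rule abelian_groupI)
  fix \<phi> assume \<phi>: "\<phi> \<in> carrier Mt"
  have "(\<ominus>\<^bsub>A\<^esub> \<one>\<^bsub>A\<^esub>) \<triangleright>\<^bsub>Mt\<^esub> \<phi> \<oplus>\<^bsub>Mt\<^esub> \<phi> = \<zero>\<^bsub>Mt\<^esub>"
    using \<phi> by (intro Mt_eqI) (auto simp: MM.T.l_minus MM.T.l_neg)
  then show "\<exists>\<psi>\<in>carrier Mt. \<psi> \<oplus>\<^bsub>Mt\<^esub> \<phi> = \<zero>\<^bsub>Mt\<^esub>"
    using \<phi> Mt_lact_closed[of \<phi> "\<ominus>\<^bsub>A\<^esub> \<one>\<^bsub>A\<^esub>"] by auto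
qed (auto intro!: Mt_eqI simp: MM.T.a_ac)

lemma Mt_bimodule [simp]: "bimodule A S Mt"
  unfolding bimodule_def
  by (intro conjI left_module.intro left_module_axioms.intro right_module.intro right_module_axioms.intro)
    (auto intro!: Mt_eqI simp: MM.T.r_distr MM.T.l_distr MM.T.m_assoc)

text \<open>Lets computations over \<open>B\<close> be carried out with the action of
  \<open>S\<close>, to which the shift identity applies.\<close>

lemma Md_ract: "b \<in> carrier B \<Longrightarrow> \<phi> \<triangleleft>\<^bsub>Md\<^esub> b = \<phi> \<triangleleft>\<^bsub>Mt\<^esub> j b"
  by (simp add: dual_def restrict_def fun_eq_iff)

lemma Md_bimodule [simp]: "bimodule A B Md"
  unfolding bimodule_def
  by (intro conjI left_module.intro left_module_axioms.intro right_module.intro right_module_axioms.intro)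
    (auto intro!: Mt_eqI simp: Md_ract MM.T.r_distr MM.T.l_distr MM.T.m_assoc)

lemma M_sides [simp]:
  "left_module A Mt" "right_module S Mt" "left_module A Md" "right_module B Md"
  by (rule bimodule_left[OF Mt_bimodule] bimodule_right[OF Mt_bimodule]
      bimodule_left[OF Md_bimodule] bimodule_right[OF Md_bimodule])+

subsection \<open>The dual basis\<close>

lemma e'_closed [simp]: "e' i \<in> carrier Mt"
  using e'_closed_dual by simp

lemma basis_sum: "x \<in> carrier M \<Longrightarrow> finsum M (\<lambda>i. e i \<triangleleft>\<^bsub>M\<^esub> e' i x) I = x"
  using basis by (auto simp: dual_basis_def)

lemma Mt_finsum_app:
  assumes "x \<in> carrier M" "finite J" "\<And>i. i \<in> J \<Longrightarrow> f i \<in> carrier Mt"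
  shows "finsum Mt f J x = finsum A (\<lambda>i. f i x) J"
  using assms by (intro addhom_finsum[where f = "\<lambda>\<phi>. \<phi> x"] addhomI) auto

lemma S_finsum_app:
  assumes "x \<in> carrier M" "finite J" "\<And>i. i \<in> J \<Longrightarrow> f i \<in> carrier S"
  shows "finsum S f J x = finsum M (\<lambda>i. f i x) J"
  using assms by (intro addhom_finsum[where f = "\<lambda>\<phi>. \<phi> x"] addhomI) auto

text \<open>Apply \<phi> to the basis expansion of x and pull the coefficients out by
  linearity.\<close>

lemma dual_expand:
  assumes "\<phi> \<in> carrier Mt" shows "finsum Mt (\<lambda>i. \<phi> (e i) \<triangleright>\<^bsub>Mt\<^esub> e' i) I = \<phi>"
proof (rule Mt_eqI)
  fix x assume x: "x \<in> carrier M"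
  have "finsum Mt (\<lambda>i. \<phi> (e i) \<triangleright>\<^bsub>Mt\<^esub> e' i) I x = finsum A (\<lambda>i. \<phi> (e i \<triangleleft>\<^bsub>M\<^esub> e' i x)) I"
    using assms x by (subst Mt_finsum_app) auto
  also have "\<dots> = \<phi> (finsum M (\<lambda>i. e i \<triangleleft>\<^bsub>M\<^esub> e' i x) I)"
    using assms x by (intro addhom_finsum[symmetric] Mt_addhom) auto
  finally show "finsum Mt (\<lambda>i. \<phi> (e i) \<triangleright>\<^bsub>Mt\<^esub> e' i) I x = \<phi> x"
    using x by (simp add: basis_sum)
qed (use assms in \<open>auto intro!: finsum_closed'\<close>)

text \<open>An arbitrary balanced map is allowed so that the expansion serves both for the tensor
  map itself and for maps that insert x and \<phi> into larger tensor products. The coefficient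
  \<phi>(e_i) crosses to the dual side, where \<open>dual_expand\<close> collects the sum.\<close>

lemma balanced_expand_right:
  assumes G: "abelian_group G" and \<beta>: "balanced A X Mt G \<beta>"
    and x: "x \<in> carrier X" and \<phi>: "\<phi> \<in> carrier Mt"
  shows "finsum G (\<lambda>i. \<beta> (x \<triangleleft>\<^bsub>X\<^esub> \<phi> (e i)) (e' i)) I = \<beta> x \<phi>"
proof -
  have "finsum G (\<lambda>i. \<beta> (x \<triangleleft>\<^bsub>X\<^esub> \<phi> (e i)) (e' i)) I = finsum G (\<lambda>i. \<beta> x (\<phi> (e i) \<triangleright>\<^bsub>Mt\<^esub> e' i)) I"
    using \<beta> x \<phi> by (intro finsum_ext) (auto simp: balanced_def)
  also have "\<dots> = \<beta> x (finsum Mt (\<lambda>i. \<phi> (e i) \<triangleright>\<^bsub>Mt\<^esub> e' i) I)"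
    using \<beta> x \<phi> G by (intro addhom_finsum[where f = "\<beta> x", symmetric]) (auto simp: balanced_def)
  finally show ?thesis
    using \<phi> by (simp add: dual_expand)
qed

text \<open>Here the coefficient e'_i(u) crosses to Sigma, where the basis expansion of u collects
  the sum.\<close>

lemma balanced_expand_left:
  assumes G: "abelian_group G" and \<beta>: "balanced A M N G \<beta>"
    and u: "u \<in> carrier M" and q: "q \<in> carrier N"
  shows "finsum G (\<lambda>i. \<beta> (e i) (e' i u \<triangleright>\<^bsub>N\<^esub> q)) I = \<beta> u q"
proof -
  have "finsum G (\<lambda>i. \<beta> (e i) (e' i u \<triangleright>\<^bsub>N\<^esub> q)) I = finsum G (\<lambda>i. \<beta> (e i \<triangleleft>\<^bsub>M\<^esub> e' i u) q) I"
    using \<beta> u q by (intro finsum_ext) (auto simp: balanced_def)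
  also have "\<dots> = \<beta> (finsum M (\<lambda>i. e i \<triangleleft>\<^bsub>M\<^esub> e' i u) I) q"
    using \<beta> u q G by (intro addhom_finsum[where f = "\<lambda>x. \<beta> x q", symmetric]) (auto simp: balanced_def)
  finally show ?thesis
    using u by (simp add: basis_sum)
qed

text \<open>This is \<open>\<Sum>\<^sub>i s e\<^sub>i \<otimes> e\<^sub>i\<^sup>* = \<Sum>\<^sub>i e\<^sub>i \<otimes> e\<^sub>i\<^sup>* s\<close>: expand \<open>s e\<^sub>i\<close> in the \<open>e\<^sub>k\<close>, move the coefficients across,
  and collect them into \<open>e\<^sub>k\<^sup>* s\<close>.\<close>

lemma balanced_shift:
  assumes G: "abelian_group G" and \<beta>: "balanced A M Mt G \<beta>" and s: "s \<in> carrier S"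
  shows "finsum G (\<lambda>i. \<beta> (s (e i)) (e' i)) I = finsum G (\<lambda>i. \<beta> (e i) (e' i \<triangleleft>\<^bsub>Mt\<^esub> s)) I"
proof -
  have cl: "\<beta> u \<phi> \<in> carrier G" if "u \<in> carrier M" "\<phi> \<in> carrier Mt" for u \<phi>
    using \<beta> that by (auto simp: balanced_def intro: addhom_closed)
  have "finsum G (\<lambda>i. \<beta> (s (e i)) (e' i)) I
      = finsum G (\<lambda>i. finsum G (\<lambda>k. \<beta> (e k) (e' k (s (e i)) \<triangleright>\<^bsub>Mt\<^esub> e' i)) I) I"
    using s by (simp add: balanced_expand_left[OF G \<beta>])
  also have "\<dots> = finsum G (\<lambda>k. finsum G (\<lambda>i. \<beta> (e k) (e' k (s (e i)) \<triangleright>\<^bsub>Mt\<^esub> e' i)) I) I"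
    using s by (intro finsum_swap[OF G]) (auto intro!: cl)
  also have "\<dots> = finsum G (\<lambda>k. finsum G (\<lambda>i. \<beta> (e k \<triangleleft>\<^bsub>M\<^esub> (e' k \<triangleleft>\<^bsub>Mt\<^esub> s) (e i)) (e' i)) I) I"
    using s \<beta> by (simp add: balanced_def)
  also have "\<dots> = finsum G (\<lambda>k. \<beta> (e k) (e' k \<triangleleft>\<^bsub>Mt\<^esub> s)) I"
    using s by (simp add: balanced_expand_right[OF G \<beta>] del: Mt_app_simps)
  finally show ?thesis .
qed

text \<open>The rank-one endomorphism that xi assigns to a pure tensor.\<close>

definition dyad :: "'m \<Rightarrow> ('m \<Rightarrow> 'a) \<Rightarrow> 'm \<Rightarrow> 'm" where
  "dyad u \<phi> = (\<lambda>x\<in>carrier M. u \<triangleleft>\<^bsub>M\<^esub> \<phi> x)"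

lemma dyad_app [simp]: "x \<in> carrier M \<Longrightarrow> dyad u \<phi> x = u \<triangleleft>\<^bsub>M\<^esub> \<phi> x"
  by (simp add: dyad_def)

lemma dyad_closed [simp]: "\<lbrakk>u \<in> carrier M; \<phi> \<in> carrier Mt\<rbrakk> \<Longrightarrow> dyad u \<phi> \<in> carrier S"
  unfolding dyad_def by (rule S_restrictI) (auto intro!: addhomI simp: MM.ract_add_right MM.ract_mult)

lemma dyad_mult:
  "\<lbrakk>s \<in> carrier S; u \<in> carrier M; \<phi> \<in> carrier Mt\<rbrakk> \<Longrightarrow> s \<otimes>\<^bsub>S\<^esub> dyad u \<phi> = dyad (s u) \<phi>"
  "\<lbrakk>s \<in> carrier S; u \<in> carrier M; \<phi> \<in> carrier Mt\<rbrakk> \<Longrightarrow> dyad u \<phi> \<otimes>\<^bsub>S\<^esub> s = dyad u (\<phi> \<triangleleft>\<^bsub>Mt\<^esub> s)"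
  by (auto intro!: S_eqI)

lemma dyad_balanced: "balanced A M Mt S dyad"
  by (rule balancedI)
    (auto intro!: addhomI S_eqI simp: MM.ract_add_right MM.ract_mult)

text \<open>The value of the sum at x is s applied to the basis expansion of x. For s = 1 this
  exhibits the identity as the image of the canonical element under xi.\<close>

lemma dyad_sum:
  assumes "s \<in> carrier S" shows "finsum S (\<lambda>i. dyad (s (e i)) (e' i)) I = s"
proof (rule S_eqI)
  fix x assume x: "x \<in> carrier M"
  have "finsum S (\<lambda>i. dyad (s (e i)) (e' i)) I x = finsum M (\<lambda>i. s (e i \<triangleleft>\<^bsub>M\<^esub> e' i x)) I"
    using assms x by (subst S_finsum_app) auto
  also have "\<dots> = s (finsum M (\<lambda>i. e i \<triangleleft>\<^bsub>M\<^esub> e' i x) I)"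
    using assms x by (intro addhom_finsum[symmetric] S_addhom) auto
  finally show "finsum S (\<lambda>i. dyad (s (e i)) (e' i)) I x = s x"
    using x by (simp add: basis_sum)
qed (use assms in \<open>auto intro!: finsum_closed'\<close>)

lemma dyad_sum_one: "finsum S (\<lambda>i. dyad (e i) (e' i)) I = \<one>\<^bsub>S\<^esub>"
  using dyad_sum[OF S_one_closed] by simp

lemma xi_lift: "xi A M = tensor_lift S dyad"
  by (simp add: xi_def dyad_def[abs_def])

lemma xi_addhom: "addhom (tensor_group A M Mt) S (xi A M)"
  unfolding xi_lift by (rule tensor_lift_addhom[OF M_right _ S_abelian dyad_balanced]) simp

lemma xi_tens [simp]:
  "\<lbrakk>u \<in> carrier M; \<phi> \<in> carrier Mt\<rbrakk> \<Longrightarrow> xi A M (tens A M Mt u \<phi>) = dyad u \<phi>"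
  unfolding xi_lift by (rule tensor_lift_tens[OF M_right _ S_abelian dyad_balanced]) simp_all

text \<open>\<open>xi_inv\<close> is defined as a set-theoretic inverse, so the formula needs two
  facts: the candidate is a left inverse of xi, which gives injectivity, and xi maps the candidate
  back to s.\<close>

lemma xi_inv_eq:
  assumes s: "s \<in> carrier S"
  shows "xi_inv A M s = finsum (tensor_group A M Mt) (\<lambda>i. tens A M Mt (s (e i)) (e' i)) I"
    (is "_ = ?h s")
proof -
  let ?T = "tensor_group A M Mt"
  have T: "abelian_group ?T" by simp
  have h: "addhom S ?T ?h"
    by (intro addhom_finsum_fun T addhom_tens_left) (auto intro!: addhomI)
  \<comment> \<open>On u \<otimes> \<phi> the candidate gives the sum of u \<phi>(e_i) \<otimes>
    e'_i, which the expansion of \<phi> contracts to u \<otimes> \<phi>.\<close>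
  have left_inverse: "?h (xi A M t) = t" if "t \<in> carrier ?T" for t
  proof (rule tensor_eqI[OF M_right _ addhom_compose[OF h xi_addhom] addhom_ident that])
    fix u \<phi> assume "u \<in> carrier M" "\<phi> \<in> carrier Mt"
    then show "?h (xi A M (tens A M Mt u \<phi>)) = tens A M Mt u \<phi>"
      using balanced_expand_right[OF T balanced_tens[OF M_right]] by simp
  qed simp
  have "xi A M (?h s) = s"
    using s by (subst addhom_finsum[OF T S_abelian xi_addhom]) (auto simp: dyad_sum)
  moreover have "?h s \<in> carrier ?T"
    by (rule addhom_closed[OF h s])
  moreover have "inj_on (xi A M) (carrier ?T)"
    by (rule inj_on_inverseI[of _ ?h]) (rule left_inverse)
  ultimately show ?thesis
    unfolding xi_inv_def by (intro inv_into_f_eq) simp_all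
qed

subsection \<open>The underlying bimodules of the two corings\<close>

lemma C_simps [simp]:
  "carrier C = carrier (tensor_group B Md M)" "add C = add (tensor_group B Md M)"
  "\<zero>\<^bsub>C\<^esub> = \<zero>\<^bsub>tensor_group B Md M\<^esub>"
  by (simp_all add: comatrix_def Let_def bimod.defs)

lemma C_acts: "ract C = ract (btensor B Md M)" "lact C = lact (btensor B Md M)"
  by (simp_all add: comatrix_def Let_def bimod.defs)

lemma D_simps [simp]:
  "carrier D = carrier (tensor_group B Sr Sl)" "add D = add (tensor_group B Sr Sl)"
  "\<zero>\<^bsub>D\<^esub> = \<zero>\<^bsub>tensor_group B Sr Sl\<^esub>"
  by (simp_all add: sweedler_def Let_def bimod.defs)

lemma D_acts: "ract D = ract (btensor B Sr Sl)" "lact D = lact (btensor B Sr Sl)"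
  by (simp_all add: sweedler_def Let_def bimod.defs)


lemma C_record_simps [simp]:
  "finsum C f J = finsum (tensor_group B Md M) f J"
  "abelian_group C \<longleftrightarrow> abelian_group (tensor_group B Md M)"
  "addhom P C = addhom P (tensor_group B Md M)" "addhom C Q = addhom (tensor_group B Md M) Q"
  by (intro finsum_record_cong abelian_group_record_cong addhom_record_cong; simp)+

lemma D_record_simps [simp]:
  "finsum D f J = finsum (tensor_group B Sr Sl) f J"
  "abelian_group D \<longleftrightarrow> abelian_group (tensor_group B Sr Sl)"
  "addhom P D = addhom P (tensor_group B Sr Sl)" "addhom D Q = addhom (tensor_group B Sr Sl) Q"
  by (intro finsum_record_cong abelian_group_record_cong addhom_record_cong; simp)+

lemma C_ract [simp]:
  "\<lbrakk>\<phi> \<in> carrier Mt; u \<in> carrier M; a \<in> carrier A\<rbrakk> \<Longrightarrow> pc \<phi> u \<triangleleft>\<^bsub>C\<^esub> a = pc \<phi> (u \<triangleleft>\<^bsub>M\<^esub> a)"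
  by (simp add: C_acts rtensor_ract_tens[OF M_sides(4) M_bimodule])

lemma C_lact [simp]:
  "\<lbrakk>\<phi> \<in> carrier Mt; u \<in> carrier M; a \<in> carrier A\<rbrakk> \<Longrightarrow> a \<triangleright>\<^bsub>C\<^esub> pc \<phi> u = pc (a \<triangleright>\<^bsub>Mt\<^esub> \<phi>) u"
  by (simp add: C_acts btensor_lact_tens[OF Md_bimodule M_left])

lemma D_ract [simp]:
  "\<lbrakk>s \<in> carrier S; s' \<in> carrier S; t \<in> carrier S\<rbrakk> \<Longrightarrow> pd s s' \<triangleleft>\<^bsub>D\<^esub> t = pd s (s' \<otimes>\<^bsub>S\<^esub> t)"
  by (simp add: D_acts rtensor_ract_tens[OF S_sides(2) Sl_bimodule])

lemma D_lact [simp]: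
  "\<lbrakk>s \<in> carrier S; s' \<in> carrier S; t \<in> carrier S\<rbrakk> \<Longrightarrow> t \<triangleright>\<^bsub>D\<^esub> pd s s' = pd (t \<otimes>\<^bsub>S\<^esub> s) s'"
  by (simp add: D_acts btensor_lact_tens[OF Sr_bimodule S_sides(3)])

lemma C_bimodule [simp]: "bimodule A A C"
  by (rule bimodule_record_cong[OF btensor_bimodule[OF Md_bimodule M_bimodule]]) (simp_all add: C_acts)

lemma D_bimodule [simp]: "bimodule S S D"
  by (rule bimodule_record_cong[OF btensor_bimodule[OF Sr_bimodule Sl_bimodule]]) (simp_all add: D_acts)

lemma coring_sides [simp]:
  "left_module A C" "right_module A C" "left_module S D" "right_module S D"
  by (rule bimodule_left[OF C_bimodule] bimodule_right[OF C_bimodule]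
      bimodule_left[OF D_bimodule] bimodule_right[OF D_bimodule])+

lemma pc_ract: "\<lbrakk>\<phi> \<in> carrier Mt; u \<in> carrier M; b \<in> carrier B\<rbrakk>
    \<Longrightarrow> pc (\<phi> \<triangleleft>\<^bsub>Mt\<^esub> j b) u = pc \<phi> (b \<triangleright>\<^bsub>M\<^esub> u)"
  using tens_ract[OF M_sides(4) M_left, of \<phi> b u] by (simp add: Md_ract)

lemma pd_ract: "\<lbrakk>s \<in> carrier S; s' \<in> carrier S; b \<in> carrier B\<rbrakk>
    \<Longrightarrow> pd (s \<otimes>\<^bsub>S\<^esub> j b) s' = pd s (j b \<otimes>\<^bsub>S\<^esub> s')"
  using tens_ract[OF S_sides(2,3), of s b s'] by simp

text \<open>The scalar travels from the left of the dual to its right, across the tensor sign over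
  \<open>B\<close> to the left of Sigma, and by centrality of Sigma to its right.\<close>

lemma C_central: "central_bimodule K A A C"
proof (rule central_bimoduleI[OF A_algebra A_algebra C_bimodule])
  fix k c assume k: "k \<in> carrier K" and c: "c \<in> carrier C"
  let ?a = "k \<odot>\<^bsub>A\<^esub> \<one>\<^bsub>A\<^esub>"
  have a: "?a \<in> carrier A" using k by simp
  \<comment> \<open>Pointwise this is k \<phi>(x) = \<phi>(x) k = \<phi>(x k) = \<phi>(k x), by
    centrality in \<open>A\<close>, linearity of \<phi> and centrality of Sigma.\<close>
  have swap: "(k \<odot>\<^bsub>A\<^esub> \<one>\<^bsub>A\<^esub>) \<triangleright>\<^bsub>Mt\<^esub> \<phi> = \<phi> \<triangleleft>\<^bsub>Mt\<^esub> j (k \<odot>\<^bsub>B\<^esub> \<one>\<^bsub>B\<^esub>)" if "\<phi> \<in> carrier Mt" for \<phi>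
    using that k by (intro Mt_eqI) (auto simp: MM.central A_central)
  show "?a \<triangleright>\<^bsub>C\<^esub> c = c \<triangleleft>\<^bsub>C\<^esub> ?a"
  proof (rule tensor_eqI[OF M_sides(4) M_left, where t = c])
    show "addhom (tensor_group B Md M) (tensor_group B Md M) (\<lambda>c. ?a \<triangleright>\<^bsub>C\<^esub> c)"
      using addhom_lact[OF coring_sides(1) a addhom_ident] by simp
    show "addhom (tensor_group B Md M) (tensor_group B Md M) (\<lambda>c. c \<triangleleft>\<^bsub>C\<^esub> ?a)"
      using addhom_ract[OF coring_sides(2) a addhom_ident] by simp
    show "?a \<triangleright>\<^bsub>C\<^esub> pc \<phi> u = pc \<phi> u \<triangleleft>\<^bsub>C\<^esub> ?a" if "\<phi> \<in> carrier Md" "u \<in> carrier M" for \<phi> u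
      using that k a by (simp add: swap pc_ract MM.central)
  qed (use c in simp)
qed

text \<open>The scalar is central in \<open>S\<close>, which moves it past s and past s'; in between
  it crosses the tensor sign as an element of \<open>B\<close>, by
  \<open>j_smult_one\<close>.\<close>

lemma D_central: "central_bimodule K S S D"
proof (rule central_bimoduleI[OF S_algebra S_algebra D_bimodule])
  fix k d assume k: "k \<in> carrier K" and d: "d \<in> carrier D"
  let ?a = "k \<odot>\<^bsub>S\<^esub> \<one>\<^bsub>S\<^esub>"
  have a: "?a \<in> carrier S" using k by simp
  have b: "k \<odot>\<^bsub>B\<^esub> \<one>\<^bsub>B\<^esub> \<in> carrier B" using k by simp
  show "?a \<triangleright>\<^bsub>D\<^esub> d = d \<triangleleft>\<^bsub>D\<^esub> ?a"
  proof (rule tensor_eqI[OF S_sides(2,3), where t = d])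
    show "addhom (tensor_group B Sr Sl) (tensor_group B Sr Sl) (\<lambda>c. ?a \<triangleright>\<^bsub>D\<^esub> c)"
      using addhom_lact[OF coring_sides(3) a addhom_ident] by simp
    show "addhom (tensor_group B Sr Sl) (tensor_group B Sr Sl) (\<lambda>c. c \<triangleleft>\<^bsub>D\<^esub> ?a)"
      using addhom_ract[OF coring_sides(4) a addhom_ident] by simp
    fix s s' assume s: "s \<in> carrier Sr" "s' \<in> carrier Sl"
    have "?a \<triangleright>\<^bsub>D\<^esub> pd s s' = pd (s \<otimes>\<^bsub>S\<^esub> j (k \<odot>\<^bsub>B\<^esub> \<one>\<^bsub>B\<^esub>)) s'"
      using s a k unital_algebra_central(1)[OF S_algebra k, of s] by (simp add: j_smult_one)
    also have "\<dots> = pd s s' \<triangleleft>\<^bsub>D\<^esub> ?a"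
      using s a k b unital_algebra_central(1)[OF S_algebra k, of s']
      by (simp add: pd_ract) (simp add: j_smult_one)
    finally show "?a \<triangleright>\<^bsub>D\<^esub> pd s s' = pd s s' \<triangleleft>\<^bsub>D\<^esub> ?a" .
  qed (use d in simp)
qed

lemma tens_C [simp]:
  "tens A X (btensor B Md M) = tens A X C"
  "tensor_group A X (btensor B Md M) = tensor_group A X C"
  "rtensor A X (btensor B Md M) = rtensor A X C"
  by (rule tens_cong rtensor_cong; simp add: C_acts)+

lemma tens_C_C [simp]:
  "tens A (btensor B Md M) C = tens A C C"
  "tensor_group A (btensor B Md M) C = tensor_group A C C"
  by (rule tens_cong; simp add: C_acts)+

lemma tens_D [simp]:
  "tens S Y (btensor B Sr Sl) = tens S Y D"
  "tensor_group S Y (btensor B Sr Sl) = tensor_group S Y D"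
  "rtensor S Y (btensor B Sr Sl) = rtensor S Y D"
  by (rule tens_cong rtensor_cong; simp add: D_acts)+

lemma tens_D_D [simp]:
  "tens S (btensor B Sr Sl) D = tens S D D"
  "tensor_group S (btensor B Sr Sl) D = tensor_group S D D"
  by (rule tens_cong; simp add: D_acts)+

lemma C_fields:
  "comult C = tensor_lift (tensor_group A C C)
    (\<lambda>\<phi> u. finsum (tensor_group A C C) (\<lambda>i. tens A C C (pc \<phi> (e i)) (pc (e' i) u)) I)"
  "counit C = tensor_lift A (\<lambda>\<phi> u. \<phi> u)"
  by (simp_all add: comatrix_fields)

lemma D_fields:
  "comult D = tensor_lift (tensor_group S D D) (\<lambda>s s'. tens S D D (pd s \<one>\<^bsub>S\<^esub>) (pd \<one>\<^bsub>S\<^esub> s'))"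
  "counit D = tensor_lift S (\<lambda>s s'. s \<otimes>\<^bsub>S\<^esub> s')"
  by (simp_all add: sweedler_fields)

end

lemma tens_btensor [simp]:
  "tens R (btensor L M N) P = tens R (rtensor L M N) P"
  "tensor_group R (btensor L M N) P = tensor_group R (rtensor L M N) P"
  by (rule tens_cong; simp)+

text \<open>Instances for initial segments of the naturals with finiteness already discharged, so
  that they can serve as rewrite rules for sums over a dual basis.\<close>

lemmas addhom_finsum_nat = addhom_finsum[where I = "{..<k::nat}" for k, OF _ _ _ finite_lessThan]
lemmas tens_finsum_left_nat =
  tens_finsum_left[where I = "{..<k::nat}" for k, OF _ _ _ finite_lessThan]
lemmas tens_finsum_right_nat =
  tens_finsum_right[where I = "{..<k::nat}" for k, OF _ _ _ finite_lessThan]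

lemma finsum_rtensor_ract:
  assumes "right_module R M" "bimodule R T N" "t \<in> carrier T"
    and "\<And>i. i \<in> {..<k} \<Longrightarrow> f i \<in> carrier (tensor_group R M N)"
  shows "finsum (tensor_group R M N) f {..<k::nat} \<triangleleft>\<^bsub>rtensor R M N\<^esub> t
      = finsum (tensor_group R M N) (\<lambda>i. f i \<triangleleft>\<^bsub>rtensor R M N\<^esub> t) {..<k}"
proof -
  have ab: "abelian_group (tensor_group R M N)"
    using assms(1) bimodule_left[OF assms(2)] by simp
  show ?thesis by (rule addhom_finsum_nat[OF ab ab rtensor_ract_addhom[OF assms(1-3)] assms(4)])
qed

lemma finsum_btensor_lact:
  assumes "bimodule L R M" "left_module R N" "l \<in> carrier L"
    and "\<And>i. i \<in> {..<k} \<Longrightarrow> f i \<in> carrier (tensor_group R M N)"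
  shows "l \<triangleright>\<^bsub>btensor R M N\<^esub> finsum (tensor_group R M N) f {..<k::nat}
      = finsum (tensor_group R M N) (\<lambda>i. l \<triangleright>\<^bsub>btensor R M N\<^esub> f i) {..<k}"
proof -
  have ab: "abelian_group (tensor_group R M N)"
    using assms(2) bimodule_right[OF assms(1)] by simp
  show ?thesis by (rule addhom_finsum_nat[OF ab ab btensor_lact_addhom[OF assms(1-3)] assms(4)])
qed

context comatrix_setup
begin

section \<open>The comatrix coring and the Sweedler coring\<close>

lemma addhom_S_left: "t \<in> carrier S \<Longrightarrow> addhom P S f \<Longrightarrow> addhom P S (\<lambda>x. f x \<otimes>\<^bsub>S\<^esub> t)"
  and addhom_S_right: "t \<in> carrier S \<Longrightarrow> addhom P S f \<Longrightarrow> addhom P S (\<lambda>x. t \<otimes>\<^bsub>S\<^esub> f x)"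
  using addhom_ract[of S Sl t P f] addhom_lact[of S Sr t P f] by simp_all

lemma addhom_M_ract: "a \<in> carrier A \<Longrightarrow> addhom P M f \<Longrightarrow> addhom P M (\<lambda>x. f x \<triangleleft>\<^bsub>M\<^esub> a)"
  and addhom_Mt_ract: "s \<in> carrier S \<Longrightarrow> addhom P Mt g \<Longrightarrow> addhom P Mt (\<lambda>x. g x \<triangleleft>\<^bsub>Mt\<^esub> s)"
  and addhom_Mt_lact: "a \<in> carrier A \<Longrightarrow> addhom P Mt g \<Longrightarrow> addhom P Mt (\<lambda>x. a \<triangleright>\<^bsub>Mt\<^esub> g x)"
  by (simp_all add: addhom_ract[OF M_right] addhom_ract[OF M_sides(2)] addhom_lact[OF M_sides(1)])

lemma addhom_dyad_left: "\<phi> \<in> carrier Mt \<Longrightarrow> addhom P M f \<Longrightarrow> addhom P S (\<lambda>x. dyad (f x) \<phi>)"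
  and addhom_dyad_right: "u \<in> carrier M \<Longrightarrow> addhom P Mt g \<Longrightarrow> addhom P S (\<lambda>x. dyad u (g x))"
  using dyad_balanced addhom_compose[of M S "\<lambda>x. dyad x \<phi>" P f] addhom_compose[of Mt S "dyad u" P g]
  by (auto simp: balanced_def)

text \<open>As introduction rules these strip equivalent record presentations from an additivity
  goal until a rule for the underlying group applies.\<close>

lemma addhom_normal:
  "addhom P (tensor_group R X N) f \<Longrightarrow> addhom P (rtensor R X N) f"
  "addhom P (tensor_group R X' N) f \<Longrightarrow> addhom P (btensor R X' N) f"
  "addhom (tensor_group R X N) Q g \<Longrightarrow> addhom (rtensor R X N) Q g"
  "addhom (tensor_group R X' N) Q g \<Longrightarrow> addhom (btensor R X' N) Q g"
  "addhom P M h \<Longrightarrow> addhom P Ms h" "addhom M Q k \<Longrightarrow> addhom Ms Q k"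
  "addhom P Mt \<alpha> \<Longrightarrow> addhom P Md \<alpha>" "addhom Mt Q \<beta> \<Longrightarrow> addhom Md Q \<beta>"
  "addhom P S \<gamma> \<Longrightarrow> addhom P Sr \<gamma>" "addhom P S \<gamma> \<Longrightarrow> addhom P Sl \<gamma>"
  "addhom S Q \<delta> \<Longrightarrow> addhom Sr Q \<delta>" "addhom S Q \<delta> \<Longrightarrow> addhom Sl Q \<delta>"
  "addhom P (tensor_group B Md M) \<kappa> \<Longrightarrow> addhom P C \<kappa>"
  "addhom (tensor_group B Md M) Q \<mu> \<Longrightarrow> addhom C Q \<mu>"
  "addhom P (tensor_group B Sr Sl) \<tau> \<Longrightarrow> addhom P D \<tau>"
  "addhom (tensor_group B Sr Sl) Q \<omega> \<Longrightarrow> addhom D Q \<omega>"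
  by simp_all

lemmas addhom_intros = addhom_normal addhom_S_left addhom_S_right addhom_M_ract addhom_Mt_ract addhom_Mt_lact
  addhom_dyad_left addhom_dyad_right addhom_tens_left addhom_tens_right addhom_finsum_fun addhom_ident

text \<open>Over \<open>B\<close>, the scalar b enters as b e_i in the middle,
  \<open>balanced_shift\<close> with s = \<open>j b\<close> transfers it to e'_i, and there it
  crosses to u.\<close>

lemma comult_C_balanced:
  "balanced B Md M (tensor_group A C C)
    (\<lambda>\<phi> u. finsum (tensor_group A C C) (\<lambda>i. tens A C C (pc \<phi> (e i)) (pc (e' i) u)) I)"
proof (rule balancedI)
  fix \<phi> b u assume *: "\<phi> \<in> carrier Md" "b \<in> carrier B" "u \<in> carrier M"
  have bal: "balanced A M Mt (tensor_group A C C) (\<lambda>v \<psi>. tens A C C (pc \<phi> v) (pc \<psi> u))"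
  proof (rule balancedI)
    fix v a \<psi> assume **: "v \<in> carrier M" "a \<in> carrier A" "\<psi> \<in> carrier Mt"
    have "tens A C C (pc \<phi> v \<triangleleft>\<^bsub>C\<^esub> a) (pc \<psi> u) = tens A C C (pc \<phi> v) (a \<triangleright>\<^bsub>C\<^esub> pc \<psi> u)"
      using * ** by (intro tens_ract[OF coring_sides(2,1)]) simp_all
    then show "tens A C C (pc \<phi> (v \<triangleleft>\<^bsub>M\<^esub> a)) (pc \<psi> u) = tens A C C (pc \<phi> v) (pc (a \<triangleright>\<^bsub>Mt\<^esub> \<psi>) u)"
      using * ** by simp
  qed ((intro addhom_intros; use * in simp), (intro addhom_intros; use * in simp))
  show "finsum (tensor_group A C C) (\<lambda>i. tens A C C (pc (\<phi> \<triangleleft>\<^bsub>Md\<^esub> b) (e i)) (pc (e' i) u)) I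
      = finsum (tensor_group A C C) (\<lambda>i. tens A C C (pc \<phi> (e i)) (pc (e' i) (b \<triangleright>\<^bsub>M\<^esub> u))) I"
    using balanced_shift[OF _ bal, of "j b"] * by (simp add: Md_ract pc_ract)
qed ((intro addhom_intros; simp), (intro addhom_intros; simp))

lemma CC_abelian [simp]: "abelian_group (tensor_group A C C)"
  by simp

lemma comult_C_addhom: "addhom (tensor_group B Md M) (tensor_group A C C) (comult C)"
  unfolding C_fields
  by (rule tensor_lift_addhom[OF M_sides(4) M_left CC_abelian comult_C_balanced])

lemma comult_C_pc [simp]:
  "\<lbrakk>\<phi> \<in> carrier Mt; u \<in> carrier M\<rbrakk> \<Longrightarrow> comult C (pc \<phi> u)
    = finsum (tensor_group A C C) (\<lambda>i. tens A C C (pc \<phi> (e i)) (pc (e' i) u)) I"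
  unfolding C_fields
  by (rule tensor_lift_tens[OF M_sides(4) M_left CC_abelian comult_C_balanced]) simp_all

lemma counit_C_balanced: "balanced B Md M A (\<lambda>\<phi> u. \<phi> u)"
  by (rule balancedI) (auto intro!: addhomI simp: Md_ract)

lemma counit_C_addhom: "addhom (tensor_group B Md M) A (counit C)"
  unfolding C_fields
  by (rule tensor_lift_addhom[OF M_sides(4) M_left A_abelian counit_C_balanced])

lemma counit_C_pc [simp]: "\<lbrakk>\<phi> \<in> carrier Mt; u \<in> carrier M\<rbrakk> \<Longrightarrow> counit C (pc \<phi> u) = \<phi> u"
  unfolding C_fields
  by (rule tensor_lift_tens[OF M_sides(4) M_left A_abelian counit_C_balanced]) simp_all

lemmas C_eqI = tensor_eqI[OF M_sides(4) M_left]
lemmas D_eqI = tensor_eqI[OF S_sides(2,3)]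

lemma C_ract_addhom: "a \<in> carrier A \<Longrightarrow> addhom (tensor_group B Md M) (tensor_group B Md M) (\<lambda>c. c \<triangleleft>\<^bsub>C\<^esub> a)"
  and C_lact_addhom: "a \<in> carrier A \<Longrightarrow> addhom (tensor_group B Md M) (tensor_group B Md M) (\<lambda>c. a \<triangleright>\<^bsub>C\<^esub> c)"
  using addhom_ract[OF coring_sides(2) _ addhom_ident, of a] addhom_lact[OF coring_sides(1) _ addhom_ident, of a]
  by simp_all

lemma D_ract_addhom: "t \<in> carrier S \<Longrightarrow> addhom (tensor_group B Sr Sl) (tensor_group B Sr Sl) (\<lambda>c. c \<triangleleft>\<^bsub>D\<^esub> t)"
  and D_lact_addhom: "t \<in> carrier S \<Longrightarrow> addhom (tensor_group B Sr Sl) (tensor_group B Sr Sl) (\<lambda>c. t \<triangleright>\<^bsub>D\<^esub> c)"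
  using addhom_ract[OF coring_sides(4) _ addhom_ident, of t] addhom_lact[OF coring_sides(3) _ addhom_ident, of t]
  by simp_all

text \<open>The left action reaches only \<phi> and the right action only u, both outside the
  inserted basis.\<close>

lemma comult_C_bilinear: "bilinear_map A A C (btensor A C C) (comult C)"
  unfolding bilinear_map_def
proof (intro conjI right_linearI ballI)
  show "addhom C (btensor A C C) (comult C)"
    using comult_C_addhom by simp
  fix a c assume a: "a \<in> carrier A" and c: "c \<in> carrier C"
  show "comult C (c \<triangleleft>\<^bsub>C\<^esub> a) = comult C c \<triangleleft>\<^bsub>btensor A C C\<^esub> a"
    unfolding btensor_simps
  proof (rule C_eqI[where t = c, OF addhom_compose[OF comult_C_addhom C_ract_addhom[OF a]]
        addhom_compose[OF rtensor_ract_addhom comult_C_addhom]])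
    fix \<phi> u assume "\<phi> \<in> carrier Md" "u \<in> carrier M"
    then show "comult C (pc \<phi> u \<triangleleft>\<^bsub>C\<^esub> a) = comult C (pc \<phi> u) \<triangleleft>\<^bsub>rtensor A C C\<^esub> a"
      using a by (simp add: finsum_rtensor_ract[OF coring_sides(2) C_bimodule]
          rtensor_ract_tens[OF coring_sides(2) C_bimodule])
  qed (use a c in simp_all)
  show "comult C (a \<triangleright>\<^bsub>C\<^esub> c) = a \<triangleright>\<^bsub>btensor A C C\<^esub> comult C c"
  proof (rule C_eqI[where t = c, OF addhom_compose[OF comult_C_addhom C_lact_addhom[OF a]]
        addhom_compose[OF btensor_lact_addhom comult_C_addhom]])
    fix \<phi> u assume "\<phi> \<in> carrier Md" "u \<in> carrier M"
    then show "comult C (a \<triangleright>\<^bsub>C\<^esub> pc \<phi> u) = a \<triangleright>\<^bsub>btensor A C C\<^esub> comult C (pc \<phi> u)"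
      using a by (simp add: finsum_btensor_lact[OF C_bimodule coring_sides(1)]
          btensor_lact_tens[OF C_bimodule coring_sides(1)])
  qed (use a c in simp_all)
qed

lemma counit_C_bilinear: "bilinear_map A A C (regular A) (counit C)"
  unfolding bilinear_map_def
proof (intro conjI right_linearI ballI)
  show "addhom C (regular A) (counit C)"
    using counit_C_addhom by simp
  fix a c assume a: "a \<in> carrier A" and c: "c \<in> carrier C"
  have r: "addhom A A (\<lambda>x. x \<otimes>\<^bsub>A\<^esub> a)" "addhom A A (\<lambda>x. a \<otimes>\<^bsub>A\<^esub> x)"
    using a by (auto intro!: addhomI simp: MM.T.l_distr MM.T.r_distr)
  have "counit C (c \<triangleleft>\<^bsub>C\<^esub> a) = counit C c \<otimes>\<^bsub>A\<^esub> a"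
    by (rule C_eqI[where t = c, OF addhom_compose[OF counit_C_addhom C_ract_addhom[OF a]]
          addhom_compose[OF r(1) counit_C_addhom]]) (use a c in simp_all)
  then show "counit C (c \<triangleleft>\<^bsub>C\<^esub> a) = counit C c \<triangleleft>\<^bsub>regular A\<^esub> a"
    by simp
  have "counit C (a \<triangleright>\<^bsub>C\<^esub> c) = a \<otimes>\<^bsub>A\<^esub> counit C c"
    by (rule C_eqI[where t = c, OF addhom_compose[OF counit_C_addhom C_lact_addhom[OF a]]
          addhom_compose[OF r(2) counit_C_addhom]]) (use a c in simp_all)
  then show "counit C (a \<triangleright>\<^bsub>C\<^esub> c) = a \<triangleright>\<^bsub>regular A\<^esub> counit C c"
    by simp
qed

lemma A_sides [simp]: "left_module A (regular A)" "right_module A (regular A)"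
  by (simp_all add: bimodule_left[OF regular_bimodule] bimodule_right[OF regular_bimodule])

lemma S_regular_sides [simp]: "left_module S (regular S)" "right_module S (regular S)"
  by (simp_all add: bimodule_left[OF regular_bimodule] bimodule_right[OF regular_bimodule])

lemmas comult_C_linear = bilinear_map_right_linear[OF comult_C_bilinear] bilinear_map_left_linear[OF comult_C_bilinear]
lemmas counit_C_linear = bilinear_map_right_linear[OF counit_C_bilinear] bilinear_map_left_linear[OF counit_C_bilinear]

lemma CC_sides [simp]:
  "left_module A (btensor A C C)" "right_module A (btensor A C C)" "right_module A (rtensor A C C)"
  using btensor_left_module[OF C_bimodule coring_sides(1)]
    btensor_right_module[OF coring_sides(2) C_bimodule] rtensor_right_module[OF coring_sides(2) C_bimodule]
  by simp_all

text \<open>Both sides of coassociativity put two copies of the canonical element between \<phi> and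
  u. The left counit axiom is the expansion of \<phi> in the forms e'_i, the right one the expansion
  of u in the vectors e_i.\<close>

lemma coring_C: "coring K A C"
proof (intro coring.intro coring_axioms.intro C_central comult_C_bilinear counit_C_bilinear)
  fix c assume c: "c \<in> carrier C"
  note r = coring_sides(2) and l = coring_sides(1)
  note L = addhom_tensor_map[OF r l CC_sides(2) l comult_C_linear(1) left_linear_ident]
  note Lt = tensor_map_tens[OF r l CC_sides(2) l comult_C_linear(1) left_linear_ident]
  note R = addhom_tensor_map[OF r l r CC_sides(1) right_linear_ident comult_C_linear(2)]
  note Rt = tensor_map_tens[OF r l r CC_sides(1) right_linear_ident comult_C_linear(2)]
  note as = tensor_assoc_addhom[OF r C_bimodule l] and ast = tensor_assoc_tens[OF r C_bimodule l]
  have ab: "abelian_group (tensor_group A (rtensor A C C) C)" "abelian_group (tensor_group A C (btensor A C C))"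
    by simp_all
  have L': "addhom (tensor_group A C C) (tensor_group A (rtensor A C C) C)
      (tensor_map A C C (btensor A C C) C (comult C) (\<lambda>x. x))"
    using L by simp
  show "tensor_assoc A A C C C (tensor_map A C C (btensor A C C) C (comult C) (\<lambda>x. x) (comult C c))
      = tensor_map A C C C (btensor A C C) (\<lambda>x. x) (comult C) (comult C c)"
  proof (rule C_eqI[where t = c, OF addhom_compose[OF as addhom_compose[OF L' comult_C_addhom]]
        addhom_compose[OF R comult_C_addhom]])
    fix \<phi> u assume *: "\<phi> \<in> carrier Md" "u \<in> carrier M"
    \<comment> \<open>After evaluation both sides are the same double sum, with the two basis
      indices summed in opposite order.\<close>
    show "tensor_assoc A A C C C (tensor_map A C C (btensor A C C) C (comult C) (\<lambda>x. x) (comult C (pc \<phi> u)))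
      = tensor_map A C C C (btensor A C C) (\<lambda>x. x) (comult C) (comult C (pc \<phi> u))"
      using *
      by (simp add: addhom_finsum_nat[OF CC_abelian ab(1) L'] addhom_finsum_nat[OF CC_abelian ab(2) R]
          addhom_finsum_nat[OF ab(1,2) as] Lt Rt ast tens_finsum_right_nat[OF r CC_sides(1), simplified]
          tens_finsum_left_nat[OF CC_sides(3) l, simplified])
        (rule finsum_swap; simp)
  qed (use c in simp)
  note L = addhom_tensor_map[OF r l A_sides(2) l counit_C_linear(1) left_linear_ident]
  note Lt = tensor_map_tens[OF r l A_sides(2) l counit_C_linear(1) left_linear_ident]
  note R = addhom_tensor_map[OF r l r A_sides(1) right_linear_ident counit_C_linear(2)]
  note Rt = tensor_map_tens[OF r l r A_sides(1) right_linear_ident counit_C_linear(2)]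
  have lu: "addhom (tensor_group A (regular A) C) (tensor_group B Md M) (tensor_lunit C)"
    using tensor_lunit_addhom[OF l] by simp
  have ru: "addhom (tensor_group A C (regular A)) (tensor_group B Md M) (tensor_runit C)"
    using tensor_runit_addhom[OF r] by simp
  have ab: "abelian_group (tensor_group A C (regular A))" "abelian_group (tensor_group A (regular A) C)"
    "abelian_group (tensor_group B Md M)"
    by simp_all
  show "tensor_lunit C (tensor_map A C C (regular A) C (counit C) (\<lambda>x. x) (comult C c)) = c"
  proof (rule C_eqI[where t = c and g = "\<lambda>x. x",
        OF addhom_compose[OF lu addhom_compose[OF L comult_C_addhom]] addhom_ident])
    fix \<phi> u assume *: "\<phi> \<in> carrier Md" "u \<in> carrier M"
    have "tensor_lunit C (tensor_map A C C (regular A) C (counit C) (\<lambda>x. x) (comult C (pc \<phi> u)))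
        = pc (finsum Mt (\<lambda>i. \<phi> (e i) \<triangleright>\<^bsub>Mt\<^esub> e' i) I) u"
      using *
      by (simp add: addhom_finsum_nat[OF CC_abelian ab(2) L] addhom_finsum_nat[OF ab(2,3) lu] Lt
          tensor_lunit_tens[OF l] tens_finsum_left_nat[OF M_sides(4) M_left, simplified])
    then show "tensor_lunit C (tensor_map A C C (regular A) C (counit C) (\<lambda>x. x) (comult C (pc \<phi> u))) = pc \<phi> u"
      using * by (simp add: dual_expand)
  qed (use c in simp)
  show "tensor_runit C (tensor_map A C C C (regular A) (\<lambda>x. x) (counit C) (comult C c)) = c"
  proof (rule C_eqI[where t = c and g = "\<lambda>x. x",
        OF addhom_compose[OF ru addhom_compose[OF R comult_C_addhom]] addhom_ident])
    fix \<phi> u assume *: "\<phi> \<in> carrier Md" "u \<in> carrier M"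
    have "tensor_runit C (tensor_map A C C C (regular A) (\<lambda>x. x) (counit C) (comult C (pc \<phi> u)))
        = pc \<phi> (finsum M (\<lambda>i. e i \<triangleleft>\<^bsub>M\<^esub> e' i u) I)"
      using *
      by (simp add: addhom_finsum_nat[OF CC_abelian ab(1) R] addhom_finsum_nat[OF ab(1,3) ru] Rt
          tensor_runit_tens[OF r] tens_finsum_right_nat[OF M_sides(4) M_left, simplified])
    then show "tensor_runit C (tensor_map A C C C (regular A) (\<lambda>x. x) (counit C) (comult C (pc \<phi> u))) = pc \<phi> u"
      using * by (simp add: basis_sum)
  qed (use c in simp)
qed

lemma DD_abelian [simp]: "abelian_group (tensor_group S D D)"
  by simp

text \<open>An element of \<open>B\<close> crosses from s to the unit of the first copy, acts on
  that copy from the right, crosses the tensor sign over \<open>S\<close>, and reaches s' past the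
  unit of the second copy.\<close>

lemma comult_D_balanced:
  "balanced B Sr Sl (tensor_group S D D) (\<lambda>s s'. tens S D D (pd s \<one>\<^bsub>S\<^esub>) (pd \<one>\<^bsub>S\<^esub> s'))"
proof (rule balancedI)
  fix s b s' assume *: "s \<in> carrier Sr" "b \<in> carrier B" "s' \<in> carrier Sl"
  have "tens S D D (pd s \<one>\<^bsub>S\<^esub> \<triangleleft>\<^bsub>D\<^esub> j b) (pd \<one>\<^bsub>S\<^esub> s') = tens S D D (pd s \<one>\<^bsub>S\<^esub>) (j b \<triangleright>\<^bsub>D\<^esub> pd \<one>\<^bsub>S\<^esub> s')"
    using * by (intro tens_ract[OF coring_sides(4,3)]) simp_all
  then show "tens S D D (pd (s \<triangleleft>\<^bsub>Sr\<^esub> b) \<one>\<^bsub>S\<^esub>) (pd \<one>\<^bsub>S\<^esub> s') = tens S D D (pd s \<one>\<^bsub>S\<^esub>) (pd \<one>\<^bsub>S\<^esub> (b \<triangleright>\<^bsub>Sl\<^esub> s'))"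
    using * pd_ract[of s "\<one>\<^bsub>S\<^esub>" b] pd_ract[of "\<one>\<^bsub>S\<^esub>" s' b] by simp
qed ((intro addhom_intros; simp), (intro addhom_intros; simp))

lemma comult_D_addhom: "addhom (tensor_group B Sr Sl) (tensor_group S D D) (comult D)"
  unfolding D_fields
  by (rule tensor_lift_addhom[OF S_sides(2,3) DD_abelian comult_D_balanced])

lemma comult_D_pd [simp]:
  "\<lbrakk>s \<in> carrier S; s' \<in> carrier S\<rbrakk>
    \<Longrightarrow> comult D (pd s s') = tens S D D (pd s \<one>\<^bsub>S\<^esub>) (pd \<one>\<^bsub>S\<^esub> s')"
  unfolding D_fields
  by (rule tensor_lift_tens[OF S_sides(2,3) DD_abelian comult_D_balanced]) simp_all

lemma counit_D_balanced: "balanced B Sr Sl S (\<lambda>s s'. s \<otimes>\<^bsub>S\<^esub> s')"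
  by (rule balancedI) ((intro addhom_intros; simp), (intro addhom_intros; simp), simp)

lemma counit_D_addhom: "addhom (tensor_group B Sr Sl) S (counit D)"
  unfolding D_fields
  by (rule tensor_lift_addhom[OF S_sides(2,3) S_abelian counit_D_balanced])

lemma counit_D_pd [simp]: "\<lbrakk>s \<in> carrier S; s' \<in> carrier S\<rbrakk> \<Longrightarrow> counit D (pd s s') = s \<otimes>\<^bsub>S\<^esub> s'"
  unfolding D_fields
  by (rule tensor_lift_tens[OF S_sides(2,3) S_abelian counit_D_balanced]) simp_all

lemma comult_D_bilinear: "bilinear_map S S D (btensor S D D) (comult D)"
  unfolding bilinear_map_def
proof (intro conjI right_linearI ballI)
  show "addhom D (btensor S D D) (comult D)"
    using comult_D_addhom by simp
  fix a c assume a: "a \<in> carrier S" and c: "c \<in> carrier D"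
  show "comult D (c \<triangleleft>\<^bsub>D\<^esub> a) = comult D c \<triangleleft>\<^bsub>btensor S D D\<^esub> a"
    unfolding btensor_simps
    by (rule D_eqI[where t = c, OF addhom_compose[OF comult_D_addhom D_ract_addhom[OF a]]
          addhom_compose[OF rtensor_ract_addhom comult_D_addhom]])
      (use a c in \<open>simp_all add: rtensor_ract_tens[OF coring_sides(4) D_bimodule]\<close>)
  show "comult D (a \<triangleright>\<^bsub>D\<^esub> c) = a \<triangleright>\<^bsub>btensor S D D\<^esub> comult D c"
    by (rule D_eqI[where t = c, OF addhom_compose[OF comult_D_addhom D_lact_addhom[OF a]]
          addhom_compose[OF btensor_lact_addhom comult_D_addhom]])
      (use a c in \<open>simp_all add: btensor_lact_tens[OF D_bimodule coring_sides(3)]\<close>)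
qed

lemma counit_D_bilinear: "bilinear_map S S D (regular S) (counit D)"
  unfolding bilinear_map_def
proof (intro conjI right_linearI ballI)
  show "addhom D (regular S) (counit D)"
    using counit_D_addhom by simp
  fix a c assume a: "a \<in> carrier S" and c: "c \<in> carrier D"
  have "counit D (c \<triangleleft>\<^bsub>D\<^esub> a) = counit D c \<otimes>\<^bsub>S\<^esub> a"
    by (rule D_eqI[where t = c, OF addhom_compose[OF counit_D_addhom D_ract_addhom[OF a]]
          addhom_S_left[OF a counit_D_addhom]]) (use a c in simp_all)
  then show "counit D (c \<triangleleft>\<^bsub>D\<^esub> a) = counit D c \<triangleleft>\<^bsub>regular S\<^esub> a"
    by simp
  have "counit D (a \<triangleright>\<^bsub>D\<^esub> c) = a \<otimes>\<^bsub>S\<^esub> counit D c"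
    by (rule D_eqI[where t = c, OF addhom_compose[OF counit_D_addhom D_lact_addhom[OF a]]
          addhom_S_right[OF a counit_D_addhom]]) (use a c in simp_all)
  then show "counit D (a \<triangleright>\<^bsub>D\<^esub> c) = a \<triangleright>\<^bsub>regular S\<^esub> counit D c"
    by simp
qed

lemmas comult_D_linear = bilinear_map_right_linear[OF comult_D_bilinear] bilinear_map_left_linear[OF comult_D_bilinear]
lemmas counit_D_linear = bilinear_map_right_linear[OF counit_D_bilinear] bilinear_map_left_linear[OF counit_D_bilinear]

lemma DD_sides [simp]:
  "left_module S (btensor S D D)" "right_module S (btensor S D D)" "right_module S (rtensor S D D)"
  using btensor_left_module[OF D_bimodule coring_sides(3)]
    btensor_right_module[OF coring_sides(4) D_bimodule] rtensor_right_module[OF coring_sides(4) D_bimodule]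
  by simp_all

text \<open>Both iterated comultiplications of s \<otimes> s' equal (s \<otimes> 1) \<otimes> (1
  \<otimes> 1) \<otimes> (1 \<otimes> s') up to bracketing; no sums occur, so evaluation on pure
  tensors settles all axioms.\<close>

lemma coring_D: "coring K S D"
proof (intro coring.intro coring_axioms.intro D_central comult_D_bilinear counit_D_bilinear)
  fix c assume c: "c \<in> carrier D"
  note r = coring_sides(4) and l = coring_sides(3)
  note L = addhom_tensor_map[OF r l DD_sides(2) l comult_D_linear(1) left_linear_ident]
  note Lt = tensor_map_tens[OF r l DD_sides(2) l comult_D_linear(1) left_linear_ident]
  note R = addhom_tensor_map[OF r l r DD_sides(1) right_linear_ident comult_D_linear(2)]
  note Rt = tensor_map_tens[OF r l r DD_sides(1) right_linear_ident comult_D_linear(2)]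
  note as = tensor_assoc_addhom[OF r D_bimodule l] and ast = tensor_assoc_tens[OF r D_bimodule l]
  have L': "addhom (tensor_group S D D) (tensor_group S (rtensor S D D) D)
      (tensor_map S D D (btensor S D D) D (comult D) (\<lambda>x. x))"
    using L by simp
  show "tensor_assoc S S D D D (tensor_map S D D (btensor S D D) D (comult D) (\<lambda>x. x) (comult D c))
      = tensor_map S D D D (btensor S D D) (\<lambda>x. x) (comult D) (comult D c)"
    by (rule D_eqI[where t = c, OF addhom_compose[OF as addhom_compose[OF L' comult_D_addhom]]
        addhom_compose[OF R comult_D_addhom]])
      (use c in \<open>simp_all add: Lt Rt ast\<close>)
  note L = addhom_tensor_map[OF r l S_regular_sides(2) l counit_D_linear(1) left_linear_ident]
  note Lt = tensor_map_tens[OF r l S_regular_sides(2) l counit_D_linear(1) left_linear_ident]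
  note R = addhom_tensor_map[OF r l r S_regular_sides(1) right_linear_ident counit_D_linear(2)]
  note Rt = tensor_map_tens[OF r l r S_regular_sides(1) right_linear_ident counit_D_linear(2)]
  have lu: "addhom (tensor_group S (regular S) D) (tensor_group B Sr Sl) (tensor_lunit D)"
    using tensor_lunit_addhom[OF l] by simp
  have ru: "addhom (tensor_group S D (regular S)) (tensor_group B Sr Sl) (tensor_runit D)"
    using tensor_runit_addhom[OF r] by simp
  show "tensor_lunit D (tensor_map S D D (regular S) D (counit D) (\<lambda>x. x) (comult D c)) = c"
    by (rule D_eqI[where t = c and g = "\<lambda>x. x",
        OF addhom_compose[OF lu addhom_compose[OF L comult_D_addhom]] addhom_ident])
      (use c in \<open>simp_all add: Lt tensor_lunit_tens[OF l]\<close>)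
  show "tensor_runit D (tensor_map S D D D (regular S) (\<lambda>x. x) (counit D) (comult D c)) = c"
    by (rule D_eqI[where t = c and g = "\<lambda>x. x",
        OF addhom_compose[OF ru addhom_compose[OF R comult_D_addhom]] addhom_ident])
      (use c in \<open>simp_all add: Rt tensor_runit_tens[OF r]\<close>)
qed

end

section \<open>Tensor maps: dependence on records and functoriality\<close>

lemma tensor_map_cong_source:
  assumes "carrier M = carrier M1" "add M = add M1" "ract M = ract M1"
  shows "tensor_map R M N M' N' f g = tensor_map R M1 N M' N' f g"
  using tens_cong(2)[OF assms, of N N R] by (simp add: tensor_map_def)

lemma tensor_map_cong_target:
  assumes "carrier M' = carrier M1" "add M' = add M1" "ract M' = ract M1"
  shows "tensor_map R M N M' N' f g = tensor_map R M N M1 N' f g"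
  using tens_cong[OF assms, of N' N' R] by (simp add: tensor_map_def)

lemma tensor_assoc_cong:
  assumes "carrier M = carrier M1" "add M = add M1" "ract M = ract M1"
  shows "tensor_assoc R T M N P = tensor_assoc R T M1 N P"
  using tens_cong[OF assms, of "btensor T N P" "btensor T N P" R] by (simp add: tensor_assoc_def)

lemma tensor_runit_cong:
  assumes "carrier M = carrier M1" "add M = add M1" "\<zero>\<^bsub>M\<^esub> = \<zero>\<^bsub>M1\<^esub>" "ract M = ract M1"
  shows "tensor_runit M = tensor_runit M1"
  using tensor_lift_record_cong[of M M1] assms by (simp add: tensor_runit_def)

text \<open>The identity in an extensional Hom-set is the restricted one. Tensor maps are
  extensional as well, so the law holds as an equality of functions.\<close>

lemma tensor_map_restrict_ident:
  assumes M: "right_module R M" and N: "left_module R N"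
  shows "tensor_map R M N M N (\<lambda>x\<in>carrier M. x) (\<lambda>x. x) = (\<lambda>t\<in>carrier (tensor_group R M N). t)"
proof (rule extensionalityI[of _ "carrier (tensor_group R M N)"])
  have l: "right_linear R M M (\<lambda>x\<in>carrier M. x)"
    using right_module.ract_closed[OF M] abelian_groupE(1)[OF right_module_abelian[OF M]]
    by (auto simp: right_linear_def)
  fix t assume t: "t \<in> carrier (tensor_group R M N)"
  have "tensor_map R M N M N (\<lambda>x\<in>carrier M. x) (\<lambda>x. x) t = t"
    by (rule tensor_eqI[OF M N addhom_tensor_map[OF M N M N l left_linear_ident] addhom_ident t])
      (simp add: tensor_map_tens[OF M N M N l left_linear_ident])
  then show "tensor_map R M N M N (\<lambda>x\<in>carrier M. x) (\<lambda>x. x) t = (\<lambda>t\<in>carrier (tensor_group R M N). t) t"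
    using t by simp
qed (simp_all add: tensor_map_extensional)

lemma right_linear_compose:
  assumes M: "right_module R M" and f: "right_linear R M M' f" and f': "right_linear R M' M'' f'"
  shows "right_linear R M M'' (compose (carrier M) f' f)"
  using assms(2,3) right_module.ract_closed[OF M] abelian_groupE(1)[OF right_module_abelian[OF M]]
  by (simp add: right_linear_def Pi_def compose_eq)

lemma tensor_map_compose:
  assumes M: "right_module R M" and M': "right_module R M'" and M'': "right_module R M''"
    and N: "left_module R N"
    and f: "right_linear R M M' f" and f': "right_linear R M' M'' f'"
  shows "tensor_map R M N M'' N (compose (carrier M) f' f) (\<lambda>x. x)
    = compose (carrier (tensor_group R M N)) (tensor_map R M' N M'' N f' (\<lambda>x. x)) (tensor_map R M N M' N f (\<lambda>x. x))"
proof (rule extensionalityI[of _ "carrier (tensor_group R M N)"])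
  note fh = right_linear_addhom[OF f]
  note l = right_linear_compose[OF M f f']
  fix t assume t: "t \<in> carrier (tensor_group R M N)"
  have "tensor_map R M N M'' N (compose (carrier M) f' f) (\<lambda>x. x) t
      = tensor_map R M' N M'' N f' (\<lambda>x. x) (tensor_map R M N M' N f (\<lambda>x. x) t)"
    by (rule tensor_eqI[OF M N addhom_tensor_map[OF M N M'' N l left_linear_ident]
          addhom_compose[OF addhom_tensor_map[OF M' N M'' N f' left_linear_ident]
            addhom_tensor_map[OF M N M' N f left_linear_ident]] t])
      (simp add: tensor_map_tens[OF M N M' N f left_linear_ident] compose_eq addhom_closed[OF fh]
        tensor_map_tens[OF M' N M'' N f' left_linear_ident] tensor_map_tens[OF M N M'' N l left_linear_ident])
  then show "tensor_map R M N M'' N (compose (carrier M) f' f) (\<lambda>x. x) t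
    = compose (carrier (tensor_group R M N)) (tensor_map R M' N M'' N f' (\<lambda>x. x)) (tensor_map R M N M' N f (\<lambda>x. x)) t"
    using t by (simp add: compose_eq)
qed (simp_all add: tensor_map_extensional compose_extensional)

lemma addhom_ract_right:
  assumes "right_module A M" "m \<in> carrier M" "addhom P A f"
  shows "addhom P M (\<lambda>x. m \<triangleleft>\<^bsub>M\<^esub> f x)"
  using assms(2,3)
  by (auto simp: addhom_def Pi_def right_module.ract_add_right[OF assms(1)]
      right_module.ract_closed[OF assms(1)])

lemma comodule_right_module: "comodule A C M \<Longrightarrow> right_module A M"
  by (simp add: comodule_def)

lemma comodule_coact_linear: "comodule A C M \<Longrightarrow> right_linear A M (rtensor A M C) (coact M)"
  by (rule comodule.coact_linear)

lemma comodule_coact_addhom: "comodule A C M \<Longrightarrow> addhom M (tensor_group A M C) (coact M)"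
  using right_linear_addhom[OF comodule.coact_linear] by simp

lemma comodule_coact_closed:
  "comodule A C M \<Longrightarrow> m \<in> carrier M \<Longrightarrow> coact M m \<in> carrier (tensor_group A M C)"
  by (rule addhom_closed[OF comodule_coact_addhom])

lemma comodule_coact_ract:
  "\<lbrakk>comodule A C M; m \<in> carrier M; a \<in> carrier A\<rbrakk>
    \<Longrightarrow> coact M (m \<triangleleft>\<^bsub>M\<^esub> a) = coact M m \<triangleleft>\<^bsub>rtensor A M C\<^esub> a"
  by (rule right_linear_ract[OF comodule.coact_linear])

text \<open>Presents the two inner lifts of the coaction as one \<open>lift_right\<close>, the form
  for which well-definedness has been established.\<close>

lemma tensor_Sigma_fields:
  fixes A B M n e e' Y
  defines "S \<equiv> End_alg A M" and "C \<equiv> btensor B (dual A M) M" and "X \<equiv> rtensor (End_alg A M) Y (End_bimod M)"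
  shows "carrier (tensor_Sigma A B M n e e' Y) = carrier X"
    "add (tensor_Sigma A B M n e e' Y) = add X"
    "\<zero>\<^bsub>tensor_Sigma A B M n e e' Y\<^esub> = \<zero>\<^bsub>X\<^esub>"
    "ract (tensor_Sigma A B M n e e' Y) = ract X"
    "coact (tensor_Sigma A B M n e e' Y) = tensor_lift (rtensor A X C) (\<lambda>y u.
      lift_right (rtensor A X C) (\<lambda>y' s s'. \<Oplus>\<^bsub>rtensor A X C\<^esub>i\<in>{..<n}. tens A X C
        (tens S Y (End_bimod M) (y' \<triangleleft>\<^bsub>Y\<^esub> s) (e i)) (tens B (dual A M) M (e' i) (s' u)))
      (coact Y y))"
  unfolding S_def C_def X_def
  by (simp_all add: tensor_Sigma_def Let_def rmod.defs comod.defs lift_right_def)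

lemma lift_right_record [simp]:
  "lift_right (rtensor R M N) = lift_right (tensor_group R M N)"
  by (simp add: lift_right_def fun_eq_iff)

context comatrix_setup
begin

section \<open>The functor to comodules over the comatrix coring\<close>

abbreviation "FM Y \<equiv> rtensor S Y Ms"
abbreviation "FC Y \<equiv> tensor_group A (FM Y) C"
abbreviation "FF Y \<equiv> tensor_Sigma A B M n e e' Y"

lemma addhom_S_app: "u \<in> carrier M \<Longrightarrow> addhom P S f \<Longrightarrow> addhom P M (\<lambda>x. f x u)"
  by (auto simp: addhom_def Pi_def)

lemma FM_right [simp]: "right_module S Y \<Longrightarrow> right_module A (FM Y)"
  by (rule rtensor_right_module[OF _ Ms_bimodule])

lemma YS_right [simp]: "right_module S Y \<Longrightarrow> right_module S (rtensor S Y D)"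
  by (rule rtensor_right_module[OF _ D_bimodule])

lemma XC_right [simp]: "right_module A X \<Longrightarrow> right_module A (rtensor A X C)"
  by (rule rtensor_right_module[OF _ C_bimodule])

lemma FM_ract [simp]:
  "\<lbrakk>right_module S Y; y \<in> carrier Y; u \<in> carrier M; a \<in> carrier A\<rbrakk>
    \<Longrightarrow> tens S Y Ms y u \<triangleleft>\<^bsub>FM Y\<^esub> a = tens S Y Ms y (u \<triangleleft>\<^bsub>M\<^esub> a)"
  using rtensor_ract_tens[OF _ Ms_bimodule] by fastforce

lemma YD_ract [simp]:
  "\<lbrakk>right_module S Y; y \<in> carrier Y; d \<in> carrier D; s \<in> carrier S\<rbrakk>
    \<Longrightarrow> tens S Y D y d \<triangleleft>\<^bsub>rtensor S Y D\<^esub> s = tens S Y D y (d \<triangleleft>\<^bsub>D\<^esub> s)"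
  by (rule rtensor_ract_tens[OF _ D_bimodule])

lemma XC_ract [simp]:
  "\<lbrakk>right_module A X; x \<in> carrier X; c \<in> carrier C; a \<in> carrier A\<rbrakk>
    \<Longrightarrow> tens A X C x c \<triangleleft>\<^bsub>rtensor A X C\<^esub> a = tens A X C x (c \<triangleleft>\<^bsub>C\<^esub> a)"
  by (rule rtensor_ract_tens[OF _ C_bimodule])

lemma YD_eqI:
  assumes "right_module S Y" "addhom (tensor_group S Y D) G f" "addhom (tensor_group S Y D) G g"
    and "t \<in> carrier (tensor_group S Y D)"
    and "\<And>y s s'. \<lbrakk>y \<in> carrier Y; s \<in> carrier S; s' \<in> carrier S\<rbrakk>
      \<Longrightarrow> f (tens S Y D y (pd s s')) = g (tens S Y D y (pd s s'))"
  shows "f t = g t"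
  using tensor_eqI_right[OF assms(1) Sr_bimodule S_sides(3), of G f g t] assms(2-) by simp

lemma XC_eqI:
  assumes "right_module A X" "addhom (tensor_group A X C) G f" "addhom (tensor_group A X C) G g"
    and "t \<in> carrier (tensor_group A X C)"
    and "\<And>x \<phi> u. \<lbrakk>x \<in> carrier X; \<phi> \<in> carrier Mt; u \<in> carrier M\<rbrakk>
      \<Longrightarrow> f (tens A X C x (pc \<phi> u)) = g (tens A X C x (pc \<phi> u))"
  shows "f t = g t"
  using tensor_eqI_right[OF assms(1) Md_bimodule M_left, of G f g t] assms(2-) by simp

lemma FC_abelian [simp]: "right_module S Y \<Longrightarrow> abelian_group (FC Y)"
  by simp

lemma FC_balanced:
  assumes Y: "right_module S Y" and y: "y \<in> carrier Y" and w: "w \<in> carrier M"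
  shows "balanced A M Mt (FC Y) (\<lambda>v \<psi>. tens A (FM Y) C (tens S Y Ms y v) (pc \<psi> w))"
proof (rule balancedI)
  fix v a \<psi> assume *: "v \<in> carrier M" "a \<in> carrier A" "\<psi> \<in> carrier Mt"
  have "tens A (FM Y) C (tens S Y Ms y v \<triangleleft>\<^bsub>FM Y\<^esub> a) (pc \<psi> w)
      = tens A (FM Y) C (tens S Y Ms y v) (a \<triangleright>\<^bsub>C\<^esub> pc \<psi> w)"
    using * Y y w by (intro tens_ract) simp_all
  then show "tens A (FM Y) C (tens S Y Ms y (v \<triangleleft>\<^bsub>M\<^esub> a)) (pc \<psi> w)
      = tens A (FM Y) C (tens S Y Ms y v) (pc (a \<triangleright>\<^bsub>Mt\<^esub> \<psi>) w)"
    using * Y y w by simp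
qed ((intro addhom_intros; use Y y w in simp), (intro addhom_intros; use Y y w in simp))

text \<open>\<open>theta\<close> is needed for all right modules, not only for comodules: coassociativity uses it for
  \<open>Y \<otimes>\<^sub>S D\<close> as well.\<close>

definition theta_term ::
  "('m \<Rightarrow> 'm, 'y, 'xy) rmod_scheme \<Rightarrow> 'm \<Rightarrow> 'y \<Rightarrow> ('m \<Rightarrow> 'm) \<Rightarrow> ('m \<Rightarrow> 'm)
    \<Rightarrow> (('y \<times> 'm \<Rightarrow>\<^sub>0 int) set \<times> (('m \<Rightarrow> 'a) \<times> 'm \<Rightarrow>\<^sub>0 int) set \<Rightarrow>\<^sub>0 int) set" where
  "theta_term Y u y s s' = finsum (FC Y)
    (\<lambda>i. tens A (FM Y) C (tens S Y Ms (y \<triangleleft>\<^bsub>Y\<^esub> s) (e i)) (pc (e' i) (s' u))) I"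

definition theta where "theta Y u = lift_right (FC Y) (theta_term Y u)"

text \<open>Theta with the vector as a variable, on (Y \<otimes> D) \<otimes> Sigma. When the
  coaction of \<open>FF Y\<close> is applied to the first leg of a value of \<open>theta\<close>,
  the vector there is a basis element, and this map describes the outcome.\<close>

definition theta_hat where "theta_hat Y = tensor_lift (FC Y) (\<lambda>t u. theta Y u t)"

context
  fixes Y
  assumes Y [simp]: "right_module S Y"
begin

lemma Y_ract_closed [simp]: "\<lbrakk>y \<in> carrier Y; s \<in> carrier S\<rbrakk> \<Longrightarrow> y \<triangleleft>\<^bsub>Y\<^esub> s \<in> carrier Y"
  by (rule right_module.ract_closed[OF Y])

lemma Y_ract_mult:
  "\<lbrakk>y \<in> carrier Y; s \<in> carrier S; t \<in> carrier S\<rbrakk> \<Longrightarrow> y \<triangleleft>\<^bsub>Y\<^esub> (s \<otimes>\<^bsub>S\<^esub> t) = y \<triangleleft>\<^bsub>Y\<^esub> s \<triangleleft>\<^bsub>Y\<^esub> t"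
  by (rule right_module.ract_mult[OF Y])

lemma Y_ract_one [simp]: "y \<in> carrier Y \<Longrightarrow> y \<triangleleft>\<^bsub>Y\<^esub> \<one>\<^bsub>S\<^esub> = y"
  by (rule right_module.ract_one[OF Y])

lemma tens_Y_ract:
  "\<lbrakk>y \<in> carrier Y; s \<in> carrier S; u \<in> carrier M\<rbrakk> \<Longrightarrow> tens S Y Ms (y \<triangleleft>\<^bsub>Y\<^esub> s) u = tens S Y Ms y (s u)"
  using tens_ract[OF Y Ms_left] by simp

text \<open>The relation over \<open>S\<close> holds because s acts on y before anything else
  happens. The one over \<open>B\<close> is \<open>balanced_shift\<close> for \<open>j b\<close>,
  which transports b from the first leg to s'.\<close>

lemma theta_term_balanced:
  assumes u: "u \<in> carrier M"
  shows "balanced3 S B Y Sr Sl (FC Y) (theta_term Y u)"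
proof (rule balanced3I)
  fix y s b s' assume *: "y \<in> carrier Y" "s \<in> carrier Sr" "b \<in> carrier B" "s' \<in> carrier Sl"
  have "finsum (FC Y) (\<lambda>i. tens A (FM Y) C (tens S Y Ms (y \<triangleleft>\<^bsub>Y\<^esub> s) (j b (e i))) (pc (e' i) (s' u))) I
      = finsum (FC Y) (\<lambda>i. tens A (FM Y) C (tens S Y Ms (y \<triangleleft>\<^bsub>Y\<^esub> s) (e i)) (pc (e' i \<triangleleft>\<^bsub>Mt\<^esub> j b) (s' u))) I"
    using * u by (intro balanced_shift FC_balanced) simp_all
  then show "theta_term Y u y (s \<triangleleft>\<^bsub>Sr\<^esub> b) s' = theta_term Y u y s (b \<triangleright>\<^bsub>Sl\<^esub> s')"
    using * u by (simp add: theta_term_def pc_ract Y_ract_mult tens_Y_ract)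
next
  fix s s' assume "s \<in> carrier Sr" "s' \<in> carrier Sl"
  then show "addhom Y (FC Y) (\<lambda>y. theta_term Y u y s s')"
    unfolding theta_term_def by (intro addhom_intros addhom_ract[OF Y]; use u in simp)
next
  fix y s' assume "y \<in> carrier Y" "s' \<in> carrier Sl"
  then show "addhom Sr (FC Y) (\<lambda>s. theta_term Y u y s s')"
    unfolding theta_term_def by (intro addhom_intros addhom_ract_right[OF Y]; use u in simp)
next
  fix y s assume "y \<in> carrier Y" "s \<in> carrier Sr"
  then show "addhom Sl (FC Y) (\<lambda>s'. theta_term Y u y s s')"
    unfolding theta_term_def by (intro addhom_intros addhom_S_app[OF u]; use u in simp)
qed (use u in \<open>simp add: theta_term_def Y_ract_mult\<close>)

lemma theta_addhom:
  assumes "u \<in> carrier M" shows "addhom (tensor_group S Y D) (FC Y) (theta Y u)"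
  using lift_right_addhom[OF Y Sr_bimodule S_sides(3) FC_abelian[OF Y] theta_term_balanced[OF assms]]
  by (simp add: theta_def)

lemma theta_closed [simp]:
  "\<lbrakk>u \<in> carrier M; t \<in> carrier (tensor_group S Y D)\<rbrakk> \<Longrightarrow> theta Y u t \<in> carrier (FC Y)"
  by (rule addhom_closed[OF theta_addhom])

lemma theta_tens [simp]:
  assumes "u \<in> carrier M" "y \<in> carrier Y" "s \<in> carrier S" "s' \<in> carrier S"
  shows "theta Y u (tens S Y D y (pd s s')) = finsum (FC Y)
    (\<lambda>i. tens A (FM Y) C (tens S Y Ms (y \<triangleleft>\<^bsub>Y\<^esub> s) (e i)) (pc (e' i) (s' u))) I"
  using lift_right_tens[OF Y Sr_bimodule S_sides(3) FC_abelian[OF Y] theta_term_balanced[OF assms(1)],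
      of y s s'] assms
  by (simp add: theta_def theta_term_def)

lemma theta_addhom_vector:
  assumes t: "t \<in> carrier (tensor_group S Y D)"
  shows "addhom M (FC Y) (\<lambda>u. theta Y u t)"
proof (rule addhomI)
  show "theta Y u t \<in> carrier (FC Y)" if "u \<in> carrier M" for u
    using that t by simp
  fix u v assume uv: "u \<in> carrier M" "v \<in> carrier M"
  have uv': "u \<oplus>\<^bsub>M\<^esub> v \<in> carrier M" using uv by simp
  show "theta Y (u \<oplus>\<^bsub>M\<^esub> v) t = theta Y u t \<oplus>\<^bsub>FC Y\<^esub> theta Y v t"
    by (rule YD_eqI[OF Y theta_addhom[OF uv'] addhom_sum2[OF _ theta_addhom[OF uv(1)] theta_addhom[OF uv(2)]] t])
      (use uv in \<open>simp_all add: tens_add_right[OF M_sides(4) M_left] tens_add_right[OF FM_right[OF Y] coring_sides(1), simplified] finsum_add_fun\<close>)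
qed

text \<open>Right multiplication in Y \<otimes> D affects only the last factor s', whose product
  with s applied to u is s' applied to s u. This is the relation over \<open>S\<close> between t and
  u that makes \<open>theta_hat\<close> and the coaction of \<open>FF Y\<close> well
  defined.\<close>

lemma theta_ract_S:
  assumes u: "u \<in> carrier M" and s: "s \<in> carrier S" and t: "t \<in> carrier (tensor_group S Y D)"
  shows "theta Y u (t \<triangleleft>\<^bsub>rtensor S Y D\<^esub> s) = theta Y (s u) t"
  by (rule YD_eqI[OF Y addhom_compose[OF theta_addhom[OF u] rtensor_ract_addhom[OF Y D_bimodule s]]
        theta_addhom t]) (use u s in simp_all)

lemma theta_ract_A:
  assumes u: "u \<in> carrier M" and a: "a \<in> carrier A" and t: "t \<in> carrier (tensor_group S Y D)"
  shows "theta Y (u \<triangleleft>\<^bsub>M\<^esub> a) t = theta Y u t \<triangleleft>\<^bsub>rtensor A (FM Y) C\<^esub> a"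
  by (rule YD_eqI[OF Y theta_addhom addhom_compose[OF rtensor_ract_addhom[OF FM_right[OF Y] C_bimodule a]
          theta_addhom[OF u]] t])
    (use u a in \<open>simp_all add: finsum_rtensor_ract[OF FM_right[OF Y] C_bimodule]\<close>)

lemma theta_hat_balanced: "balanced S (rtensor S Y D) Ms (FC Y) (\<lambda>t u. theta Y u t)"
  by (rule balancedI) (simp_all add: theta_addhom theta_addhom_vector theta_ract_S)

lemma theta_hat_addhom: "addhom (tensor_group S (rtensor S Y D) Ms) (FC Y) (theta_hat Y)"
  unfolding theta_hat_def
  by (rule tensor_lift_addhom[OF YS_right[OF Y] Ms_left FC_abelian[OF Y] theta_hat_balanced])

lemma theta_hat_tens [simp]:
  "\<lbrakk>t \<in> carrier (tensor_group S Y D); u \<in> carrier M\<rbrakk>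
    \<Longrightarrow> theta_hat Y (tens S (rtensor S Y D) Ms t u) = theta Y u t"
  unfolding theta_hat_def
  by (subst tensor_lift_tens[OF YS_right[OF Y] Ms_left FC_abelian[OF Y] theta_hat_balanced]) simp_all

lemma theta_hat_linear: "right_linear A (FM (rtensor S Y D)) (rtensor A (FM Y) C) (theta_hat Y)"
proof (rule right_linearI)
  show "addhom (FM (rtensor S Y D)) (rtensor A (FM Y) C) (theta_hat Y)"
    using theta_hat_addhom by simp
  fix q a assume q: "q \<in> carrier (FM (rtensor S Y D))" and a: "a \<in> carrier A"
  show "theta_hat Y (q \<triangleleft>\<^bsub>FM (rtensor S Y D)\<^esub> a) = theta_hat Y q \<triangleleft>\<^bsub>rtensor A (FM Y) C\<^esub> a"
    by (rule tensor_eqI[OF YS_right[OF Y] Ms_left, where t = q,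
        OF addhom_compose[OF theta_hat_addhom rtensor_ract_addhom[OF YS_right[OF Y] Ms_bimodule a]]
          addhom_compose[OF rtensor_ract_addhom[OF FM_right[OF Y] C_bimodule a] theta_hat_addhom]])
      (use q a in \<open>simp_all add: theta_ract_A\<close>)
qed

end

lemma FF_simps [simp]:
  "carrier (FF Y) = carrier (tensor_group S Y Ms)" "add (FF Y) = add (tensor_group S Y Ms)"
  "\<zero>\<^bsub>FF Y\<^esub> = \<zero>\<^bsub>tensor_group S Y Ms\<^esub>" "ract (FF Y) = ract (FM Y)"
  by (simp_all add: tensor_Sigma_fields)

lemma FF_record_simps [simp]:
  "tens A (FF Y) N = tens A (FM Y) N"
  "tensor_group A (FF Y) N = tensor_group A (FM Y) N"
  "rtensor A (FF Y) N = rtensor A (FM Y) N"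
  "addhom (FF Y) Q = addhom (tensor_group S Y Ms) Q"
  "addhom P (FF Y) = addhom P (tensor_group S Y Ms)"
  "tensor_map A (FF Y) N1 M1 N1' f g = tensor_map A (FM Y) N1 M1 N1' f g"
  "tensor_map A M2 N2 (FF Y) N2' f' g' = tensor_map A M2 N2 (FM Y) N2' f' g'"
  "tensor_assoc A T (FF Y) N3 N3' = tensor_assoc A T (FM Y) N3 N3'"
  "tensor_runit (FF Y) = tensor_runit (FM Y)"
  by (intro tens_cong rtensor_cong addhom_record_cong tensor_map_cong_source tensor_map_cong_target
      tensor_assoc_cong tensor_runit_cong; simp)+

lemma FF_coact: "coact (FF Y) = tensor_lift (FC Y) (\<lambda>y u. theta Y u (coact Y y))"
  by (simp add: tensor_Sigma_fields theta_def theta_term_def[abs_def])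

context
  fixes Y
  assumes Y: "comodule S D Y"
begin

lemma Y_right [simp]: "right_module S Y" by (rule comodule_right_module[OF Y])

lemmas coact_Y_closed [simp] = comodule_coact_closed[OF Y]

lemma FF_right: "right_module A (FF Y)"
  by (rule right_module_record_cong[OF FM_right[OF Y_right]]) simp_all

text \<open>Right linearity of the coaction of Y turns y s into rho(y) s, and
  \<open>theta_ract_S\<close> moves s to u.\<close>

lemma FF_coact_balanced: "balanced S Y Ms (FC Y) (\<lambda>y u. theta Y u (coact Y y))"
  by (rule balancedI)
    (simp_all add: theta_addhom_vector theta_ract_S comodule_coact_ract[OF Y]
      addhom_compose[OF theta_addhom comodule_coact_addhom[OF Y]])

lemma FF_coact_addhom: "addhom (tensor_group S Y Ms) (FC Y) (coact (FF Y))"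
  unfolding FF_coact
  by (rule tensor_lift_addhom[OF Y_right Ms_left FC_abelian[OF Y_right] FF_coact_balanced])

lemma FF_coact_tens [simp]:
  "\<lbrakk>y \<in> carrier Y; u \<in> carrier M\<rbrakk> \<Longrightarrow> coact (FF Y) (tens S Y Ms y u) = theta Y u (coact Y y)"
  unfolding FF_coact
  by (subst tensor_lift_tens[OF Y_right Ms_left FC_abelian[OF Y_right] FF_coact_balanced]) simp_all

lemma FF_coact_linear: "right_linear A (FM Y) (rtensor A (FM Y) C) (coact (FF Y))"
proof (rule right_linearI)
  show "addhom (FM Y) (rtensor A (FM Y) C) (coact (FF Y))"
    using FF_coact_addhom by simp
  fix q a assume q: "q \<in> carrier (FM Y)" and a: "a \<in> carrier A"
  show "coact (FF Y) (q \<triangleleft>\<^bsub>FM Y\<^esub> a) = coact (FF Y) q \<triangleleft>\<^bsub>rtensor A (FM Y) C\<^esub> a"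
    by (rule tensor_eqI[OF Y_right Ms_left, where t = q,
        OF addhom_compose[OF FF_coact_addhom rtensor_ract_addhom[OF Y_right Ms_bimodule a]]
          addhom_compose[OF rtensor_ract_addhom[OF FM_right[OF Y_right] C_bimodule a] FF_coact_addhom]])
      (use q a in \<open>simp_all add: theta_ract_A\<close>)
qed

lemma FF_coassoc:
  assumes u: "u \<in> carrier M" and y: "y \<in> carrier Y"
  shows "tensor_assoc A A (FM Y) C C
      (tensor_map A (FM Y) C (rtensor A (FM Y) C) C (coact (FF Y)) (\<lambda>x. x) (theta Y u (coact Y y)))
    = tensor_map A (FM Y) C (FM Y) (btensor A C C) (\<lambda>x. x) (comult C) (theta Y u (coact Y y))"
proof -
  let ?Z = "rtensor S Y D" and ?F = "FM Y"
  note Yr = Y_right and l = coring_sides(1) and Dl = coring_sides(3)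
  have F: "right_module A ?F" and FC: "right_module A (rtensor A ?F C)" and Z: "right_module S ?Z"
    and FZ: "right_module A (FM ?Z)"
    by simp_all
  note th = theta_addhom[OF Yr u] and thZ = theta_addhom[OF Z u]
  note cF = addhom_tensor_map[OF F l FC l FF_coact_linear left_linear_ident]
    and cFt = tensor_map_tens[OF F l FC l FF_coact_linear left_linear_ident]
  note hh = addhom_tensor_map[OF FZ l FC l theta_hat_linear[OF Yr] left_linear_ident]
    and hht = tensor_map_tens[OF FZ l FC l theta_hat_linear[OF Yr] left_linear_ident]
  note cY = addhom_tensor_map[OF Yr Dl Z Dl comodule_coact_linear[OF Y] left_linear_ident]
    and cYt = tensor_map_tens[OF Yr Dl Z Dl comodule_coact_linear[OF Y] left_linear_ident]
  note dY = addhom_tensor_map[OF Yr Dl Yr DD_sides(1) right_linear_ident comult_D_linear(2)]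
    and dYt = tensor_map_tens[OF Yr Dl Yr DD_sides(1) right_linear_ident comult_D_linear(2)]
  note dF = addhom_tensor_map[OF F l F CC_sides(1) right_linear_ident comult_C_linear(2)]
    and dFt = tensor_map_tens[OF F l F CC_sides(1) right_linear_ident comult_C_linear(2)]
  note as = tensor_assoc_addhom[OF F C_bimodule l] and ast = tensor_assoc_tens[OF F C_bimodule l]
  note ai = tensor_assoc_inv_addhom[OF Yr D_bimodule Dl] and ait = tensor_assoc_inv_tens[OF Yr D_bimodule Dl]
  have ab: "abelian_group (FC Y)" "abelian_group (FC ?Z)" "abelian_group (tensor_group A (rtensor A ?F C) C)"
    "abelian_group (tensor_group A ?F (btensor A C C))"
    using F FC FZ by simp_all
  let ?cF = "tensor_map A ?F C (rtensor A ?F C) C (coact (FF Y)) (\<lambda>x. x)"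
  let ?hh = "tensor_map A (FM ?Z) C (rtensor A ?F C) C (theta_hat Y) (\<lambda>x. x)"
  let ?cY = "tensor_map S Y D ?Z D (coact Y) (\<lambda>x. x)"
  let ?dY = "tensor_map S Y D Y (btensor S D D) (\<lambda>x. x) (comult D)"
  let ?dF = "tensor_map A ?F C ?F (btensor A C C) (\<lambda>x. x) (comult C)"
  let ?ai = "tensor_assoc_inv S S Y D D" and ?as = "tensor_assoc A A ?F C C"
  txt \<open>Applying the new coaction twice is \<open>\<Theta>\<close> for \<open>Y \<otimes>\<^sub>S D\<close> after applying the old one twice; on the
    other side the two comultiplications correspond to each other.\<close>
  have step1: "?cF (theta Y u t) = ?hh (theta ?Z u (?cY t))" if "t \<in> carrier (tensor_group S Y D)" for t
    by (rule YD_eqI[OF Yr addhom_compose[OF cF th] addhom_compose[OF hh addhom_compose[OF thZ cY]] that])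
      (use u in \<open>simp_all add: addhom_finsum_nat[OF ab(1,3) cF] addhom_finsum_nat[OF ab(2,3) hh]
        cFt hht cYt comodule_coact_ract[OF Y] Y_ract_closed[OF Z, simplified]\<close>)
  have step2: "?as (?hh (theta ?Z u (?ai (?dY t)))) = ?dF (theta Y u t)"
    if "t \<in> carrier (tensor_group S Y D)" for t
  proof (rule YD_eqI[OF Yr addhom_compose[OF as addhom_compose[OF hh addhom_compose[OF thZ
          addhom_compose[OF ai dY]]]] addhom_compose[OF dF th] that])
    fix y s s' assume *: "y \<in> carrier Y" "s \<in> carrier S" "s' \<in> carrier S"
    \<comment> \<open>Both sides become the double sum of (y s \<otimes> e_k) \<otimes> (e'_k
      \<otimes> e_i) \<otimes> (e'_i \<otimes> s' u), taken in different orders.\<close>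
    show "?as (?hh (theta ?Z u (?ai (?dY (tens S Y D y (pd s s')))))) = ?dF (theta Y u (tens S Y D y (pd s s')))"
      using * u F
      by (simp add: addhom_finsum_nat[OF ab(1,4) dF] addhom_finsum_nat[OF ab(2,3) hh] dYt dFt ait hht ast
          addhom_finsum_nat[OF ab(3,4) as] tens_finsum_left_nat[OF FC l, simplified]
          tens_finsum_right_nat[OF F CC_sides(1), simplified])
        (rule finsum_swap; simp)
  qed
  have cl: "?cY (coact Y y) \<in> carrier (tensor_group S ?Z D)"
    by (rule addhom_closed[OF cY]) (simp add: y)
  \<comment> \<open>Coassociativity of Y in solved form: \<open>theta\<close> for Y \<otimes> D
    expects its argument bracketed as (Y \<otimes> D) \<otimes> D.\<close>
  have "?cY (coact Y y) = ?ai (?dY (coact Y y))"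
    using tensor_assoc_inv_assoc[OF Yr D_bimodule Dl cl] comodule.coact_coassoc[OF Y y] by simp
  then show ?thesis
    using step1[of "coact Y y"] step2[of "coact Y y"] y by simp
qed

text \<open>The counits correspond: contracting the basis inserted by \<open>theta\<close> leaves y
  s \<otimes> s' u, which equals y (s s') \<otimes> u, and s s' is the Sweedler counit of s
  \<otimes> s'. For t = rho(y) the counit axiom of Y finishes the argument.\<close>

lemma FF_counit:
  assumes u: "u \<in> carrier M" and y: "y \<in> carrier Y"
  shows "tensor_runit (FM Y) (tensor_map A (FM Y) C (FM Y) (regular A) (\<lambda>x. x) (counit C) (theta Y u (coact Y y)))
    = tens S Y Ms y u"
proof -
  note Yr = Y_right and l = coring_sides(1) and Dl = coring_sides(3)
  have F: "right_module A (FM Y)" by simp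
  note th = theta_addhom[OF Yr u]
  note eF = addhom_tensor_map[OF F l F A_sides(1) right_linear_ident counit_C_linear(2)]
    and eFt = tensor_map_tens[OF F l F A_sides(1) right_linear_ident counit_C_linear(2)]
  note eY = addhom_tensor_map[OF Yr Dl Yr S_regular_sides(1) right_linear_ident counit_D_linear(2)]
    and eYt = tensor_map_tens[OF Yr Dl Yr S_regular_sides(1) right_linear_ident counit_D_linear(2)]
  have rF: "addhom (tensor_group A (FM Y) (regular A)) (tensor_group S Y Ms) (tensor_runit (FM Y))"
    using tensor_runit_addhom[OF F] by simp
  note rY = tensor_runit_addhom[OF Yr]
  have ab: "abelian_group (FC Y)" "abelian_group (tensor_group A (FM Y) (regular A))"
    "abelian_group (tensor_group S Y Ms)"
    using F by simp_all
  let ?eF = "tensor_map A (FM Y) C (FM Y) (regular A) (\<lambda>x. x) (counit C)"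
  let ?eY = "tensor_map S Y D Y (regular S) (\<lambda>x. x) (counit D)"
  have tu: "addhom Y (tensor_group S Y Ms) (\<lambda>y. tens S Y Ms y u)"
    by (rule addhom_tens_left[OF Yr Ms_left _ addhom_ident]) (simp add: u)
  have "tensor_runit (FM Y) (?eF (theta Y u t)) = tens S Y Ms (tensor_runit Y (?eY t)) u"
    if "t \<in> carrier (tensor_group S Y D)" for t
  proof (rule YD_eqI[OF Yr addhom_compose[OF rF addhom_compose[OF eF th]]
        addhom_compose[OF tu addhom_compose[OF rY eY]] that])
    fix y s s' assume *: "y \<in> carrier Y" "s \<in> carrier S" "s' \<in> carrier S"
    have "tensor_runit (FM Y) (?eF (theta Y u (tens S Y D y (pd s s'))))
        = tens S Y Ms (y \<triangleleft>\<^bsub>Y\<^esub> s) (finsum M (\<lambda>i. e i \<triangleleft>\<^bsub>M\<^esub> e' i (s' u)) I)"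
      using * u F
      by (simp add: addhom_finsum_nat[OF ab(1,2) eF] addhom_finsum_nat[OF ab(2,3) rF] eFt
          tensor_runit_tens[OF F] tens_finsum_right_nat[OF Yr Ms_left, simplified])
    then show "tensor_runit (FM Y) (?eF (theta Y u (tens S Y D y (pd s s'))))
        = tens S Y Ms (tensor_runit Y (?eY (tens S Y D y (pd s s')))) u"
      using * u by (simp add: basis_sum eYt tensor_runit_tens[OF Yr] tens_Y_ract Y_ract_mult)
  qed
  then show ?thesis
    using y u comodule.coact_counit[OF Y y] by simp
qed

lemma comodule_FF: "comodule A C (FF Y)"
proof (intro comodule.intro comodule_axioms.intro FF_right, unfold FF_record_simps)
  have F: "right_module A (FM Y)" by simp
  note l = coring_sides(1)
  note FC = XC_right[OF F]
  show "right_linear A (FF Y) (rtensor A (FM Y) C) (coact (FF Y))"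
    using FF_coact_linear by (simp add: right_linear_def)
  fix m assume m: "m \<in> carrier (FF Y)"
  note cF = addhom_tensor_map[OF F l FC l FF_coact_linear left_linear_ident]
  note dF = addhom_tensor_map[OF F l F CC_sides(1) right_linear_ident comult_C_linear(2)]
  note eF = addhom_tensor_map[OF F l F A_sides(1) right_linear_ident counit_C_linear(2)]
  have rF: "addhom (tensor_group A (FM Y) (regular A)) (tensor_group S Y Ms) (tensor_runit (FM Y))"
    using tensor_runit_addhom[OF F] by simp
  note c = FF_coact_addhom
  show "tensor_assoc A A (FM Y) C C
      (tensor_map A (FM Y) C (rtensor A (FM Y) C) C (coact (FF Y)) (\<lambda>x. x) (coact (FF Y) m))
    = tensor_map A (FM Y) C (FM Y) (btensor A C C) (\<lambda>x. x) (comult C) (coact (FF Y) m)"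
    by (rule tensor_eqI[OF Y_right Ms_left, where t = m,
        OF addhom_compose[OF tensor_assoc_addhom[OF F C_bimodule l] addhom_compose[OF cF c]]
          addhom_compose[OF dF c]]) (use m in \<open>simp_all add: FF_coassoc\<close>)
  show "tensor_runit (FM Y) (tensor_map A (FM Y) C (FM Y) (regular A) (\<lambda>x. x) (counit C) (coact (FF Y) m)) = m"
    by (rule tensor_eqI[OF Y_right Ms_left, where t = m and g = "\<lambda>x. x",
        OF addhom_compose[OF rF addhom_compose[OF eF c]] addhom_ident])
      (use m in \<open>simp_all add: FF_counit\<close>)
qed

end

text \<open>Theta is natural in Y because h touches neither the vector nor the dual basis;
  colinearity of h then makes h \<otimes> Sigma commute with the coactions.\<close>

lemma tensor_Sigma_map_colinear:
  assumes Y: "comodule S D Y" and Y': "comodule S D Y'" and h: "h \<in> colinear_maps S D Y' Y"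
  shows "tensor_Sigma_map A M Y' Y h \<in> colinear_maps A C (FF Y') (FF Y)"
proof (rule colinear_mapsI, unfold tensor_Sigma_map_def FF_record_simps)
  note Yr = Y_right[OF Y] and Yr' = Y_right[OF Y'] and l = coring_sides(1) and Dl = coring_sides(3)
  note hl = colinear_maps_right_linear[OF h]
  note hh = right_linear_addhom[OF hl]
  let ?h = "tensor_map S Y' Ms Y Ms h (\<lambda>u. u)"
  have F: "right_module A (FM Y)" "right_module A (FM Y')" using Yr Yr' by simp_all
  have lin: "right_linear A (FM Y') (FM Y) ?h"
    by (rule right_linear_tensor_map[OF Yr' Ms_bimodule Yr Ms_bimodule hl left_linear_ident right_linear_ident])
  then show "right_linear A (FF Y') (FF Y) ?h" by (simp add: right_linear_def)
  show "?h \<in> extensional (carrier (FF Y'))" using tensor_map_extensional by simp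
  note k = addhom_tensor_map[OF Yr' Ms_left Yr Ms_left hl left_linear_ident]
    and kt = tensor_map_tens[OF Yr' Ms_left Yr Ms_left hl left_linear_ident]
  note kD = addhom_tensor_map[OF Yr' Dl Yr Dl hl left_linear_ident]
    and kDt = tensor_map_tens[OF Yr' Dl Yr Dl hl left_linear_ident]
  note kC = addhom_tensor_map[OF F(2) l F(1) l lin left_linear_ident]
    and kCt = tensor_map_tens[OF F(2) l F(1) l lin left_linear_ident]
  have ab: "abelian_group (FC Y')" "abelian_group (FC Y)" using F by simp_all
  have theta: "theta Y u (tensor_map S Y' D Y D h (\<lambda>x. x) t) = tensor_map A (FM Y') C (FM Y) C ?h (\<lambda>x. x) (theta Y' u t)"
    if u: "u \<in> carrier M" and t: "t \<in> carrier (tensor_group S Y' D)" for u t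
    by (rule YD_eqI[OF Yr' addhom_compose[OF theta_addhom[OF Yr u] kD] addhom_compose[OF kC theta_addhom[OF Yr' u]] t])
      (use u Yr Yr' F in \<open>simp_all add: kDt addhom_closed[OF hh] addhom_finsum_nat[OF ab kC] kCt kt
        Y_ract_closed right_linear_ract[OF hl]\<close>)
  fix m assume m: "m \<in> carrier (FF Y')"
  show "coact (FF Y) (?h m) = tensor_map A (FM Y') C (FM Y) C ?h (\<lambda>x. x) (coact (FF Y') m)"
    by (rule tensor_eqI[OF Yr' Ms_left, where t = m,
        OF addhom_compose[OF FF_coact_addhom[OF Y] k] addhom_compose[OF kC FF_coact_addhom[OF Y']]])
      (use m in \<open>simp_all add: kt FF_coact_tens[OF Y] FF_coact_tens[OF Y'] addhom_closed[OF hh]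
        colinear_maps_coact[OF h] theta comodule_coact_closed[OF Y']\<close>)
qed

end

lemma tensor_Sigma_dual_fields:
  fixes A B M X
  defines "S \<equiv> End_alg A M"
  defines "Sl \<equiv> regular_left (End_canonical M) S" and "Sr \<equiv> regular_right (End_canonical M) S"
  defines "D \<equiv> btensor B Sr Sl" and "C \<equiv> btensor B (dual A M) M"
    and "ZB \<equiv> rtensor A X (dual A M)" and "ZS \<equiv> rtensor A X (End_dual A M)"
    and "E \<equiv> btensor A M (End_dual A M)"
  shows "carrier (tensor_Sigma_dual A B M X) = carrier ZS"
    "add (tensor_Sigma_dual A B M X) = add ZS"
    "\<zero>\<^bsub>tensor_Sigma_dual A B M X\<^esub> = \<zero>\<^bsub>ZS\<^esub>"
    "ract (tensor_Sigma_dual A B M X) = ract ZS"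
    "coact (tensor_Sigma_dual A B M X) = (\<lambda>z.
      tensor_lift (rtensor S ZS D) (\<lambda>z s. tens S ZS D z (tens B Sr Sl \<one>\<^bsub>S\<^esub> s))
        (tensor_map B ZB E ZB Sl (\<lambda>z. z) (xi A M)
          (tensor_lift (rtensor B ZB E) (\<lambda>t v. lift_right (rtensor B ZB E)
              (\<lambda>x \<phi> u. tens B ZB E (tens A X (dual A M) x \<phi>) (tens A M (End_dual A M) u v)) t)
            (tensor_map A X (End_dual A M) (rtensor A X C) (End_dual A M) (coact X) (\<lambda>v. v) z))))"
  unfolding S_def C_def D_def ZB_def ZS_def E_def Sl_def Sr_def
  by (simp_all add: tensor_Sigma_dual_def Let_def rmod.defs comod.defs lift_right_def)

context comatrix_setup
begin

section \<open>The functor to comodules over the Sweedler coring\<close>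

abbreviation "E \<equiv> btensor A M Mt"
abbreviation "ZB X \<equiv> rtensor A X Md"
abbreviation "GM X \<equiv> rtensor A X Mt"
abbreviation "GD X \<equiv> tensor_group S (GM X) D"
abbreviation "XQ X \<equiv> tensor_group B (ZB X) E"
abbreviation "GG X \<equiv> tensor_Sigma_dual A B M X"

lemma GM_right [simp]: "right_module A X \<Longrightarrow> right_module S (GM X)"
  by (rule rtensor_right_module[OF _ Mt_bimodule])

lemma ZB_right [simp]: "right_module A X \<Longrightarrow> right_module B (ZB X)"
  by (rule rtensor_right_module[OF _ Md_bimodule])

lemma E_left [simp]: "left_module B E"
  by (rule btensor_left_module[OF M_bimodule M_sides(1)])

lemma E_lact [simp]:
  "\<lbrakk>u \<in> carrier M; v \<in> carrier Mt; b \<in> carrier B\<rbrakk>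
    \<Longrightarrow> b \<triangleright>\<^bsub>E\<^esub> tens A M Mt u v = tens A M Mt (b \<triangleright>\<^bsub>M\<^esub> u) v"
  by (rule btensor_lact_tens[OF M_bimodule M_sides(1)])

lemma GM_ract [simp]:
  "\<lbrakk>right_module A X; x \<in> carrier X; \<phi> \<in> carrier Mt; s \<in> carrier S\<rbrakk>
    \<Longrightarrow> tens A X Mt x \<phi> \<triangleleft>\<^bsub>GM X\<^esub> s = tens A X Mt x (\<phi> \<triangleleft>\<^bsub>Mt\<^esub> s)"
  by (rule rtensor_ract_tens[OF _ Mt_bimodule])

lemma ZB_ract_tens:
  "\<lbrakk>right_module A X; x \<in> carrier X; \<phi> \<in> carrier Mt; b \<in> carrier B\<rbrakk>
    \<Longrightarrow> tens A X Mt x \<phi> \<triangleleft>\<^bsub>ZB X\<^esub> b = tens A X Mt x (\<phi> \<triangleleft>\<^bsub>Mt\<^esub> j b)"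
  using rtensor_ract_tens[OF _ Md_bimodule, of X x \<phi> b] by (simp add: Md_ract)

text \<open>Needed to pass from the tensor product over \<open>B\<close> to the one over
  \<open>S\<close> when the unit is inserted.\<close>

lemma ZB_ract:
  assumes X: "right_module A X" and z: "z \<in> carrier (tensor_group A X Mt)" and b: "b \<in> carrier B"
  shows "z \<triangleleft>\<^bsub>ZB X\<^esub> b = z \<triangleleft>\<^bsub>GM X\<^esub> j b"
proof (rule tensor_eqI[OF X M_sides(1), where t = z])
  show "addhom (tensor_group A X Mt) (tensor_group A X Mt) (\<lambda>z. z \<triangleleft>\<^bsub>ZB X\<^esub> b)"
    using rtensor_ract_addhom[OF X Md_bimodule b] by simp
  show "addhom (tensor_group A X Mt) (tensor_group A X Mt) (\<lambda>z. z \<triangleleft>\<^bsub>GM X\<^esub> j b)"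
    using rtensor_ract_addhom[OF X Mt_bimodule, of "j b"] b by simp
qed (use X z b in \<open>simp_all add: ZB_ract_tens\<close>)

lemma GM_ract_closed [simp]:
  "\<lbrakk>right_module A X; z \<in> carrier (tensor_group A X Mt); s \<in> carrier S\<rbrakk>
    \<Longrightarrow> z \<triangleleft>\<^bsub>GM X\<^esub> s \<in> carrier (tensor_group A X Mt)"
  using right_module.ract_closed[OF GM_right, of X z s] by simp

lemma addhom_XMd:
  "\<lbrakk>right_module A X; \<phi> \<in> carrier Mt; addhom P X f\<rbrakk>
    \<Longrightarrow> addhom P (tensor_group A X Md) (\<lambda>y. tens A X Mt (f y) \<phi>)"
  "\<lbrakk>right_module A X; x \<in> carrier X; addhom P Mt g\<rbrakk>
    \<Longrightarrow> addhom P (tensor_group A X Md) (\<lambda>y. tens A X Mt x (g y))"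
  using addhom_tens_left[of A X Mt \<phi> P f] addhom_tens_right[of A X Mt x P g] by simp_all

text \<open>The last leg v is held fixed, so that the map is a lift on X \<otimes> C alone;
  \<open>rebracket_outer_balanced\<close> then makes v variable.\<close>

definition rebracket ::
  "('a, 'x, 'xx) rmod_scheme \<Rightarrow> ('m \<Rightarrow> 'a) \<Rightarrow> ('x \<times> (('m \<Rightarrow> 'a) \<times> 'm \<Rightarrow>\<^sub>0 int) set \<Rightarrow>\<^sub>0 int) set
    \<Rightarrow> (('x \<times> ('m \<Rightarrow> 'a) \<Rightarrow>\<^sub>0 int) set \<times> ('m \<times> ('m \<Rightarrow> 'a) \<Rightarrow>\<^sub>0 int) set \<Rightarrow>\<^sub>0 int) set" where
  "rebracket X v = lift_right (tensor_group B (ZB X) E)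
    (\<lambda>x \<phi> u. tens B (ZB X) E (tens A X Mt x \<phi>) (tens A M Mt u v))"

definition map_xi where
  "map_xi X = tensor_map B (ZB X) E (ZB X) Sl (\<lambda>z. z) (xi A M)"

definition insert_one where
  "insert_one X = tensor_lift (GD X) (\<lambda>z s. tens S (GM X) D z (pd \<one>\<^bsub>S\<^esub> s))"

text \<open>With the last leg \<phi> fixed, these are the factors of the coaction that come after
  rho; the argument t stands for rho(x).\<close>

definition omega where
  "omega X \<phi> t = insert_one X (map_xi X (rebracket X \<phi> t))"

text \<open>Analogue of \<open>theta_hat\<close>: \<phi> becomes variable, for use when the coaction
  of \<open>GG X\<close> is applied to a leg x \<otimes> \<psi> inside a value of
  \<open>omega\<close>.\<close>

definition omega_hat where
  "omega_hat X = tensor_lift (GD X) (\<lambda>t \<phi>. omega X \<phi> t)"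

lemma xi_left_linear: "left_linear B E Sl (xi A M)"
  unfolding left_linear_def
proof (intro conjI ballI)
  show "addhom E Sl (xi A M)" using xi_addhom by simp
  fix b t assume b: "b \<in> carrier B" and t: "t \<in> carrier E"
  have "xi A M (b \<triangleright>\<^bsub>E\<^esub> t) = j b \<otimes>\<^bsub>S\<^esub> xi A M t"
    by (rule tensor_eqI[OF M_right M_sides(1), where t = t,
        OF addhom_compose[OF xi_addhom btensor_lact_addhom[OF M_bimodule M_sides(1) b]]
          addhom_S_right[OF _ xi_addhom]]) (use b t in \<open>simp_all add: dyad_mult\<close>)
  then show "xi A M (b \<triangleright>\<^bsub>E\<^esub> t) = b \<triangleright>\<^bsub>Sl\<^esub> xi A M t" by simp
qed

context
  fixes X
  assumes X [simp]: "right_module A X"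
begin

lemma Q_abelian [simp]: "abelian_group (XQ X)" and GD_abelian [simp]: "abelian_group (GD X)"
  by simp_all

lemma rebracket_balanced:
  assumes v: "v \<in> carrier Mt"
  shows "balanced3 A B X Md M (XQ X) (\<lambda>x \<phi> u. tens B (ZB X) E (tens A X Mt x \<phi>) (tens A M Mt u v))"
proof (rule balanced3I)
  fix x \<phi> b u assume *: "x \<in> carrier X" "\<phi> \<in> carrier Md" "b \<in> carrier B" "u \<in> carrier M"
  have "tens B (ZB X) E (tens A X Mt x \<phi> \<triangleleft>\<^bsub>ZB X\<^esub> b) (tens A M Mt u v)
      = tens B (ZB X) E (tens A X Mt x \<phi>) (b \<triangleright>\<^bsub>E\<^esub> tens A M Mt u v)"
    using * v by (intro tens_ract) simp_all
  then show "tens B (ZB X) E (tens A X Mt x (\<phi> \<triangleleft>\<^bsub>Md\<^esub> b)) (tens A M Mt u v)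
      = tens B (ZB X) E (tens A X Mt x \<phi>) (tens A M Mt (b \<triangleright>\<^bsub>M\<^esub> u) v)"
    using * v by (simp add: ZB_ract_tens Md_ract)
next
  fix \<phi> u assume "\<phi> \<in> carrier Md" "u \<in> carrier M"
  then show "addhom X (XQ X) (\<lambda>x. tens B (ZB X) E (tens A X Mt x \<phi>) (tens A M Mt u v))"
    using v by (intro addhom_tens_left addhom_normal addhom_XMd addhom_ident; simp)
next
  fix x u assume "x \<in> carrier X" "u \<in> carrier M"
  then show "addhom Md (XQ X) (\<lambda>\<phi>. tens B (ZB X) E (tens A X Mt x \<phi>) (tens A M Mt u v))"
    using v by (intro addhom_tens_left addhom_normal addhom_XMd addhom_ident; simp)
next
  fix x \<phi> assume "x \<in> carrier X" "\<phi> \<in> carrier Md"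
  then show "addhom M (XQ X) (\<lambda>u. tens B (ZB X) E (tens A X Mt x \<phi>) (tens A M Mt u v))"
    using v by (intro addhom_tens_left addhom_tens_right addhom_normal addhom_ident; simp)
qed (simp add: tens_ract[OF X M_sides(1)])

lemma rebracket_addhom:
  assumes "v \<in> carrier Mt" shows "addhom (tensor_group A X C) (XQ X) (rebracket X v)"
  using lift_right_addhom[OF X Md_bimodule M_left Q_abelian rebracket_balanced[OF assms]]
  by (simp add: rebracket_def)

lemma rebracket_tens [simp]:
  assumes "v \<in> carrier Mt" "x \<in> carrier X" "\<phi> \<in> carrier Mt" "u \<in> carrier M"
  shows "rebracket X v (tens A X C x (pc \<phi> u)) = tens B (ZB X) E (tens A X Mt x \<phi>) (tens A M Mt u v)"
  using lift_right_tens[OF X Md_bimodule M_left Q_abelian rebracket_balanced[OF assms(1)], of x \<phi> u] assms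
  by (simp add: rebracket_def)

lemma rebracket_addhom_dual:
  assumes t: "t \<in> carrier (tensor_group A X C)"
  shows "addhom Mt (XQ X) (\<lambda>v. rebracket X v t)"
proof (rule addhomI)
  show "rebracket X v t \<in> carrier (XQ X)" if "v \<in> carrier Mt" for v
    by (rule addhom_closed[OF rebracket_addhom[OF that] t])
  fix v w assume vw: "v \<in> carrier Mt" "w \<in> carrier Mt"
  have vw': "v \<oplus>\<^bsub>Mt\<^esub> w \<in> carrier Mt" using vw by simp
  show "rebracket X (v \<oplus>\<^bsub>Mt\<^esub> w) t = rebracket X v t \<oplus>\<^bsub>XQ X\<^esub> rebracket X w t"
    by (rule XC_eqI[OF X rebracket_addhom[OF vw'] addhom_sum2[OF Q_abelian rebracket_addhom[OF vw(1)]
            rebracket_addhom[OF vw(2)]] t])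
      (use vw in \<open>simp_all add: tens_add_right[OF M_right M_sides(1)]
        tens_add_right[OF ZB_right[OF X] E_left, simplified]\<close>)
qed

text \<open>The right action on X \<otimes> C reaches u, and u a \<otimes> v = u \<otimes> a v over
  \<open>A\<close>.\<close>

lemma rebracket_ract:
  assumes v: "v \<in> carrier Mt" and a: "a \<in> carrier A" and t: "t \<in> carrier (tensor_group A X C)"
  shows "rebracket X v (t \<triangleleft>\<^bsub>rtensor A X C\<^esub> a) = rebracket X (a \<triangleright>\<^bsub>Mt\<^esub> v) t"
  by (rule XC_eqI[OF X addhom_compose[OF rebracket_addhom[OF v] rtensor_ract_addhom[OF X C_bimodule a]]
        rebracket_addhom t]) (use v a in \<open>simp_all add: tens_ract[OF M_right M_sides(1)]\<close>)

lemma rebracket_outer_balanced: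
  "balanced A (rtensor A X C) Mt (XQ X) (\<lambda>t v. rebracket X v t)"
  by (rule balancedI) (simp_all add: rebracket_addhom rebracket_addhom_dual rebracket_ract)

lemma map_xi_addhom: "addhom (XQ X) (tensor_group B (ZB X) Sl) (map_xi X)"
  unfolding map_xi_def
  by (rule addhom_tensor_map[OF ZB_right[OF X] E_left ZB_right[OF X] S_sides(3) right_linear_ident xi_left_linear])

lemma map_xi_tens [simp]:
  "\<lbrakk>z \<in> carrier (tensor_group A X Mt); t \<in> carrier (tensor_group A M Mt)\<rbrakk>
    \<Longrightarrow> map_xi X (tens B (ZB X) E z t) = tens B (ZB X) Sl z (xi A M t)"
  unfolding map_xi_def
  by (subst tensor_map_tens[OF ZB_right[OF X] E_left ZB_right[OF X] S_sides(3) right_linear_ident xi_left_linear])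
    simp_all

text \<open>The action of b on z is that of \<open>j b\<close>; it crosses the tensor sign over
  \<open>S\<close> and then, inside the Sweedler coring, moves past the unit to s.\<close>

lemma insert_one_balanced:
  "balanced B (ZB X) Sl (GD X) (\<lambda>z s. tens S (GM X) D z (pd \<one>\<^bsub>S\<^esub> s))"
proof (rule balancedI)
  show "addhom (ZB X) (GD X) (\<lambda>z. tens S (GM X) D z (pd \<one>\<^bsub>S\<^esub> s))" if "s \<in> carrier Sl" for s
    using addhom_tens_left[OF GM_right[OF X] coring_sides(3) _ addhom_ident, of "pd \<one>\<^bsub>S\<^esub> s"] that by simp
  show "addhom Sl (GD X) (\<lambda>s. tens S (GM X) D z (pd \<one>\<^bsub>S\<^esub> s))" if "z \<in> carrier (ZB X)" for z
    using that by (intro addhom_tens_right addhom_normal addhom_ident; simp)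
  fix z b s assume *: "z \<in> carrier (ZB X)" "b \<in> carrier B" "s \<in> carrier Sl"
  have "tens S (GM X) D (z \<triangleleft>\<^bsub>GM X\<^esub> j b) (pd \<one>\<^bsub>S\<^esub> s) = tens S (GM X) D z (j b \<triangleright>\<^bsub>D\<^esub> pd \<one>\<^bsub>S\<^esub> s)"
    using * by (intro tens_ract) simp_all
  then show "tens S (GM X) D (z \<triangleleft>\<^bsub>ZB X\<^esub> b) (pd \<one>\<^bsub>S\<^esub> s) = tens S (GM X) D z (pd \<one>\<^bsub>S\<^esub> (b \<triangleright>\<^bsub>Sl\<^esub> s))"
    using * pd_ract[of "\<one>\<^bsub>S\<^esub>" s b] by (simp add: ZB_ract)
qed

lemma insert_one_addhom: "addhom (tensor_group B (ZB X) Sl) (GD X) (insert_one X)"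
  unfolding insert_one_def
  by (rule tensor_lift_addhom[OF ZB_right[OF X] S_sides(3) GD_abelian insert_one_balanced])

lemma insert_one_tens [simp]:
  "\<lbrakk>z \<in> carrier (tensor_group A X Mt); s \<in> carrier S\<rbrakk>
    \<Longrightarrow> insert_one X (tens B (ZB X) Sl z s) = tens S (GM X) D z (pd \<one>\<^bsub>S\<^esub> s)"
  unfolding insert_one_def
  by (subst tensor_lift_tens[OF ZB_right[OF X] S_sides(3) GD_abelian insert_one_balanced]) simp_all

lemma omega_addhom: "\<phi> \<in> carrier Mt \<Longrightarrow> addhom (tensor_group A X C) (GD X) (omega X \<phi>)"
  unfolding omega_def
  by (rule addhom_compose[OF insert_one_addhom addhom_compose[OF map_xi_addhom rebracket_addhom]])

lemma omega_tens [simp]: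
  "\<lbrakk>\<phi> \<in> carrier Mt; x \<in> carrier X; \<psi> \<in> carrier Mt; u \<in> carrier M\<rbrakk>
    \<Longrightarrow> omega X \<phi> (tens A X C x (pc \<psi> u)) = tens S (GM X) D (tens A X Mt x \<psi>) (pd \<one>\<^bsub>S\<^esub> (dyad u \<phi>))"
  by (simp add: omega_def)

lemma omega_addhom_dual:
  "t \<in> carrier (tensor_group A X C) \<Longrightarrow> addhom Mt (GD X) (\<lambda>\<phi>. omega X \<phi> t)"
  unfolding omega_def
  by (rule addhom_compose[OF insert_one_addhom addhom_compose[OF map_xi_addhom rebracket_addhom_dual]])

lemma omega_ract_A:
  "\<lbrakk>\<phi> \<in> carrier Mt; a \<in> carrier A; t \<in> carrier (tensor_group A X C)\<rbrakk>
    \<Longrightarrow> omega X \<phi> (t \<triangleleft>\<^bsub>rtensor A X C\<^esub> a) = omega X (a \<triangleright>\<^bsub>Mt\<^esub> \<phi>) t"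
  by (simp add: omega_def rebracket_ract)

text \<open>Composing \<open>dyad u \<phi>\<close> with s amounts to composing \<phi> with s, and
  the right action on the Sweedler factor is this composition.\<close>

lemma omega_ract_S:
  assumes \<phi>: "\<phi> \<in> carrier Mt" and s: "s \<in> carrier S" and t: "t \<in> carrier (tensor_group A X C)"
  shows "omega X (\<phi> \<triangleleft>\<^bsub>Mt\<^esub> s) t = omega X \<phi> t \<triangleleft>\<^bsub>rtensor S (GM X) D\<^esub> s"
  by (rule XC_eqI[OF X omega_addhom addhom_compose[OF rtensor_ract_addhom[OF GM_right[OF X] D_bimodule s]
          omega_addhom[OF \<phi>]] t])
    (use \<phi> s in \<open>simp_all add: dyad_mult\<close>)

lemma omega_hat_balanced: "balanced A (rtensor A X C) Mt (GD X) (\<lambda>t \<phi>. omega X \<phi> t)"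
  by (rule balancedI) (simp_all add: omega_addhom omega_addhom_dual omega_ract_A)

lemma omega_hat_addhom: "addhom (tensor_group A (rtensor A X C) Mt) (GD X) (omega_hat X)"
  unfolding omega_hat_def
  by (rule tensor_lift_addhom[OF XC_right[OF X] M_sides(1) GD_abelian omega_hat_balanced])

lemma omega_hat_tens [simp]:
  "\<lbrakk>t \<in> carrier (tensor_group A X C); \<phi> \<in> carrier Mt\<rbrakk>
    \<Longrightarrow> omega_hat X (tens A (rtensor A X C) Mt t \<phi>) = omega X \<phi> t"
  unfolding omega_hat_def
  by (subst tensor_lift_tens[OF XC_right[OF X] M_sides(1) GD_abelian omega_hat_balanced]) simp_all

lemma omega_hat_linear: "right_linear S (GM (rtensor A X C)) (rtensor S (GM X) D) (omega_hat X)"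
proof (rule right_linearI)
  show "addhom (GM (rtensor A X C)) (rtensor S (GM X) D) (omega_hat X)"
    using omega_hat_addhom by simp
  fix q s assume q: "q \<in> carrier (GM (rtensor A X C))" and s: "s \<in> carrier S"
  show "omega_hat X (q \<triangleleft>\<^bsub>GM (rtensor A X C)\<^esub> s) = omega_hat X q \<triangleleft>\<^bsub>rtensor S (GM X) D\<^esub> s"
    by (rule tensor_eqI[OF XC_right[OF X] M_sides(1), where t = q,
        OF addhom_compose[OF omega_hat_addhom rtensor_ract_addhom[OF XC_right[OF X] Mt_bimodule s]]
          addhom_compose[OF rtensor_ract_addhom[OF GM_right[OF X] D_bimodule s] omega_hat_addhom]])
      (use q s in \<open>simp_all add: omega_ract_S\<close>)
qed

end

lemma GG_simps [simp]:
  "carrier (GG X) = carrier (tensor_group A X Mt)" "add (GG X) = add (tensor_group A X Mt)"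
  "\<zero>\<^bsub>GG X\<^esub> = \<zero>\<^bsub>tensor_group A X Mt\<^esub>" "ract (GG X) = ract (GM X)"
  by (simp_all add: tensor_Sigma_dual_fields)

lemma GG_record_simps [simp]:
  "tens S (GG X) N = tens S (GM X) N"
  "tensor_group S (GG X) N = tensor_group S (GM X) N"
  "rtensor S (GG X) N = rtensor S (GM X) N"
  "addhom (GG X) Q = addhom (tensor_group A X Mt) Q"
  "addhom P (GG X) = addhom P (tensor_group A X Mt)"
  "tensor_map S (GG X) N1 M1 N1' f g = tensor_map S (GM X) N1 M1 N1' f g"
  "tensor_map S M2 N2 (GG X) N2' f' g' = tensor_map S M2 N2 (GM X) N2' f' g'"
  "tensor_assoc S T (GG X) N3 N3' = tensor_assoc S T (GM X) N3 N3'"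
  "tensor_runit (GG X) = tensor_runit (GM X)"
  by (intro tens_cong rtensor_cong addhom_record_cong tensor_map_cong_source tensor_map_cong_target
      tensor_assoc_cong tensor_runit_cong; simp)+

lemma GG_coact: "coact (GG X) = (\<lambda>z. insert_one X (map_xi X
    (tensor_lift (tensor_group B (ZB X) E) (\<lambda>t v. rebracket X v t)
      (tensor_map A X Mt (rtensor A X C) Mt (coact X) (\<lambda>v. v) z))))"
  by (simp add: tensor_Sigma_dual_fields insert_one_def map_xi_def rebracket_def)

context
  fixes X
  assumes X: "comodule A C X"
begin

lemma X_right [simp]: "right_module A X" by (rule comodule_right_module[OF X])

lemmas coact_X_closed [simp] = comodule_coact_closed[OF X]

lemma GG_right: "right_module S (GG X)"
  by (rule right_module_record_cong[OF GM_right[OF X_right]]) simp_all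

lemma GG_coact_addhom: "addhom (tensor_group A X Mt) (GD X) (coact (GG X))"
proof -
  note Xr = X_right
  note c = addhom_tensor_map[OF Xr M_sides(1) XC_right[OF Xr] M_sides(1) comodule_coact_linear[OF X] left_linear_ident]
  note r = tensor_lift_addhom[OF XC_right[OF Xr] M_sides(1) Q_abelian[OF Xr] rebracket_outer_balanced[OF Xr]]
  show ?thesis unfolding GG_coact
    by (rule addhom_compose[OF insert_one_addhom[OF Xr] addhom_compose[OF map_xi_addhom[OF Xr]
            addhom_compose[OF r c]]])
qed

lemma GG_coact_tens [simp]:
  assumes "x \<in> carrier X" "\<phi> \<in> carrier Mt"
  shows "coact (GG X) (tens A X Mt x \<phi>) = omega X \<phi> (coact X x)"
proof -
  note Xr = X_right
  note c = tensor_map_tens[OF Xr M_sides(1) XC_right[OF Xr] M_sides(1) comodule_coact_linear[OF X] left_linear_ident]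
  note r = tensor_lift_tens[OF XC_right[OF Xr] M_sides(1) Q_abelian[OF Xr] rebracket_outer_balanced[OF Xr]]
  show ?thesis using assms by (simp add: GG_coact c r omega_def)
qed

lemma GG_coact_linear: "right_linear S (GM X) (rtensor S (GM X) D) (coact (GG X))"
proof (rule right_linearI)
  show "addhom (GM X) (rtensor S (GM X) D) (coact (GG X))"
    using GG_coact_addhom by simp
  fix q s assume q: "q \<in> carrier (GM X)" and s: "s \<in> carrier S"
  show "coact (GG X) (q \<triangleleft>\<^bsub>GM X\<^esub> s) = coact (GG X) q \<triangleleft>\<^bsub>rtensor S (GM X) D\<^esub> s"
    by (rule tensor_eqI[OF X_right M_sides(1), where t = q,
        OF addhom_compose[OF GG_coact_addhom rtensor_ract_addhom[OF X_right Mt_bimodule s]]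
          addhom_compose[OF rtensor_ract_addhom[OF GM_right[OF X_right] D_bimodule s] GG_coact_addhom]])
      (use q s in \<open>simp_all add: omega_ract_S\<close>)
qed

text \<open>The comatrix comultiplication inserts the canonical element between \<psi> and u, the
  Sweedler one inserts 1 \<otimes> 1; they agree since xi maps the canonical element to 1. The
  scheme, with arbitrary t and Omega for X \<otimes> C, is that of
  \<open>FF_coassoc\<close>.\<close>

lemma GG_coassoc:
  assumes \<phi>: "\<phi> \<in> carrier Mt" and x: "x \<in> carrier X"
  shows "tensor_assoc S S (GM X) D D
      (tensor_map S (GM X) D (rtensor S (GM X) D) D (coact (GG X)) (\<lambda>x. x) (omega X \<phi> (coact X x)))
    = tensor_map S (GM X) D (GM X) (btensor S D D) (\<lambda>x. x) (comult D) (omega X \<phi> (coact X x))"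
proof -
  let ?Z = "rtensor A X C" and ?G = "GM X"
  note Xr = X_right and l = coring_sides(3) and Cl = coring_sides(1)
  have G: "right_module S ?G" and GD: "right_module S (rtensor S ?G D)" and Z: "right_module A ?Z"
    and GZ: "right_module S (GM ?Z)"
    by simp_all
  note om = omega_addhom[OF Xr \<phi>] and omZ = omega_addhom[OF Z \<phi>]
  note cG = addhom_tensor_map[OF G l GD l GG_coact_linear left_linear_ident]
    and cGt = tensor_map_tens[OF G l GD l GG_coact_linear left_linear_ident]
  note oh = addhom_tensor_map[OF GZ l GD l omega_hat_linear[OF Xr] left_linear_ident]
    and oht = tensor_map_tens[OF GZ l GD l omega_hat_linear[OF Xr] left_linear_ident]
  note cX = addhom_tensor_map[OF Xr Cl Z Cl comodule_coact_linear[OF X] left_linear_ident]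
    and cXt = tensor_map_tens[OF Xr Cl Z Cl comodule_coact_linear[OF X] left_linear_ident]
  note dX = addhom_tensor_map[OF Xr Cl Xr CC_sides(1) right_linear_ident comult_C_linear(2)]
    and dXt = tensor_map_tens[OF Xr Cl Xr CC_sides(1) right_linear_ident comult_C_linear(2)]
  note dG = addhom_tensor_map[OF G l G DD_sides(1) right_linear_ident comult_D_linear(2)]
    and dGt = tensor_map_tens[OF G l G DD_sides(1) right_linear_ident comult_D_linear(2)]
  note as = tensor_assoc_addhom[OF G D_bimodule l] and ast = tensor_assoc_tens[OF G D_bimodule l]
  note ai = tensor_assoc_inv_addhom[OF Xr C_bimodule Cl] and ait = tensor_assoc_inv_tens[OF Xr C_bimodule Cl]
  have ab: "abelian_group (GD X)" "abelian_group (GD ?Z)" "abelian_group (tensor_group S (rtensor S ?G D) D)"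
    "abelian_group (tensor_group S ?G (btensor S D D))" "abelian_group (tensor_group A X (btensor A C C))"
    "abelian_group (tensor_group A ?Z C)"
    using G GD GZ Z by simp_all
  let ?cG = "tensor_map S ?G D (rtensor S ?G D) D (coact (GG X)) (\<lambda>x. x)"
  let ?oh = "tensor_map S (GM ?Z) D (rtensor S ?G D) D (omega_hat X) (\<lambda>x. x)"
  let ?cX = "tensor_map A X C ?Z C (coact X) (\<lambda>x. x)"
  let ?dX = "tensor_map A X C X (btensor A C C) (\<lambda>x. x) (comult C)"
  let ?dG = "tensor_map S ?G D ?G (btensor S D D) (\<lambda>x. x) (comult D)"
  let ?ai = "tensor_assoc_inv A A X C C" and ?as = "tensor_assoc S S ?G D D"
  \<comment> \<open>The coaction of \<open>GG X\<close> on the leg x \<otimes> \<psi> is Omega with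
    last leg \<psi> applied to rho(x), which is the value of \<open>omega_hat\<close> at rho(x)
    \<otimes> \<psi>.\<close>
  have step1: "?cG (omega X \<phi> t) = ?oh (omega ?Z \<phi> (?cX t))" if "t \<in> carrier (tensor_group A X C)" for t
    by (rule XC_eqI[OF Xr addhom_compose[OF cG om] addhom_compose[OF oh addhom_compose[OF omZ cX]] that])
      (use \<phi> Z in \<open>simp_all add: cGt oht cXt\<close>)
  \<comment> \<open>The unit in the middle of the iterated Sweedler comultiplication, written as xi
    of the canonical element.\<close>
  have pd_one: "pd \<one>\<^bsub>S\<^esub> \<one>\<^bsub>S\<^esub> = finsum (tensor_group B Sr Sl) (\<lambda>i. pd \<one>\<^bsub>S\<^esub> (dyad (e i) (e' i))) I"
  proof -
    have "pd \<one>\<^bsub>S\<^esub> (finsum S (\<lambda>i. dyad (e i) (e' i)) I) = finsum (tensor_group B Sr Sl) (\<lambda>i. pd \<one>\<^bsub>S\<^esub> (dyad (e i) (e' i))) I"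
      by (rule addhom_finsum_nat[of S]) (intro addhom_intros | simp)+
    then show ?thesis by (simp add: dyad_sum_one)
  qed
  have step2: "?as (?oh (omega ?Z \<phi> (?ai (?dX t)))) = ?dG (omega X \<phi> t)"
    if "t \<in> carrier (tensor_group A X C)" for t
  proof (rule XC_eqI[OF Xr addhom_compose[OF as addhom_compose[OF oh addhom_compose[OF omZ
          addhom_compose[OF ai dX]]]] addhom_compose[OF dG om] that])
    fix x \<psi> u assume *: "x \<in> carrier X" "\<psi> \<in> carrier Mt" "u \<in> carrier M"
    \<comment> \<open>A single sum appears: Omega contributes no basis index, so only the comatrix
      comultiplication inserts one. It is then pulled into the middle factor, where it adds up to
      the unit.\<close>
    have "?as (?oh (omega ?Z \<phi> (?ai (?dX (tens A X C x (pc \<psi> u))))))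
      = finsum (tensor_group S ?G (btensor S D D)) (\<lambda>i. tens S ?G (btensor S D D) (tens A X Mt x \<psi>)
          (tens S D D (pd \<one>\<^bsub>S\<^esub> (dyad (e i) (e' i))) (pd \<one>\<^bsub>S\<^esub> (dyad u \<phi>)))) I"
      using * \<phi> Z
      by (simp add: addhom_finsum_nat[OF ab(5,6) ai] addhom_finsum_nat[OF ab(2,3) oh] dXt ait oht ast
          addhom_finsum_nat[OF ab(6,2) omZ] addhom_finsum_nat[OF ab(3,4) as]
          tens_finsum_right_nat[OF Xr CC_sides(1), simplified])
    also have "\<dots> = tens S ?G (btensor S D D) (tens A X Mt x \<psi>)
        (tens S D D (finsum (tensor_group B Sr Sl) (\<lambda>i. pd \<one>\<^bsub>S\<^esub> (dyad (e i) (e' i))) I) (pd \<one>\<^bsub>S\<^esub> (dyad u \<phi>)))"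
      using * \<phi>
      by (simp add: tens_finsum_left_nat[OF coring_sides(4) l, simplified]
          tens_finsum_right_nat[OF G DD_sides(1), simplified])
    also have "\<dots> = ?dG (omega X \<phi> (tens A X C x (pc \<psi> u)))"
      using * \<phi> by (simp add: dGt pd_one[symmetric])
    finally show "?as (?oh (omega ?Z \<phi> (?ai (?dX (tens A X C x (pc \<psi> u))))))
      = ?dG (omega X \<phi> (tens A X C x (pc \<psi> u)))" .
  qed
  have cl: "?cX (coact X x) \<in> carrier (tensor_group A ?Z C)"
    by (rule addhom_closed[OF cX]) (simp add: x)
  have "?cX (coact X x) = ?ai (?dX (coact X x))"
    using tensor_assoc_inv_assoc[OF Xr C_bimodule Cl cl] comodule.coact_coassoc[OF X x] by simp
  then show ?thesis
    using step1[of "coact X x"] step2[of "coact X x"] x by simp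
qed

text \<open>Composing \<psi> with the rank-one map of u and \<phi> gives \<psi>(u) \<phi>, so the
  Sweedler counit yields x \<otimes> \<psi>(u) \<phi>. Moving \<psi>(u) across leaves the comatrix
  counit of \<psi> \<otimes> u acting on x.\<close>

lemma GG_counit:
  assumes \<phi>: "\<phi> \<in> carrier Mt" and x: "x \<in> carrier X"
  shows "tensor_runit (GM X) (tensor_map S (GM X) D (GM X) (regular S) (\<lambda>x. x) (counit D) (omega X \<phi> (coact X x)))
    = tens A X Mt x \<phi>"
proof -
  note Xr = X_right and l = coring_sides(3) and Cl = coring_sides(1)
  have G: "right_module S (GM X)" by simp
  note om = omega_addhom[OF Xr \<phi>]
  note eG = addhom_tensor_map[OF G l G S_regular_sides(1) right_linear_ident counit_D_linear(2)]
    and eGt = tensor_map_tens[OF G l G S_regular_sides(1) right_linear_ident counit_D_linear(2)]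
  note eX = addhom_tensor_map[OF Xr Cl Xr A_sides(1) right_linear_ident counit_C_linear(2)]
    and eXt = tensor_map_tens[OF Xr Cl Xr A_sides(1) right_linear_ident counit_C_linear(2)]
  have rG: "addhom (tensor_group S (GM X) (regular S)) (tensor_group A X Mt) (tensor_runit (GM X))"
    using tensor_runit_addhom[OF G] by simp
  note rX = tensor_runit_addhom[OF Xr]
  let ?eG = "tensor_map S (GM X) D (GM X) (regular S) (\<lambda>x. x) (counit D)"
  let ?eX = "tensor_map A X C X (regular A) (\<lambda>x. x) (counit C)"
  have t\<phi>: "addhom X (tensor_group A X Mt) (\<lambda>x. tens A X Mt x \<phi>)"
    by (rule addhom_tens_left[OF Xr M_sides(1) \<phi> addhom_ident])
  have dy: "\<psi> \<triangleleft>\<^bsub>Mt\<^esub> dyad u \<phi> = \<psi> u \<triangleright>\<^bsub>Mt\<^esub> \<phi>" if "\<psi> \<in> carrier Mt" "u \<in> carrier M" for \<psi> u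
    using that \<phi> by (intro Mt_eqI) simp_all
  have "tensor_runit (GM X) (?eG (omega X \<phi> t)) = tens A X Mt (tensor_runit X (?eX t)) \<phi>"
    if "t \<in> carrier (tensor_group A X C)" for t
    by (rule XC_eqI[OF Xr addhom_compose[OF rG addhom_compose[OF eG om]]
        addhom_compose[OF t\<phi> addhom_compose[OF rX eX]] that])
      (use \<phi> in \<open>simp add: eGt eXt tensor_runit_tens[OF G] tensor_runit_tens[OF Xr] dy tens_ract[OF Xr M_sides(1)]\<close>)
  then show ?thesis
    using x \<phi> comodule.coact_counit[OF X x] by simp
qed

lemma comodule_GG: "comodule S D (GG X)"
proof (intro comodule.intro comodule_axioms.intro GG_right, unfold GG_record_simps)
  have G: "right_module S (GM X)" by simp
  note l = coring_sides(3)
  note GD = YS_right[OF G]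
  show "right_linear S (GG X) (rtensor S (GM X) D) (coact (GG X))"
    using GG_coact_linear by (simp add: right_linear_def)
  fix m assume m: "m \<in> carrier (GG X)"
  note cG = addhom_tensor_map[OF G l GD l GG_coact_linear left_linear_ident]
  note dG = addhom_tensor_map[OF G l G DD_sides(1) right_linear_ident comult_D_linear(2)]
  note eG = addhom_tensor_map[OF G l G S_regular_sides(1) right_linear_ident counit_D_linear(2)]
  have rG: "addhom (tensor_group S (GM X) (regular S)) (tensor_group A X Mt) (tensor_runit (GM X))"
    using tensor_runit_addhom[OF G] by simp
  note c = GG_coact_addhom
  show "tensor_assoc S S (GM X) D D
      (tensor_map S (GM X) D (rtensor S (GM X) D) D (coact (GG X)) (\<lambda>x. x) (coact (GG X) m))
    = tensor_map S (GM X) D (GM X) (btensor S D D) (\<lambda>x. x) (comult D) (coact (GG X) m)"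
    by (rule tensor_eqI[OF X_right M_sides(1), where t = m,
        OF addhom_compose[OF tensor_assoc_addhom[OF G D_bimodule l] addhom_compose[OF cG c]]
          addhom_compose[OF dG c]]) (use m in \<open>simp_all add: GG_coassoc\<close>)
  show "tensor_runit (GM X) (tensor_map S (GM X) D (GM X) (regular S) (\<lambda>x. x) (counit D) (coact (GG X) m)) = m"
    by (rule tensor_eqI[OF X_right M_sides(1), where t = m and g = "\<lambda>x. x",
        OF addhom_compose[OF rG addhom_compose[OF eG c]] addhom_ident])
      (use m in \<open>simp_all add: GG_counit\<close>)
qed

end

text \<open>Omega is natural in X since k acts on the leg x alone; colinearity of k does the
  rest.\<close>

lemma tensor_Sigma_dual_map_colinear:
  assumes X: "comodule A C X" and X': "comodule A C X'" and k: "k \<in> colinear_maps A C X X'"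
  shows "tensor_Sigma_dual_map A M X X' k \<in> colinear_maps S D (GG X) (GG X')"
proof (rule colinear_mapsI, unfold tensor_Sigma_dual_map_def GG_record_simps)
  note Xr = X_right[OF X] and Xr' = X_right[OF X'] and l = coring_sides(3) and Cl = coring_sides(1)
  note kl = colinear_maps_right_linear[OF k]
  note kh = right_linear_addhom[OF kl]
  let ?k = "tensor_map A X Mt X' Mt k (\<lambda>v. v)"
  have G: "right_module S (GM X)" "right_module S (GM X')" using Xr Xr' by simp_all
  have lin: "right_linear S (GM X) (GM X') ?k"
    by (rule right_linear_tensor_map[OF Xr Mt_bimodule Xr' Mt_bimodule kl left_linear_ident right_linear_ident])
  then show "right_linear S (GG X) (GG X') ?k" by (simp add: right_linear_def)
  show "?k \<in> extensional (carrier (GG X))" using tensor_map_extensional by simp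
  note h = addhom_tensor_map[OF Xr M_sides(1) Xr' M_sides(1) kl left_linear_ident]
    and ht = tensor_map_tens[OF Xr M_sides(1) Xr' M_sides(1) kl left_linear_ident]
  note kC = addhom_tensor_map[OF Xr Cl Xr' Cl kl left_linear_ident]
    and kCt = tensor_map_tens[OF Xr Cl Xr' Cl kl left_linear_ident]
  note kD = addhom_tensor_map[OF G(1) l G(2) l lin left_linear_ident]
    and kDt = tensor_map_tens[OF G(1) l G(2) l lin left_linear_ident]
  have omega: "omega X' \<phi> (tensor_map A X C X' C k (\<lambda>x. x) t) = tensor_map S (GM X) D (GM X') D ?k (\<lambda>x. x) (omega X \<phi> t)"
    if \<phi>: "\<phi> \<in> carrier Mt" and t: "t \<in> carrier (tensor_group A X C)" for \<phi> t
    by (rule XC_eqI[OF Xr addhom_compose[OF omega_addhom[OF Xr' \<phi>] kC] addhom_compose[OF kD omega_addhom[OF Xr \<phi>]] t])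
      (use \<phi> Xr Xr' G in \<open>simp_all add: kDt addhom_closed[OF kh] kCt ht\<close>)
  fix m assume m: "m \<in> carrier (GG X)"
  show "coact (GG X') (?k m) = tensor_map S (GM X) D (GM X') D ?k (\<lambda>x. x) (coact (GG X) m)"
    by (rule tensor_eqI[OF Xr M_sides(1), where t = m,
        OF addhom_compose[OF GG_coact_addhom[OF X'] h] addhom_compose[OF kD GG_coact_addhom[OF X]]])
      (use m in \<open>simp_all add: ht GG_coact_tens[OF X] GG_coact_tens[OF X'] addhom_closed[OF kh]
        colinear_maps_coact[OF k] omega comodule_coact_closed[OF X]\<close>)
qed


section \<open>The adjunction\<close>

abbreviation "Es \<equiv> btensor A Ms Mt"
abbreviation "C' \<equiv> comatrix A S Ms n e e'"

text \<open>The comatrix coring over \<open>S\<close> that provides \<open>\<epsilon>'\<close> is the instance \<open>B = S\<close>.\<close>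

lemma Ms_setup: "comatrix_setup K A S Ms n e e'"
proof (rule comatrix_setup.intro)
  show "central_bimodule K S A Ms"
    by (rule central_bimoduleI[OF S_algebra A_algebra Ms_bimodule]) simp
  show "dual_basis A Ms n e e'"
    using basis_sum by (simp add: dual_basis_def)
qed simp_all

lemma Es_left [simp]: "left_module S Es"
  by (rule btensor_left_module[OF Ms_bimodule M_sides(1)])

lemma Es_lact [simp]:
  "\<lbrakk>u \<in> carrier M; \<phi> \<in> carrier Mt; s \<in> carrier S\<rbrakk>
    \<Longrightarrow> s \<triangleright>\<^bsub>Es\<^esub> tens A M Mt u \<phi> = tens A M Mt (s u) \<phi>"
  using btensor_lact_tens[OF Ms_bimodule M_sides(1), of u \<phi> s] by simp

text \<open>In the explicit formula the factor r only composes in front of s e_i, which is the left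
  action on the first leg. Left linearity over \<open>S\<close> is what allows this map to be
  tensored with Y.\<close>

lemma xi_inv_left_linear: "left_linear S (regular S) Es (xi_inv A M)"
proof -
  let ?T = "tensor_group A M Mt"
  have "addhom S ?T (\<lambda>s. finsum ?T (\<lambda>i. tens A M Mt (s (e i)) (e' i)) I)"
    by (intro addhom_intros addhom_S_app; simp)
  then have "addhom S ?T (xi_inv A M)"
    using abelian_groupE(1)[OF S_abelian] by (simp add: addhom_def Pi_def xi_inv_eq)
  moreover have "xi_inv A M (r \<otimes>\<^bsub>S\<^esub> s) = r \<triangleright>\<^bsub>Es\<^esub> xi_inv A M s" if "r \<in> carrier S" "s \<in> carrier S" for r s
    using that finsum_btensor_lact[OF Ms_bimodule M_sides(1), of r n "\<lambda>i. tens A M Mt (s (e i)) (e' i)"]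
    by (simp add: xi_inv_eq)
  ultimately show ?thesis
    by (simp add: left_linear_def)
qed

text \<open>The counit of the adjunction at X; \<open>Psi_inv\<close> is its composite with g
  \<otimes> Sigma.\<close>

definition evaluation where
  "evaluation X t = tensor_runit X (tensor_map A X C' X (regular A) (\<lambda>x. x) (counit C') (tensor_assoc A S X Mt Ms t))"

context
  fixes X
  assumes X [simp]: "right_module A X"
begin

lemma X_abelian [simp]: "abelian_group X"
  by (rule right_module_abelian[OF X])

lemma X_ract_closed [simp]: "\<lbrakk>x \<in> carrier X; a \<in> carrier A\<rbrakk> \<Longrightarrow> x \<triangleleft>\<^bsub>X\<^esub> a \<in> carrier X"
  by (rule right_module.ract_closed[OF X])

lemma tens_C' [simp]:
  "tens A X (btensor S Mt Ms) = tens A X C'" "tensor_group A X (btensor S Mt Ms) = tensor_group A X C'"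
  using comatrix_setup.tens_C[OF Ms_setup] by auto

lemmas C'_left = comatrix_setup.coring_sides(1)[OF Ms_setup]

lemma C'_closed [simp]: "\<lbrakk>\<phi> \<in> carrier Mt; u \<in> carrier M\<rbrakk> \<Longrightarrow> tens S Mt Ms \<phi> u \<in> carrier C'"
  by (simp add: comatrix_setup.C_simps(1)[OF Ms_setup])

lemma counit_C'_tens [simp]: "\<lbrakk>\<phi> \<in> carrier Mt; u \<in> carrier M\<rbrakk> \<Longrightarrow> counit C' (tens S Mt Ms \<phi> u) = \<phi> u"
  using comatrix_setup.counit_C_pc[OF Ms_setup, of \<phi> u]
  by (simp flip: comatrix_setup.Md_simps(1)[OF Ms_setup])

lemma evaluation_addhom: "addhom (tensor_group S (GM X) Ms) X (evaluation X)"
proof -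
  have a: "addhom (tensor_group S (GM X) Ms) (tensor_group A X C') (tensor_assoc A S X Mt Ms)"
    using tensor_assoc_addhom[OF X Mt_bimodule Ms_left] by simp
  have m: "addhom (tensor_group A X C') (tensor_group A X (regular A))
      (tensor_map A X C' X (regular A) (\<lambda>x. x) (counit C'))"
    by (rule addhom_tensor_map[OF X C'_left X A_sides(1) right_linear_ident
          comatrix_setup.counit_C_linear(2)[OF Ms_setup]])
  show ?thesis
    unfolding evaluation_def
    by (rule addhom_compose[OF tensor_runit_addhom[OF X] addhom_compose[OF m a]])
qed

lemma evaluation_tens [simp]:
  assumes "x \<in> carrier X" "\<phi> \<in> carrier Mt" "u \<in> carrier M"
  shows "evaluation X (tens S (GM X) Ms (tens A X Mt x \<phi>) u) = x \<triangleleft>\<^bsub>X\<^esub> \<phi> u"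
  using assms tensor_assoc_tens[OF X Mt_bimodule Ms_left, of x \<phi> u]
  by (simp add: evaluation_def tensor_runit_tens[OF X]
      tensor_map_tens[OF X C'_left X A_sides(1) right_linear_ident comatrix_setup.counit_C_linear(2)[OF Ms_setup]])

lemma evaluation_linear: "right_linear A (FM (GM X)) X (evaluation X)"
proof (rule right_linearI)
  show "addhom (FM (GM X)) X (evaluation X)"
    using evaluation_addhom by simp
  fix q a assume q: "q \<in> carrier (FM (GM X))" and a: "a \<in> carrier A"
  show "evaluation X (q \<triangleleft>\<^bsub>FM (GM X)\<^esub> a) = evaluation X q \<triangleleft>\<^bsub>X\<^esub> a"
    by (rule tensor_eqI_left[OF X Mt_bimodule Ms_left, where t = q,
        OF addhom_compose[OF evaluation_addhom rtensor_ract_addhom[OF GM_right[OF X] Ms_bimodule a]]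
          addhom_ract[OF X a evaluation_addhom]])
      (use q a in \<open>simp_all add: right_module.ract_mult[OF X]\<close>)
qed

text \<open>A triangle identity in explicit form: evaluating x \<otimes> \<phi> at e_i gives x
  \<phi>(e_i), and the expansion of \<phi> contracts the sum.\<close>

lemma evaluation_expand:
  assumes z: "z \<in> carrier (tensor_group A X Mt)"
  shows "finsum (tensor_group A X Mt) (\<lambda>i. tens A X Mt (evaluation X (tens S (GM X) Ms z (e i))) (e' i)) I = z"
proof -
  let ?T = "tensor_group A X Mt"
  have ev: "addhom ?T X (\<lambda>z. evaluation X (tens S (GM X) Ms z (e i)))" for i
    using addhom_compose[OF evaluation_addhom addhom_tens_left[OF GM_right[OF X] Ms_left _ addhom_ident, of "e i"]]
    by simp
  have T: "abelian_group ?T" by simp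
  show ?thesis
    by (rule tensor_eqI[OF X M_sides(1), where t = z and g = "\<lambda>z. z",
        OF addhom_finsum_fun[OF T addhom_tens_left[OF X M_sides(1) e'_closed ev]] addhom_ident z])
      (use balanced_expand_right[OF T balanced_tens[OF X M_sides(1)]] in simp)
qed

end

lemma XC_balanced:
  assumes X: "right_module A X" and w: "w \<in> carrier M"
  shows "balanced A X Mt (tensor_group A X C) (\<lambda>x \<psi>. tens A X C x (pc \<psi> w))"
proof (rule balancedI)
  fix x a \<psi> assume *: "x \<in> carrier X" "a \<in> carrier A" "\<psi> \<in> carrier Mt"
  show "tens A X C (x \<triangleleft>\<^bsub>X\<^esub> a) (pc \<psi> w) = tens A X C x (pc (a \<triangleright>\<^bsub>Mt\<^esub> \<psi>) w)"
    using tens_ract[OF X coring_sides(1), of x a "pc \<psi> w"] * w by simp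
qed ((intro addhom_intros; use X w in simp), (intro addhom_intros; use X w in simp))

lemma Psi_app:
  assumes Y: "right_module S Y" and X: "right_module A X" and f: "right_linear A (FM Y) X f"
    and y: "y \<in> carrier Y"
  shows "Psi A M Y X f y
    = finsum (tensor_group A X Mt) (\<lambda>i. tens A X Mt (f (tens S Y Ms y (e i))) (e' i)) I"
proof -
  let ?T = "tensor_group A (FM Y) Mt"
  have F: "right_module A (FM Y)" using Y by simp
  note m = tensor_map_tens[OF Y S_regular_sides(1) Y Es_left right_linear_ident xi_inv_left_linear]
  note ai = tensor_assoc_inv_addhom[OF Y Ms_bimodule M_sides(1)]
    and ait = tensor_assoc_inv_tens[OF Y Ms_bimodule M_sides(1), simplified]
  note mf = addhom_tensor_map[OF F M_sides(1) X M_sides(1) f left_linear_ident]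
    and mft = tensor_map_tens[OF F M_sides(1) X M_sides(1) f left_linear_ident]
  have ab: "abelian_group (tensor_group S Y Es)" "abelian_group ?T" "abelian_group (tensor_group A X Mt)"
    using Y X F by simp_all
  \<comment> \<open>\<open>iota'\<close> places the unit of \<open>S\<close> next to y, and
    \<open>xi_inv\<close> at the unit is the canonical element.\<close>
  have "tensor_assoc_inv S A Y Ms Mt (tensor_map S Y (regular S) Y Es (\<lambda>y. y) (xi_inv A M) (iota' S Y y))
      = finsum ?T (\<lambda>i. tens A (FM Y) Mt (tens S Y Ms y (e i)) (e' i)) I"
    using y by (simp add: iota'_def m xi_inv_eq tens_finsum_right_nat[OF Y Es_left, simplified]
        addhom_finsum_nat[OF ab(1,2) ai] ait)
  then show ?thesis
    using y by (simp add: Psi_def Let_def tensor_Sigma_dual_map_def addhom_finsum_nat[OF ab(2,3) mf] mft)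
qed

lemma Psi_inv_app:
  "t \<in> carrier (tensor_group S Y Ms)
    \<Longrightarrow> Psi_inv A M n e e' Y X g t = evaluation X (tensor_map S Y Ms (GM X) Ms g (\<lambda>u. u) t)"
  by (simp add: Psi_inv_def Let_def evaluation_def tensor_Sigma_map_def)

lemma Psi_inv_tens:
  assumes Y: "right_module S Y" and X: "right_module A X" and g: "right_linear S Y (GM X) g"
    and "y \<in> carrier Y" "u \<in> carrier M"
  shows "Psi_inv A M n e e' Y X g (tens S Y Ms y u) = evaluation X (tens S (GM X) Ms (g y) u)"
  using assms(4,5) tensor_map_tens[OF Y Ms_left GM_right[OF X] Ms_left g left_linear_ident, of y u]
  by (simp add: Psi_inv_app)

lemma Psi_inv_linear:
  assumes Y: "right_module S Y" and X: "right_module A X" and g: "right_linear S Y (GM X) g"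
  shows "right_linear A (FM Y) X (Psi_inv A M n e e' Y X g)"
proof -
  have "right_linear A (FM Y) (FM (GM X)) (tensor_map S Y Ms (GM X) Ms g (\<lambda>u. u))"
    by (rule right_linear_tensor_map[OF Y Ms_bimodule GM_right[OF X] Ms_bimodule g left_linear_ident right_linear_ident])
  with evaluation_linear[OF X] right_module.ract_closed[OF FM_right[OF Y]]
    abelian_groupE(1)[OF right_module_abelian[OF FM_right[OF Y]]]
  show ?thesis
    by (simp add: right_linear_def Pi_def Psi_inv_app)
qed

context
  fixes Y and X
  assumes Y: "comodule S D Y" and X: "comodule A C X"
begin

private lemma Yr [simp]: "right_module S Y" by (rule Y_right[OF Y])
private lemma Xr [simp]: "right_module A X" by (rule X_right[OF X])

lemma FF_colinear_linear: "f \<in> colinear_maps A C (FF Y) X \<Longrightarrow> right_linear A (FM Y) X f"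
  by (drule colinear_maps_right_linear) (simp add: right_linear_def)

lemma GG_colinear_linear: "g \<in> colinear_maps S D Y (GG X) \<Longrightarrow> right_linear S Y (GM X) g"
  by (drule colinear_maps_right_linear) (simp add: right_linear_def)

lemma Psi_linear:
  assumes f: "right_linear A (FM Y) X f"
  shows "right_linear S Y (GM X) (Psi A M Y X f)"
proof (rule right_linearI)
  let ?T = "tensor_group A X Mt"
  have fh: "addhom (tensor_group S Y Ms) X f" using right_linear_addhom[OF f] by simp
  have fc: "f t \<in> carrier X" if "t \<in> carrier (tensor_group S Y Ms)" for t
    by (rule addhom_closed[OF fh that])
  have "addhom Y ?T (\<lambda>y. finsum ?T (\<lambda>i. tens A X Mt (f (tens S Y Ms y (e i))) (e' i)) I)"
    by (intro addhom_finsum_fun addhom_tens_left addhom_compose[OF fh] addhom_ident; simp)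
  then show "addhom Y (GM X) (Psi A M Y X f)"
    using abelian_groupE(1)[OF right_module_abelian[OF Yr]]
    by (simp add: addhom_def Pi_def Psi_app[OF Yr Xr f])
  fix y s assume y: "y \<in> carrier Y" and s: "s \<in> carrier S"
  \<comment> \<open>Right \<open>A\<close>-linearity of f lets a coefficient leave f and cross the
    tensor sign, which is the relation that the shift identity requires.\<close>
  have bal: "balanced A M Mt ?T (\<lambda>v \<psi>. tens A X Mt (f (tens S Y Ms y v)) \<psi>)"
  proof (rule balancedI)
    fix v a \<psi> assume *: "v \<in> carrier M" "a \<in> carrier A" "\<psi> \<in> carrier Mt"
    show "tens A X Mt (f (tens S Y Ms y (v \<triangleleft>\<^bsub>M\<^esub> a))) \<psi> = tens A X Mt (f (tens S Y Ms y v)) (a \<triangleright>\<^bsub>Mt\<^esub> \<psi>)"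
      using * y right_linear_ract[OF f, of "tens S Y Ms y v" a]
      by (simp add: fc tens_ract[OF Xr M_sides(1)])
  next
    show "addhom M ?T (\<lambda>v. tens A X Mt (f (tens S Y Ms y v)) \<psi>)" if "\<psi> \<in> carrier Mt" for \<psi>
      using that y by (intro addhom_tens_left addhom_compose[OF fh] addhom_tens_right addhom_normal addhom_ident; simp)
    show "addhom Mt ?T (\<lambda>\<psi>. tens A X Mt (f (tens S Y Ms y v)) \<psi>)" if "v \<in> carrier M" for v
      using that y fc by (intro addhom_tens_right addhom_ident; simp)
  qed
  have ys: "y \<triangleleft>\<^bsub>Y\<^esub> s \<in> carrier Y" using y s by (simp add: Y_ract_closed)
  have "Psi A M Y X f (y \<triangleleft>\<^bsub>Y\<^esub> s) = finsum ?T (\<lambda>i. tens A X Mt (f (tens S Y Ms y (s (e i)))) (e' i)) I"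
    using y s ys by (simp add: Psi_app[OF Yr Xr f] tens_Y_ract)
  also have "\<dots> = finsum ?T (\<lambda>i. tens A X Mt (f (tens S Y Ms y (e i))) (e' i \<triangleleft>\<^bsub>Mt\<^esub> s)) I"
    by (rule balanced_shift[OF _ bal s]) simp
  also have "\<dots> = Psi A M Y X f y \<triangleleft>\<^bsub>GM X\<^esub> s"
    using y s by (simp add: Psi_app[OF Yr Xr f] finsum_rtensor_ract[OF Xr Mt_bimodule] fc)
  finally show "Psi A M Y X f (y \<triangleleft>\<^bsub>Y\<^esub> s) = Psi A M Y X f y \<triangleleft>\<^bsub>GM X\<^esub> s" .
qed

text \<open>By colinearity of f, Omega applied to the coaction of f(y \<otimes> e_i) is Omega
  applied to f \<otimes> C of Theta of rho(y). The claim thus becomes an equation in rho(y), which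
  \<open>key\<close> proves for every t.\<close>

lemma Psi_colinear:
  assumes f: "f \<in> colinear_maps A C (FF Y) X"
  shows "Psi A M Y X f \<in> colinear_maps S D Y (GG X)"
proof (rule colinear_mapsI, unfold GG_record_simps)
  note fl = FF_colinear_linear[OF f]
  note P = Psi_linear[OF fl] and Pa = Psi_app[OF Yr Xr fl]
  note Ph = right_linear_addhom[OF P]
  show "Psi A M Y X f \<in> extensional (carrier Y)" by (simp add: Psi_def)
  show "right_linear S Y (GG X) (Psi A M Y X f)" using P by (simp add: right_linear_def)
  have fh: "addhom (tensor_group S Y Ms) X f" using right_linear_addhom[OF fl] by simp
  have fc: "f t \<in> carrier X" if "t \<in> carrier (tensor_group S Y Ms)" for t
    by (rule addhom_closed[OF fh that])
  have F: "right_module A (FM Y)" and G: "right_module S (GM X)" by simp_all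
  note Cl = coring_sides(1) and Dl = coring_sides(3)
  note mC = addhom_tensor_map[OF F Cl Xr Cl fl left_linear_ident]
    and mCt = tensor_map_tens[OF F Cl Xr Cl fl left_linear_ident]
  note mD = addhom_tensor_map[OF Yr Dl G Dl P left_linear_ident]
    and mDt = tensor_map_tens[OF Yr Dl G Dl P left_linear_ident]
  have ab: "abelian_group (FC Y)" "abelian_group (tensor_group A X C)" "abelian_group (GD X)"
    "abelian_group (tensor_group A X Mt)"
    using F G by simp_all
  let ?mC = "tensor_map A (FM Y) C X C f (\<lambda>x. x)"
  let ?mD = "tensor_map S Y D (GM X) D (Psi A M Y X f) (\<lambda>x. x)"
  have key: "finsum (GD X) (\<lambda>i. omega X (e' i) (?mC (theta Y (e i) t))) I = ?mD t"
    if "t \<in> carrier (tensor_group S Y D)" for t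
  proof (rule YD_eqI[OF Yr _ mD that])
    show "addhom (tensor_group S Y D) (GD X) (\<lambda>t. finsum (GD X) (\<lambda>i. omega X (e' i) (?mC (theta Y (e i) t))) I)"
      by (rule addhom_finsum_fun[OF ab(3)],
          rule addhom_compose[OF omega_addhom[OF Xr e'_closed]
            addhom_compose[OF mC theta_addhom[OF Yr e_closed]]])
    fix y s s' assume *: "y \<in> carrier Y" "s \<in> carrier S" "s' \<in> carrier S"
    have ys: "y \<triangleleft>\<^bsub>Y\<^esub> s \<in> carrier Y" using * by (simp add: Y_ract_closed)
    let ?x = "\<lambda>k. f (tens S Y Ms (y \<triangleleft>\<^bsub>Y\<^esub> s) (e k))"
    let ?g = "\<lambda>k i. tens S (GM X) D (tens A X Mt (?x k) (e' k)) (pd \<one>\<^bsub>S\<^esub> (dyad (s' (e i)) (e' i)))"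
    have x: "?x k \<in> carrier X" for k using ys by (simp add: fc)
    have pd_sum: "pd \<one>\<^bsub>S\<^esub> s' = finsum (tensor_group B Sr Sl) (\<lambda>i. pd \<one>\<^bsub>S\<^esub> (dyad (s' (e i)) (e' i))) I"
    proof -
      have "pd \<one>\<^bsub>S\<^esub> (finsum S (\<lambda>i. dyad (s' (e i)) (e' i)) I)
          = finsum (tensor_group B Sr Sl) (\<lambda>i. pd \<one>\<^bsub>S\<^esub> (dyad (s' (e i)) (e' i))) I"
        by (rule addhom_finsum_nat[of S]) (intro addhom_intros | simp add: *)+
      then show ?thesis using * by (simp add: dyad_sum)
    qed
    \<comment> \<open>The index k belongs to the basis inserted by \<open>theta\<close>, the index i
      to the one inserted by \<open>Psi\<close>. The sum over k rebuilds \<open>Psi\<close> of f at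
      y s, the sum over i rebuilds s' from rank-one maps.\<close>
    have "finsum (GD X) (\<lambda>i. omega X (e' i) (?mC (theta Y (e i) (tens S Y D y (pd s s'))))) I
        = finsum (GD X) (\<lambda>i. finsum (GD X) (\<lambda>k. ?g k i) I) I"
      using * ys x
      by (simp add: addhom_finsum_nat[OF ab(1,2) mC] mCt
          addhom_finsum_nat[OF ab(2,3) omega_addhom[OF Xr e'_closed]])
    also have "\<dots> = tens S (GM X) D (Psi A M Y X f (y \<triangleleft>\<^bsub>Y\<^esub> s)) (pd \<one>\<^bsub>S\<^esub> s')"
      using * ys x unfolding pd_sum
      by (simp add: Pa tens_finsum_left_nat[OF G Dl, simplified] tens_finsum_right_nat[OF G Dl, simplified])
    \<comment> \<open>Right \<open>S\<close>-linearity of \<open>Psi\<close> of f releases s, which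
      crosses to the Sweedler factor.\<close>
    also have "\<dots> = tens S (GM X) D (Psi A M Y X f y) (s \<triangleright>\<^bsub>D\<^esub> pd \<one>\<^bsub>S\<^esub> s')"
      using * addhom_closed[OF Ph, of y] by (simp add: right_linear_ract[OF P] tens_ract[OF G Dl] del: D_lact)
    also have "\<dots> = ?mD (tens S Y D y (pd s s'))"
      using * by (simp add: mDt)
    finally show "finsum (GD X) (\<lambda>i. omega X (e' i) (?mC (theta Y (e i) (tens S Y D y (pd s s'))))) I
        = ?mD (tens S Y D y (pd s s'))" .
  qed
  fix y assume y: "y \<in> carrier Y"
  have "coact (GG X) (Psi A M Y X f y) = finsum (GD X) (\<lambda>i. omega X (e' i) (coact X (f (tens S Y Ms y (e i))))) I"
    using y by (simp add: Pa addhom_finsum_nat[OF ab(4,3) GG_coact_addhom[OF X]] fc GG_coact_tens[OF X])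
  also have "\<dots> = finsum (GD X) (\<lambda>i. omega X (e' i) (?mC (theta Y (e i) (coact Y y)))) I"
    using y colinear_maps_coact[OF f] by (simp add: FF_coact_tens[OF Y])
  also have "\<dots> = ?mD (coact Y y)"
    using y by (intro key comodule_coact_closed[OF Y])
  finally show "coact (GG X) (Psi A M Y X f y) = ?mD (coact Y y)" .
qed

text \<open>The core is colinearity of \<open>evaluation\<close>, which is \<open>step3\<close>. The
  reduction to it is \<open>step1\<close>: \<open>Psi_inv\<close> is evaluation after g \<otimes>
  Sigma, and Theta is natural.\<close>

lemma Psi_inv_colinear:
  assumes g: "g \<in> colinear_maps S D Y (GG X)"
  shows "Psi_inv A M n e e' Y X g \<in> colinear_maps A C (FF Y) X"
proof (rule colinear_mapsI, unfold FF_record_simps)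
  note gl = GG_colinear_linear[OF g]
  note P = Psi_inv_linear[OF Yr Xr gl] and Pt = Psi_inv_tens[OF Yr Xr gl]
  have gc: "g y \<in> carrier (tensor_group A X Mt)" if "y \<in> carrier Y" for y
    using addhom_closed[OF right_linear_addhom[OF gl] that] by simp
  show "Psi_inv A M n e e' Y X g \<in> extensional (carrier (FF Y))"
    by (simp add: Psi_inv_def Let_def)
  show "right_linear A (FF Y) X (Psi_inv A M n e e' Y X g)" using P by (simp add: right_linear_def)
  have F: "right_module A (FM Y)" and G: "right_module S (GM X)" and FG: "right_module A (FM (GM X))"
    by simp_all
  note Cl = coring_sides(1) and Dl = coring_sides(3)
  note mC = addhom_tensor_map[OF F Cl Xr Cl P left_linear_ident]
    and mCt = tensor_map_tens[OF F Cl Xr Cl P left_linear_ident]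
  note mD = addhom_tensor_map[OF Yr Dl G Dl gl left_linear_ident]
    and mDt = tensor_map_tens[OF Yr Dl G Dl gl left_linear_ident]
  note ev = addhom_tensor_map[OF FG Cl Xr Cl evaluation_linear[OF Xr] left_linear_ident]
    and evt = tensor_map_tens[OF FG Cl Xr Cl evaluation_linear[OF Xr] left_linear_ident]
  have ab: "abelian_group (FC Y)" "abelian_group (tensor_group A X C)" "abelian_group (FC (GM X))"
    using F G FG by simp_all
  let ?mC = "tensor_map A (FM Y) C X C (Psi_inv A M n e e' Y X g) (\<lambda>x. x)"
  let ?mD = "tensor_map S Y D (GM X) D g (\<lambda>x. x)"
  let ?ev = "tensor_map A (FM (GM X)) C X C (evaluation X) (\<lambda>x. x)"
  have step1: "?mC (theta Y u t) = ?ev (theta (GM X) u (?mD t))"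
    if u: "u \<in> carrier M" and t: "t \<in> carrier (tensor_group S Y D)" for u t
    by (rule YD_eqI[OF Yr addhom_compose[OF mC theta_addhom[OF Yr u]]
          addhom_compose[OF ev addhom_compose[OF theta_addhom[OF G u] mD]] t])
      (use u in \<open>simp add: addhom_finsum_nat[OF ab(1,2) mC] addhom_finsum_nat[OF ab(3,2) ev] mCt mDt evt
        gc Pt Y_ract_closed right_linear_ract[OF gl]\<close>)
  \<comment> \<open>For t = x \<otimes> (\<psi> \<otimes> w), Omega stores \<phi> in the rank-one
    map of w and \<phi>, Theta applies that map to u and obtains w \<phi>(u), and evaluation
    contracts the inserted basis back to \<psi>.\<close>
  have step2: "?ev (theta (GM X) u (omega X \<phi> t)) = t \<triangleleft>\<^bsub>rtensor A X C\<^esub> \<phi> u"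
    if u: "u \<in> carrier M" and \<phi>: "\<phi> \<in> carrier Mt" and t: "t \<in> carrier (tensor_group A X C)" for u \<phi> t
    by (rule XC_eqI[OF Xr addhom_compose[OF ev addhom_compose[OF theta_addhom[OF G u] omega_addhom[OF Xr \<phi>]]]
          rtensor_ract_addhom[OF Xr C_bimodule Mt_app_closed[OF \<phi> u]] t])
      (use u \<phi> in \<open>simp add: addhom_finsum_nat[OF ab(3,2) ev] evt right_module.ract_one[OF G]
        balanced_expand_right[OF ab(2) XC_balanced[OF Xr]]\<close>)
  \<comment> \<open>Tested on z = x \<otimes> \<phi>, the left side is the coaction of x \<phi>(u),
    which by right linearity is rho(x) \<phi>(u); \<open>step2\<close> gives the same for the right
    side.\<close>
  have step3: "coact X (evaluation X (tens S (GM X) Ms z u)) = ?ev (theta (GM X) u (coact (GG X) z))"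
    if u: "u \<in> carrier M" and z: "z \<in> carrier (tensor_group A X Mt)" for u z
  proof (rule tensor_eqI[OF Xr M_sides(1), where t = z])
    show "addhom (tensor_group A X Mt) (tensor_group A X C) (\<lambda>z. coact X (evaluation X (tens S (GM X) Ms z u)))"
      using addhom_compose[OF comodule_coact_addhom[OF X] addhom_compose[OF evaluation_addhom[OF Xr]
          addhom_tens_left[OF G Ms_left _ addhom_ident, of u]]] u by simp
    show "addhom (tensor_group A X Mt) (tensor_group A X C) (\<lambda>z. ?ev (theta (GM X) u (coact (GG X) z)))"
      by (rule addhom_compose[OF ev addhom_compose[OF theta_addhom[OF G u] GG_coact_addhom[OF X]]])
  qed (use u z in \<open>simp_all add: comodule_coact_ract[OF X] GG_coact_tens[OF X] step2 comodule_coact_closed[OF X]\<close>)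
  fix m assume m: "m \<in> carrier (FF Y)"
  have Ph: "addhom (tensor_group S Y Ms) X (Psi_inv A M n e e' Y X g)"
    using right_linear_addhom[OF P] by simp
  show "coact X (Psi_inv A M n e e' Y X g m) = ?mC (coact (FF Y) m)"
    by (rule tensor_eqI[OF Yr Ms_left, where t = m,
        OF addhom_compose[OF comodule_coact_addhom[OF X] Ph] addhom_compose[OF mC FF_coact_addhom[OF Y]]])
      (use m in \<open>simp_all add: FF_coact_tens[OF Y] Pt step1 step3 gc comodule_coact_closed[OF Y]
        colinear_maps_coact[OF g]\<close>)
qed

lemma Psi_Psi_inv:
  assumes g: "g \<in> colinear_maps S D Y (GG X)"
  shows "Psi A M Y X (Psi_inv A M n e e' Y X g) = g"
proof (rule extensionalityI[of _ "carrier Y"])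
  note gl = GG_colinear_linear[OF g]
  show "Psi A M Y X (Psi_inv A M n e e' Y X g) \<in> extensional (carrier Y)" by (simp add: Psi_def)
  show "g \<in> extensional (carrier Y)" by (rule colinear_maps_extensional[OF g])
  fix y assume y: "y \<in> carrier Y"
  then have "g y \<in> carrier (tensor_group A X Mt)"
    using addhom_closed[OF right_linear_addhom[OF gl]] by simp
  then show "Psi A M Y X (Psi_inv A M n e e' Y X g) y = g y"
    using y by (simp add: Psi_app[OF Yr Xr Psi_inv_linear[OF Yr Xr gl]] Psi_inv_tens[OF Yr Xr gl]
        evaluation_expand[OF Xr])
qed

text \<open>Evaluation turns e'_i into the coefficient e'_i(u); linearity of f over \<open>A\<close>
  takes it inside, where the basis expansion of u collects the sum.\<close>

lemma Psi_inv_Psi: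
  assumes f: "f \<in> colinear_maps A C (FF Y) X"
  shows "Psi_inv A M n e e' Y X (Psi A M Y X f) = f"
proof (rule extensionalityI[of _ "carrier (tensor_group S Y Ms)"])
  note fl = FF_colinear_linear[OF f]
  note P = Psi_linear[OF fl]
  note inv = Psi_inv_linear[OF Yr Xr P]
  show "Psi_inv A M n e e' Y X (Psi A M Y X f) \<in> extensional (carrier (tensor_group S Y Ms))"
    by (simp add: Psi_inv_def Let_def)
  show "f \<in> extensional (carrier (tensor_group S Y Ms))" using colinear_maps_extensional[OF f] by simp
  have fh: "addhom (tensor_group S Y Ms) X f" using right_linear_addhom[OF fl] by simp
  have ih: "addhom (tensor_group S Y Ms) X (Psi_inv A M n e e' Y X (Psi A M Y X f))"
    using right_linear_addhom[OF inv] by simp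
  have ab: "abelian_group (tensor_group S (GM X) Ms)" "abelian_group X" "abelian_group (tensor_group S Y Ms)"
    using X_abelian[OF Xr] by simp_all
  fix t assume t: "t \<in> carrier (tensor_group S Y Ms)"
  show "Psi_inv A M n e e' Y X (Psi A M Y X f) t = f t"
  proof (rule tensor_eqI[OF Yr Ms_left, where t = t, OF ih fh t])
    fix y u assume y: "y \<in> carrier Y" and u: "u \<in> carrier Ms"
    have fc: "f (tens S Y Ms y v) \<in> carrier X" if "v \<in> carrier M" for v
      using that y by (intro addhom_closed[OF fh]) simp
    have fr: "f (tens S Y Ms y v) \<triangleleft>\<^bsub>X\<^esub> a = f (tens S Y Ms y (v \<triangleleft>\<^bsub>M\<^esub> a))"
      if "v \<in> carrier M" "a \<in> carrier A" for v a
      using that y right_linear_ract[OF fl, of "tens S Y Ms y v" a] by simp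
    have "Psi_inv A M n e e' Y X (Psi A M Y X f) (tens S Y Ms y u)
        = finsum X (\<lambda>i. f (tens S Y Ms y (e i \<triangleleft>\<^bsub>M\<^esub> e' i u))) I"
      using y u
      by (simp add: Psi_inv_tens[OF Yr Xr P] Psi_app[OF Yr Xr fl] fc fr
          tens_finsum_left_nat[OF GM_right[OF Xr] Ms_left, simplified]
          addhom_finsum_nat[OF ab(1,2) evaluation_addhom[OF Xr]] evaluation_tens[OF Xr])
    also have "\<dots> = f (tens S Y Ms y (finsum M (\<lambda>i. e i \<triangleleft>\<^bsub>M\<^esub> e' i u) I))"
      using y u by (simp add: tens_finsum_right_nat[OF Yr Ms_left, simplified] addhom_finsum_nat[OF ab(3,2) fh])
    finally show "Psi_inv A M n e e' Y X (Psi A M Y X f) (tens S Y Ms y u) = f (tens S Y Ms y u)"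
      using u by (simp add: basis_sum)
  qed
qed

lemma Psi_linear_iso: "linear_iso K (Hom_comod A C (FF Y) X) (Hom_comod S D Y (GG X)) (Psi A M Y X)"
proof -
  let ?T = "tensor_group A X Mt"
  note FF = comodule_FF[OF Y] and GG = comodule_GG[OF X]
  interpret VP: comodule_pair K A C "FF Y" X
    by (rule comodule_pair.intro[OF C_central FF X])
  have V: "module K (Hom_comod A C (FF Y) X)" "module K (Hom_comod S D Y (GG X))"
    by (rule module_Hom_comod[OF C_central FF X], rule module_Hom_comod[OF D_central Y GG])
  have bij: "bij_betw (Psi A M Y X) (colinear_maps A C (FF Y) X) (colinear_maps S D Y (GG X))"
    by (rule bij_betw_byWitness[where f' = "Psi_inv A M n e e' Y X"])
      (auto simp: Psi_inv_Psi Psi_Psi_inv Psi_colinear Psi_inv_colinear)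
  have fc: "f (tens S Y Ms y u) \<in> carrier X"
    if "f \<in> colinear_maps A C (FF Y) X" "y \<in> carrier Y" "u \<in> carrier M" for f y u
    using that addhom_closed[OF right_linear_addhom[OF FF_colinear_linear[OF that(1)]], of "tens S Y Ms y u"]
    by simp
  have T: "abelian_group ?T" by simp
  have add: "Psi A M Y X (\<lambda>t\<in>carrier (FF Y). f t \<oplus>\<^bsub>X\<^esub> g t)
      = (\<lambda>y\<in>carrier Y. Psi A M Y X f y \<oplus>\<^bsub>GG X\<^esub> Psi A M Y X g y)"
    if f: "f \<in> colinear_maps A C (FF Y) X" and g: "g \<in> colinear_maps A C (FF Y) X" for f g
  proof (rule extensionalityI[of _ "carrier Y"])
    fix y assume y: "y \<in> carrier Y"
    show "Psi A M Y X (\<lambda>t\<in>carrier (FF Y). f t \<oplus>\<^bsub>X\<^esub> g t) y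
        = (\<lambda>y\<in>carrier Y. Psi A M Y X f y \<oplus>\<^bsub>GG X\<^esub> Psi A M Y X g y) y"
      using y fc[OF f y] fc[OF g y]
      by (simp add: Psi_app[OF Yr Xr FF_colinear_linear[OF VP.add_colinear[OF f g]], simplified]
          Psi_app[OF Yr Xr FF_colinear_linear[OF f]] Psi_app[OF Yr Xr FF_colinear_linear[OF g]]
          tens_add_left[OF Xr M_sides(1)] finsum_add_fun[OF T])
  qed (simp_all add: Psi_def)
  have smult: "Psi A M Y X (\<lambda>t\<in>carrier (FF Y). f t \<triangleleft>\<^bsub>X\<^esub> (k \<odot>\<^bsub>A\<^esub> \<one>\<^bsub>A\<^esub>))
      = (\<lambda>y\<in>carrier Y. Psi A M Y X f y \<triangleleft>\<^bsub>GG X\<^esub> (k \<odot>\<^bsub>S\<^esub> \<one>\<^bsub>S\<^esub>))"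
    if f: "f \<in> colinear_maps A C (FF Y) X" and k: "k \<in> carrier K" for f k
  proof (rule extensionalityI[of _ "carrier Y"])
    fix y assume y: "y \<in> carrier Y"
    \<comment> \<open>Scalars of \<open>K\<close> act through \<open>A\<close> on the source
      Hom-module and through \<open>S\<close> on the target; on linear forms the two actions agree
      pointwise.\<close>
    have sw: "(k \<odot>\<^bsub>A\<^esub> \<one>\<^bsub>A\<^esub>) \<triangleright>\<^bsub>Mt\<^esub> \<phi> = \<phi> \<triangleleft>\<^bsub>Mt\<^esub> (k \<odot>\<^bsub>S\<^esub> \<one>\<^bsub>S\<^esub>)" if "\<phi> \<in> carrier Mt" for \<phi>
      using that k by (intro Mt_eqI) (simp_all add: A_central)
    have cl: "k \<odot>\<^bsub>A\<^esub> \<one>\<^bsub>A\<^esub> \<in> carrier A" "k \<odot>\<^bsub>S\<^esub> \<one>\<^bsub>S\<^esub> \<in> carrier S" using k by simp_all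
    show "Psi A M Y X (\<lambda>t\<in>carrier (FF Y). f t \<triangleleft>\<^bsub>X\<^esub> (k \<odot>\<^bsub>A\<^esub> \<one>\<^bsub>A\<^esub>)) y
        = (\<lambda>y\<in>carrier Y. Psi A M Y X f y \<triangleleft>\<^bsub>GG X\<^esub> (k \<odot>\<^bsub>S\<^esub> \<one>\<^bsub>S\<^esub>)) y"
      using y fc[OF f y] cl
      by (simp add: Psi_app[OF Yr Xr FF_colinear_linear[OF VP.smult_colinear[OF f k]], simplified]
          Psi_app[OF Yr Xr FF_colinear_linear[OF f]] tens_ract[OF Xr M_sides(1)]
          finsum_rtensor_ract[OF Xr Mt_bimodule] sw)
  qed (simp_all add: Psi_def)
  show ?thesis
    unfolding linear_iso_def using V bij add smult by (simp add: Hom_comod_def)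
qed

end

text \<open>By \<open>Psi_app\<close> both sides at y equal the sum of k(f(h y \<otimes> e_i))
  \<otimes> e'_i.\<close>

lemma Psi_natural:
  assumes Y: "comodule S D Y" and Y': "comodule S D Y'" and X: "comodule A C X" and X': "comodule A C X'"
    and h: "h \<in> colinear_maps S D Y' Y" and k: "k \<in> colinear_maps A C X X'"
    and f: "f \<in> colinear_maps A C (FF Y) X"
  shows "Psi A M Y' X' (compose (carrier (FF Y')) k (compose (carrier (FF Y')) f (tensor_Sigma_map A M Y' Y h)))
    = compose (carrier Y') (tensor_Sigma_dual_map A M X X' k) (compose (carrier Y') (Psi A M Y X f) h)"
proof (rule extensionalityI[of _ "carrier Y'"], unfold FF_simps)
  note Yr = Y_right[OF Y] and Yr' = Y_right[OF Y'] and Xr = X_right[OF X] and Xr' = X_right[OF X']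
  note hl = colinear_maps_right_linear[OF h] and kl = colinear_maps_right_linear[OF k]
    and fl = FF_colinear_linear[OF Y X f]
  let ?h = "tensor_map S Y' Ms Y Ms h (\<lambda>u. u)"
  let ?F = "tensor_group S Y' Ms"
  let ?c = "compose (carrier ?F) k (compose (carrier ?F) f (tensor_Sigma_map A M Y' Y h))"
  have Hl: "right_linear A (FM Y') (FM Y) ?h"
    by (rule right_linear_tensor_map[OF Yr' Ms_bimodule Yr Ms_bimodule hl left_linear_ident right_linear_ident])
  have cl: "right_linear A (FM Y') X' ?c"
    using right_linear_compose[OF FM_right[OF Yr'] right_linear_compose[OF FM_right[OF Yr'] Hl fl] kl]
    by (simp add: tensor_Sigma_map_def)
  note ht = tensor_map_tens[OF Yr' Ms_left Yr Ms_left hl left_linear_ident]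
  note kh = addhom_tensor_map[OF Xr M_sides(1) Xr' M_sides(1) kl left_linear_ident]
    and kt = tensor_map_tens[OF Xr M_sides(1) Xr' M_sides(1) kl left_linear_ident]
  have ab: "abelian_group (tensor_group A X Mt)" "abelian_group (tensor_group A X' Mt)"
    using Xr Xr' by simp_all
  fix y assume y: "y \<in> carrier Y'"
  have hy: "h y \<in> carrier Y" by (rule addhom_closed[OF right_linear_addhom[OF hl] y])
  have fc: "f (tens S Y Ms (h y) u) \<in> carrier X" if "u \<in> carrier M" for u
    using that hy addhom_closed[OF right_linear_addhom[OF fl], of "tens S Y Ms (h y) u"] by simp
  show "Psi A M Y' X' ?c y = compose (carrier Y') (tensor_Sigma_dual_map A M X X' k) (compose (carrier Y') (Psi A M Y X f) h) y"
    using y hy fc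
    by (simp add: Psi_app[OF Yr' Xr' cl] compose_eq Psi_app[OF Yr Xr fl] tensor_Sigma_dual_map_def
        addhom_finsum_nat[OF ab kh] kt, simp add: tensor_Sigma_map_def ht)
qed (simp_all add: Psi_def compose_extensional)

section \<open>Functor laws\<close>

lemma tensor_Sigma_map_ident:
  assumes Y: "comodule S D Y"
  shows "tensor_Sigma_map A M Y Y (\<lambda>y\<in>carrier Y. y) = (\<lambda>t\<in>carrier (FF Y). t)"
  using tensor_map_restrict_ident[OF Y_right[OF Y] Ms_left] by (simp add: tensor_Sigma_map_def)

lemma tensor_Sigma_map_compose:
  assumes "comodule S D Y" "comodule S D Y'" "comodule S D Y''"
    and "h \<in> colinear_maps S D Y' Y" "h' \<in> colinear_maps S D Y'' Y'"
  shows "tensor_Sigma_map A M Y'' Y (compose (carrier Y'') h h')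
    = compose (carrier (FF Y'')) (tensor_Sigma_map A M Y' Y h) (tensor_Sigma_map A M Y'' Y' h')"
  using tensor_map_compose[OF Y_right Y_right Y_right Ms_left colinear_maps_right_linear
      colinear_maps_right_linear, OF assms(3,2,1,5,4)]
  by (simp add: tensor_Sigma_map_def)

lemma tensor_Sigma_dual_map_ident:
  assumes X: "comodule A C X"
  shows "tensor_Sigma_dual_map A M X X (\<lambda>x\<in>carrier X. x) = (\<lambda>t\<in>carrier (GG X). t)"
  using tensor_map_restrict_ident[OF X_right[OF X] M_sides(1)] by (simp add: tensor_Sigma_dual_map_def)

lemma tensor_Sigma_dual_map_compose:
  assumes "comodule A C X" "comodule A C X'" "comodule A C X''"
    and "k \<in> colinear_maps A C X X'" "k' \<in> colinear_maps A C X' X''"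
  shows "tensor_Sigma_dual_map A M X X'' (compose (carrier X) k' k)
    = compose (carrier (GG X)) (tensor_Sigma_dual_map A M X' X'' k') (tensor_Sigma_dual_map A M X X' k)"
  using tensor_map_compose[OF X_right X_right X_right M_sides(1) colinear_maps_right_linear
      colinear_maps_right_linear, OF assms(1,2,3,4,5)]
  by (simp add: tensor_Sigma_dual_map_def)

end

section \<open>Extending the dual basis beyond its range, and the final assembly\<close>

lemma finsum_cong_simp:
  "A = B \<Longrightarrow> (\<And>i. i \<in> B =simp=> f i = g i) \<Longrightarrow> finsum G f A = finsum G g B"
  by (auto simp: simp_implies_def intro: finsum_ext)

text \<open>Only indices below n enter these constructions; \<open>finsum_cong_simp\<close> hands
  the bound on the index to the simplifier while it rewrites a summand.\<close>

lemma dual_basis_data_cong: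
  assumes "\<And>i. i < n \<Longrightarrow> e i = E i" "\<And>i. i < n \<Longrightarrow> e' i = E' i"
  shows "comatrix A B M n e e' = comatrix A B M n E E'"
    and "tensor_Sigma A B M n e e' Y = tensor_Sigma A B M n E E' Y"
  using assms by (simp_all add: comatrix_def tensor_Sigma_def Let_def cong: finsum_cong_simp)

text \<open>Padding by zero beyond n meets the demand of \<open>comatrix_setup\<close> that all
  values lie in the carriers, without altering any sum over the range.\<close>

lemma dual_basis_total:
  assumes M: "abelian_group M" and basis: "dual_basis A M n e e'" and zero: "\<zero>\<^bsub>dual A M\<^esub> \<in> carrier (dual A M)"
  obtains E E' where "dual_basis A M n E E'" "\<And>i. E i \<in> carrier M" "\<And>i. E' i \<in> carrier (dual A M)"
    "\<And>i. i < n \<Longrightarrow> e i = E i" "\<And>i. i < n \<Longrightarrow> e' i = E' i"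
proof
  let ?E = "\<lambda>i. if i < n then e i else \<zero>\<^bsub>M\<^esub>" and ?E' = "\<lambda>i. if i < n then e' i else \<zero>\<^bsub>dual A M\<^esub>"
  have "finsum M (\<lambda>i. ?E i \<triangleleft>\<^bsub>M\<^esub> ?E' i x) {..<n} = finsum M (\<lambda>i. e i \<triangleleft>\<^bsub>M\<^esub> e' i x) {..<n}" for x
    by (rule finsum_ext) simp
  then show "dual_basis A M n ?E ?E'"
    using basis by (simp add: dual_basis_def)
  show "?E i \<in> carrier M" "?E' i \<in> carrier (dual A M)" for i
    using basis zero abelian_groupE(2)[OF M] by (auto simp: dual_basis_def)
qed simp_all

theorem proposition1p2:
  fixes K :: "('k, 'xk) ring_scheme"
    and A :: "('k, 'a, 'xa) module_scheme"
    and B :: "('k, 'b, 'xb) module_scheme"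
    and M :: "('b, 'a, 'm, 'xm) bimod_scheme"
    and n :: nat and e :: "nat \<Rightarrow> 'm" and e' :: "nat \<Rightarrow> 'm \<Rightarrow> 'a"
    and Y :: "('m \<Rightarrow> 'm, (('m \<Rightarrow> 'm) \<times> ('m \<Rightarrow> 'm) \<Rightarrow>\<^sub>0 int) set, 'y, 'xy) comod_scheme"
    and Y' :: "('m \<Rightarrow> 'm, (('m \<Rightarrow> 'm) \<times> ('m \<Rightarrow> 'm) \<Rightarrow>\<^sub>0 int) set, 'y1, 'xy1) comod_scheme"
    and Y'' :: "('m \<Rightarrow> 'm, (('m \<Rightarrow> 'm) \<times> ('m \<Rightarrow> 'm) \<Rightarrow>\<^sub>0 int) set, 'y2, 'xy2) comod_scheme"
    and X :: "('a, (('m \<Rightarrow> 'a) \<times> 'm \<Rightarrow>\<^sub>0 int) set, 'x, 'xx) comod_scheme"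
    and X' :: "('a, (('m \<Rightarrow> 'a) \<times> 'm \<Rightarrow>\<^sub>0 int) set, 'x1, 'xx1) comod_scheme"
    and X'' :: "('a, (('m \<Rightarrow> 'a) \<times> 'm \<Rightarrow>\<^sub>0 int) set, 'x2, 'xx2) comod_scheme"
  defines "S \<equiv> End_alg A M"
    and "C \<equiv> comatrix A B M n e e'"
    and "D \<equiv> End_sweedler A B M"
    and "F \<equiv> tensor_Sigma A B M n e e' Y"
    and "F' \<equiv> tensor_Sigma A B M n e e' Y'"
    and "F'' \<equiv> tensor_Sigma A B M n e e' Y''"
    and "G \<equiv> tensor_Sigma_dual A B M X"
    and "G' \<equiv> tensor_Sigma_dual A B M X'"
    and "G'' \<equiv> tensor_Sigma_dual A B M X''"
  assumes bimodule: "central_bimodule K B A M"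
    and fin_gen: "finitely_generated A M"
    and projective: "projective A M"
    and dual_basis: "dual_basis A M n e e'"
    and Y: "comodule S D Y" and Y': "comodule S D Y'" and Y'': "comodule S D Y''"
    and X: "comodule A C X" and X': "comodule A C X'" and X'': "comodule A C X''"
  shows
    "coring K A C \<and> coring K S D \<and>

     \<comment> \<open>\<open>- \<otimes>\<^sub>S \<Sigma>\<close> is a functor\<close>
     comodule A C F \<and>
     tensor_Sigma_map A M Y Y (\<lambda>y\<in>carrier Y. y) = (\<lambda>t\<in>carrier F. t) \<and>
     (\<forall>h\<in>colinear_maps S D Y' Y. tensor_Sigma_map A M Y' Y h \<in> colinear_maps A C F' F) \<and>
     (\<forall>h\<in>colinear_maps S D Y' Y. \<forall>h'\<in>colinear_maps S D Y'' Y'.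
        tensor_Sigma_map A M Y'' Y (compose (carrier Y'') h h') =
          compose (carrier F'') (tensor_Sigma_map A M Y' Y h) (tensor_Sigma_map A M Y'' Y' h')) \<and>

     \<comment> \<open>\<open>- \<otimes>\<^sub>A \<Sigma>\<^sup>*\<close> is a functor\<close>
     comodule S D G \<and>
     tensor_Sigma_dual_map A M X X (\<lambda>x\<in>carrier X. x) = (\<lambda>t\<in>carrier G. t) \<and>
     (\<forall>k\<in>colinear_maps A C X X'. tensor_Sigma_dual_map A M X X' k \<in> colinear_maps S D G G') \<and>
     (\<forall>k\<in>colinear_maps A C X X'. \<forall>k'\<in>colinear_maps A C X' X''.
        tensor_Sigma_dual_map A M X X'' (compose (carrier X) k' k) =
          compose (carrier G) (tensor_Sigma_dual_map A M X' X'' k') (tensor_Sigma_dual_map A M X X' k)) \<and>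

     \<comment> \<open>\<open>\<Psi>\<close> is a \<open>K\<close>-linear isomorphism with the stated inverse\<close>
     linear_iso K (Hom_comod A C F X) (Hom_comod S D Y G) (Psi A M Y X) \<and>
     (\<forall>g\<in>colinear_maps S D Y G. Psi_inv A M n e e' Y X g \<in> colinear_maps A C F X \<and>
        Psi A M Y X (Psi_inv A M n e e' Y X g) = g) \<and>
     (\<forall>f\<in>colinear_maps A C F X. Psi_inv A M n e e' Y X (Psi A M Y X f) = f) \<and>

     \<comment> \<open>\<open>\<Psi>\<close> is natural\<close>
     (\<forall>h\<in>colinear_maps S D Y' Y. \<forall>k\<in>colinear_maps A C X X'. \<forall>f\<in>colinear_maps A C F X.
        Psi A M Y' X' (compose (carrier F') k (compose (carrier F') f (tensor_Sigma_map A M Y' Y h))) =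
          compose (carrier Y') (tensor_Sigma_dual_map A M X X' k) (compose (carrier Y') (Psi A M Y X f) h))"
proof -
  interpret MM: central_bimodule K B A M by (rule bimodule)
  \<comment> \<open>The padding value must be a linear form. This is checked directly because
    \<open>comatrix_setup\<close> becomes available only after the padding.\<close>
  have zero: "\<zero>\<^bsub>dual A M\<^esub> \<in> carrier (dual A M)"
  proof -
    have "\<zero>\<^bsub>A\<^esub> \<oplus>\<^bsub>A\<^esub> \<zero>\<^bsub>A\<^esub> = \<zero>\<^bsub>A\<^esub>" by simp
    then show ?thesis
      by (auto simp: dual_def Lin_def right_linear_def MM.ract_closed)
  qed
  \<comment> \<open>From here on the padded basis replaces the given one. The comatrix coring, the
    functor to its comodules and \<open>Psi_inv\<close> stay the same, since they read only indices
    below n.\<close>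
  obtain E E' where E: "dual_basis A M n E E'" "\<And>i. E i \<in> carrier M" "\<And>i. E' i \<in> carrier (dual A M)"
    and eq: "\<And>i. i < n \<Longrightarrow> e i = E i" "\<And>i. i < n \<Longrightarrow> e' i = E' i"
    using dual_basis_total[OF MM.M.abelian_group_axioms dual_basis zero] by blast
  interpret comatrix_setup K A B M n E E'
    by (rule comatrix_setup.intro[OF bimodule E])
  have C: "C = comatrix A B M n E E'"
    unfolding C_def by (rule dual_basis_data_cong(1)[OF eq])
  have F: "F = tensor_Sigma A B M n E E' Y" "F' = tensor_Sigma A B M n E E' Y'"
    "F'' = tensor_Sigma A B M n E E' Y''"
    unfolding F_def F'_def F''_def by (rule dual_basis_data_cong(2)[OF eq]; assumption)+
  have inv: "Psi_inv A M n e e' Y X g = Psi_inv A M n E E' Y X g" for g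
    using dual_basis_data_cong(1)[OF eq, where A = A and B = S and M = "End_bimod M"]
    by (simp add: Psi_inv_def Let_def S_def)
  note Ys = Y[unfolded S_def D_def] Y'[unfolded S_def D_def] Y''[unfolded S_def D_def]
  note Xs = X[unfolded C] X'[unfolded C] X''[unfolded C]
  show ?thesis
    unfolding inv F C G_def G'_def G''_def S_def D_def
    by (intro conjI ballI coring_C coring_D comodule_FF[OF Ys(1)] comodule_GG[OF Xs(1)]
        tensor_Sigma_map_ident[OF Ys(1)] tensor_Sigma_dual_map_ident[OF Xs(1)]
        tensor_Sigma_map_colinear[OF Ys(1,2)] tensor_Sigma_map_compose[OF Ys]
        tensor_Sigma_dual_map_colinear[OF Xs(1,2)] tensor_Sigma_dual_map_compose[OF Xs]
        Psi_linear_iso[OF Ys(1) Xs(1)] Psi_inv_colinear[OF Ys(1) Xs(1)]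
        Psi_Psi_inv[OF Ys(1) Xs(1)] Psi_inv_Psi[OF Ys(1) Xs(1)]
        Psi_natural[OF Ys(1,2) Xs(1,2)])
qed

end
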